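(* Let $(M,g,\mathcal V,\mathcal F)$ be a non-degenerate second order properly superintegrable system in dimension two, with structure tensor $T_{ijk}=S_{ijk}+t_ig_{jk}+t_jg_{ik}-g_{ij}t_k$, $t_i=\nabla_it$, and $\Xi_{ij}=(\nabla^a+\tfrac23t^a)S_{ija}$ (see context). Then the following prolongation (closed system) holds: \begin{align*} \Delta t&=\tfrac32R+\tfrac13S^{abc}S_{abc},\\ \mathring\nabla^2_{ij}t&=S_{ija}t^a+\tfrac43\bigl(t_it_j-\tfrac12g_{ij}t^at_a\bigr)-\tfrac12\Xi_{ij},\\ \nabla_lS_{ijk}&=\tfrac16\,\mathrm{Sym}^\circ_{ijk}\Bigl[-\tfrac23S_{ijk}t_l+2t_iS_{jkl}+\Xi_{ij}g_{kl}\Bigr],\\ \nabla_k\Xi_{ij}&=\tfrac13S_{ijk}S^{abc}S_{abc}+\tfrac29\,\mathrm{Sym}_{ijk}\Bigl(\Xi_{jk}t_i-\tfrac12g_{ij}\Xi_{ka}t^a\Bigr)+\tfrac23\,\mathrm{Sym}^\circ_{ij}\bigl(g_{jk}S_{iab}\Xi^{ab}\bigr), \end{align*} where $\mathring\nabla^2t$ denotes the trace-free part of the Hessian of $t$, together with the algebraic condition $$\tfrac23\Xi_{ia}t^a+\tfrac49S_{iab}t^at^b+\tfrac59S_{abc}S^{abc}t_i-S_{iab}\Xi^{ab}=\tfrac12\nabla_iR-Rt_i.$$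
   Context: All objects are smooth, real and local. $(M,g)$ is a surface with Riemannian metric, $\nabla$ its Levi-Civita connection, a comma denotes covariant differentiation, indices are raised and lowered with $g$, $\Delta=\nabla^a\nabla_a$, and $R$ is the scalar curvature (twice the Gauss curvature). Symmetrisers: $\mathrm{Sym}_{ij}X_{ij}=X_{ij}+X_{ji}$; $\mathrm{Sym}_{ijk}$ is the sum over all 6 permutations of $(i,j,k)$; the superscript $\circ$ means that the result is additionally projected onto its completely trace-free part in the indicated indices, e.g. $\mathrm{Sym}^\circ_{ij}X_{ij}=X_{ij}+X_{ji}-g_{ij}X^a{}_a$. For a Hamiltonian $H=g^{ij}p_ip_j+V$ on $T^*M$, a second order integral is a function $F=K^{ij}p_ip_j+W$ ($K^{ij}$ symmetric; $K^{ij},W$ depending only on position) with $\{F,H\}=0$. Then $K_{ij}$ is a Killing tensor, $K_{ij,k}+K_{jk,i}+K_{ki,j}=0$, and compatibility with $V$ (Bertrand-Darboux condition) is that the antisymmetrisation in $(i,j)$ of $K^m{}_iV_{,jm}+K^m{}_{i,j}V_{,m}$ vanishes. Non-degenerate second order properly superintegrable system in dimension two: a quadruple $(M,g,\mathcal V,\mathcal F)$ with a 3-dimensional space $\mathcal F$ of second order integrals, containing $H$ and spanned by three functionally independent ones, whose Killing tensors form an irreducible set of endomorphisms (irreducibility), and a 4-dimensional linear space $\mathcal V$ of potentials such that for every $V\in\mathcal V$ the Bertrand-Darboux condition holds for all integrals in $\mathcal F$, and $$V_{,ij}=T_{ij}{}^kV_{,k}+\tfrac12g_{ij}\Delta V$$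 with a tensor $T_{ijk}$ independent of $V$. The structure tensor $T$ is unique, symmetric and trace-free in $(i,j)$, and one has $T_{ijk}=S_{ijk}+t_ig_{jk}+t_jg_{ik}-g_{ij}t_k$ where $S_{ijk}$ is totally symmetric and trace-free and $t_i=\frac12T_{ai}{}^a=\nabla_it$ for a function $t$, unique up to an additive constant. *)

theory Defs
  imports "HOL-Analysis.Analysis"
begin

text \<open>
  Everything is local: the surface \<open>M\<close> is a chart domain, i.e. a connected open set \<open>U\<close> of \<open>real ^ 2\<close>,
  and tensor fields are given by their components in the chart. Values of fields outside \<open>U\<close> are
  irrelevant. Indices range over the two-element type \<open>2\<close>. Unless said otherwise, tensor fields are
  given by their fully covariant components; indices are raised explicitly where a formula
  needs it.
\<close>

type_synonym point = "real ^ 2"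
type_synonym scalar = "point \<Rightarrow> real"
type_synonym tensor1 = "2 \<Rightarrow> scalar"
type_synonym tensor2 = "2 \<Rightarrow> 2 \<Rightarrow> scalar"
type_synonym tensor3 = "2 \<Rightarrow> 2 \<Rightarrow> 2 \<Rightarrow> scalar"
type_synonym phase_fun = "point \<times> (real ^ 2) \<Rightarrow> real"

section \<open>Smooth functions\<close>

definition pd :: "2 \<Rightarrow> scalar \<Rightarrow> scalar" where
  "pd i f x = frechet_derivative f (at x) (axis i 1)"

text \<open>All iterated partial derivatives exist and are differentiable at every point of the open set \<open>U\<close>.\<close>

definition smooth_fun :: "point set \<Rightarrow> scalar \<Rightarrow> bool" where
  "smooth_fun U f \<longleftrightarrow> (\<forall>is. \<forall>x\<in>U. foldr pd is f differentiable (at x))"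

section \<open>Riemannian metric, Levi-Civita connection, scalar curvature\<close>

type_synonym metric = "point \<Rightarrow> real ^ 2 ^ 2"

definition gl :: "metric \<Rightarrow> tensor2" where
  "gl g i j x = g x $ i $ j"

definition gu :: "metric \<Rightarrow> tensor2" where
  "gu g i j x = matrix_inv (g x) $ i $ j"

definition riemannian_metric :: "point set \<Rightarrow> metric \<Rightarrow> bool" where
  "riemannian_metric U g \<longleftrightarrow>
     (\<forall>i j. smooth_fun U (gl g i j)) \<and>
     (\<forall>x\<in>U. transpose (g x) = g x \<and> (\<forall>v. v \<noteq> 0 \<longrightarrow> v \<bullet> (g x *v v) > 0))"

definition christoffel :: "metric \<Rightarrow> 2 \<Rightarrow> 2 \<Rightarrow> 2 \<Rightarrow> scalar" where
  "christoffel g k i j x =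
     (1/2) * (\<Sum>l\<in>UNIV. gu g k l x * (pd i (gl g l j) x + pd j (gl g l i) x - pd l (gl g i j) x))"

text \<open>
  In \<open>nabla1 g w l i\<close>, \<open>nabla2 g A l i j\<close>, \<open>nabla3 g A l i j k\<close> the index \<open>l\<close> of the derivative
  comes first: e.g. \<open>nabla2 g A l i j\<close> is $\nabla_l A_{ij} = A_{ij,l}$.
\<close>

definition nabla1 :: "metric \<Rightarrow> tensor1 \<Rightarrow> tensor2" where
  "nabla1 g w l i x = pd l (w i) x - (\<Sum>a\<in>UNIV. christoffel g a l i x * w a x)"

definition nabla2 :: "metric \<Rightarrow> tensor2 \<Rightarrow> tensor3" where
  "nabla2 g A l i j x = pd l (A i j) x
     - (\<Sum>a\<in>UNIV. christoffel g a l i x * A a j x)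
     - (\<Sum>a\<in>UNIV. christoffel g a l j x * A i a x)"

definition nabla3 :: "metric \<Rightarrow> tensor3 \<Rightarrow> 2 \<Rightarrow> tensor3" where
  "nabla3 g A l i j k x = pd l (A i j k) x
     - (\<Sum>a\<in>UNIV. christoffel g a l i x * A a j k x)
     - (\<Sum>a\<in>UNIV. christoffel g a l j x * A i a k x)
     - (\<Sum>a\<in>UNIV. christoffel g a l k x * A i j a x)"

definition grad :: "scalar \<Rightarrow> tensor1" where
  "grad f i = pd i f"

text \<open>\<open>hess g f i j\<close> is $f_{,ij} = \nabla_j\nabla_i f$.\<close>

definition hess :: "metric \<Rightarrow> scalar \<Rightarrow> tensor2" where
  "hess g f i j = nabla1 g (grad f) j i"

definition laplacian :: "metric \<Rightarrow> scalar \<Rightarrow> scalar" where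
  "laplacian g f x = (\<Sum>a\<in>UNIV. \<Sum>b\<in>UNIV. gu g a b x * hess g f a b x)"

text \<open>
  \<open>riemann g d c a b\<close> is $R^d{}_{cab}$ with
  $(\nabla_a\nabla_b-\nabla_b\nabla_a)X^d = R^d{}_{cab}X^c$; the round unit sphere has scalar curvature \<open>2\<close>.
\<close>

definition riemann :: "metric \<Rightarrow> 2 \<Rightarrow> tensor3" where
  "riemann g d c a b x = pd a (christoffel g d b c) x - pd b (christoffel g d a c) x
     + (\<Sum>e\<in>UNIV. christoffel g d a e x * christoffel g e b c x)
     - (\<Sum>e\<in>UNIV. christoffel g d b e x * christoffel g e a c x)"

definition scalar_curv :: "metric \<Rightarrow> scalar" where
  "scalar_curv g x = (\<Sum>a\<in>UNIV. \<Sum>b\<in>UNIV. \<Sum>c\<in>UNIV. gu g b c x * riemann g a c a b x)"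

section \<open>Index gymnastics and symmetrisers\<close>

definition up1 :: "metric \<Rightarrow> tensor1 \<Rightarrow> tensor1" where
  "up1 g w a x = (\<Sum>b\<in>UNIV. gu g a b x * w b x)"

definition up2 :: "metric \<Rightarrow> tensor2 \<Rightarrow> tensor2" where
  "up2 g A a b x = (\<Sum>c\<in>UNIV. \<Sum>d\<in>UNIV. gu g a c x * gu g b d x * A c d x)"

definition up3 :: "metric \<Rightarrow> tensor3 \<Rightarrow> tensor3" where
  "up3 g A a b c x =
     (\<Sum>d\<in>UNIV. \<Sum>e\<in>UNIV. \<Sum>f\<in>UNIV. gu g a d x * gu g b e x * gu g c f x * A d e f x)"

text \<open>The full contraction $A^{abc}A_{abc}$.\<close>

definition normsq3 :: "metric \<Rightarrow> tensor3 \<Rightarrow> scalar" where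
  "normsq3 g A x = (\<Sum>a\<in>UNIV. \<Sum>b\<in>UNIV. \<Sum>c\<in>UNIV. up3 g A a b c x * A a b c x)"

text \<open>The symmetrisers act pointwise, on the components of a tensor at the point \<open>x\<close>.\<close>

definition sym3 :: "(2 \<Rightarrow> 2 \<Rightarrow> 2 \<Rightarrow> real) \<Rightarrow> 2 \<Rightarrow> 2 \<Rightarrow> 2 \<Rightarrow> real" where
  "sym3 X i j k = X i j k + X i k j + X j i k + X j k i + X k i j + X k j i"

definition trace2 :: "metric \<Rightarrow> point \<Rightarrow> (2 \<Rightarrow> 2 \<Rightarrow> real) \<Rightarrow> real" where
  "trace2 g x X = (\<Sum>a\<in>UNIV. \<Sum>b\<in>UNIV. gu g a b x * X a b)"

definition sym2o :: "metric \<Rightarrow> point \<Rightarrow> (2 \<Rightarrow> 2 \<Rightarrow> real) \<Rightarrow> 2 \<Rightarrow> 2 \<Rightarrow> real" where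
  "sym2o g x X i j = X i j + X j i - gl g i j x * trace2 g x X"

text \<open>
  Projection of a totally symmetric \<open>Y\<close> onto its completely trace-free part. With
  $y_k = Y^a{}_{ak}$, the trace of $g_{ij}y_k+g_{ik}y_j+g_{jk}y_i$ is $(n+2)\,y_k = 4y_k$.
\<close>

definition tracefree3 :: "metric \<Rightarrow> point \<Rightarrow> (2 \<Rightarrow> 2 \<Rightarrow> 2 \<Rightarrow> real) \<Rightarrow> 2 \<Rightarrow> 2 \<Rightarrow> 2 \<Rightarrow> real" where
  "tracefree3 g x Y i j k = Y i j k
     - (1/4) * (gl g i j x * trace2 g x (\<lambda>a b. Y a b k)
              + gl g i k x * trace2 g x (\<lambda>a b. Y a b j)
              + gl g j k x * trace2 g x (\<lambda>a b. Y a b i))"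

definition sym3o :: "metric \<Rightarrow> point \<Rightarrow> (2 \<Rightarrow> 2 \<Rightarrow> 2 \<Rightarrow> real) \<Rightarrow> 2 \<Rightarrow> 2 \<Rightarrow> 2 \<Rightarrow> real" where
  "sym3o g x X = tracefree3 g x (sym3 X)"

definition tracefree_hess :: "metric \<Rightarrow> scalar \<Rightarrow> tensor2" where
  "tracefree_hess g f i j x = hess g f i j x - (1/2) * gl g i j x * laplacian g f x"

section \<open>Second order integrals\<close>

definition dx :: "2 \<Rightarrow> phase_fun \<Rightarrow> phase_fun" where
  "dx i F z = frechet_derivative F (at z) (axis i 1, 0)"

definition dp :: "2 \<Rightarrow> phase_fun \<Rightarrow> phase_fun" where
  "dp i F z = frechet_derivative F (at z) (0, axis i 1)"

definition poisson :: "phase_fun \<Rightarrow> phase_fun \<Rightarrow> phase_fun" where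
  "poisson F G z = (\<Sum>i\<in>UNIV. dx i F z * dp i G z - dp i F z * dx i G z)"

definition hamiltonian :: "metric \<Rightarrow> scalar \<Rightarrow> phase_fun" where
  "hamiltonian g V = (\<lambda>(x, p). (\<Sum>i\<in>UNIV. \<Sum>j\<in>UNIV. gu g i j x * p $ i * p $ j) + V x)"

text \<open>Here, and below in the context of integrals, \<open>K\<close> has contravariant components $K^{ij}$.\<close>

definition second_order :: "point set \<Rightarrow> phase_fun \<Rightarrow> tensor2 \<Rightarrow> scalar \<Rightarrow> bool" where
  "second_order U F K W \<longleftrightarrow>
     (\<forall>i j. smooth_fun U (K i j)) \<and> smooth_fun U W \<and>
     (\<forall>x\<in>U. \<forall>i j. K i j x = K j i x) \<and>
     (\<forall>x\<in>U. \<forall>p. F (x, p) = (\<Sum>i\<in>UNIV. \<Sum>j\<in>UNIV. K i j x * p $ i * p $ j) + W x)"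

definition second_order_integral :: "point set \<Rightarrow> phase_fun \<Rightarrow> phase_fun \<Rightarrow> bool" where
  "second_order_integral U H F \<longleftrightarrow>
     (\<exists>K W. second_order U F K W) \<and> (\<forall>x\<in>U. \<forall>p. poisson F H (x, p) = 0)"

definition mixed :: "metric \<Rightarrow> tensor2 \<Rightarrow> tensor2" where
  "mixed g K i j x = (\<Sum>a\<in>UNIV. K i a x * gl g a j x)"

definition low2 :: "metric \<Rightarrow> tensor2 \<Rightarrow> tensor2" where
  "low2 g K i j x = (\<Sum>a\<in>UNIV. \<Sum>b\<in>UNIV. gl g i a x * gl g j b x * K a b x)"

text \<open>\<open>bd_form g K V i j\<close> is $K^m{}_iV_{,jm}+K^m{}_{i,j}V_{,m}$, with $K^m{}_{i,j} = g^{mn}K_{ni,j}$.\<close>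

definition bd_form :: "metric \<Rightarrow> tensor2 \<Rightarrow> scalar \<Rightarrow> tensor2" where
  "bd_form g K V i j x =
     (\<Sum>m\<in>UNIV. mixed g K m i x * hess g V j m x
       + (\<Sum>n\<in>UNIV. gu g m n x * nabla2 g (low2 g K) j n i x) * grad V m x)"

definition bertrand_darboux :: "point set \<Rightarrow> metric \<Rightarrow> tensor2 \<Rightarrow> scalar \<Rightarrow> bool" where
  "bertrand_darboux U g K V \<longleftrightarrow>
     (\<forall>x\<in>U. \<forall>i j. bd_form g K V i j x - bd_form g K V j i x = 0)"

definition irreducible_endos :: "(real ^ 2 ^ 2) set \<Rightarrow> bool" where
  "irreducible_endos E \<longleftrightarrow>
     (\<forall>L. subspace L \<and> (\<forall>A\<in>E. \<forall>v\<in>L. A *v v \<in> L) \<longrightarrow> L = {0} \<or> L = UNIV)"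

definition killing_endos :: "point set \<Rightarrow> metric \<Rightarrow> phase_fun set \<Rightarrow> point \<Rightarrow> (real ^ 2 ^ 2) set" where
  "killing_endos U g \<F> x =
     {\<chi> i j. mixed g K i j x | K W F. F \<in> \<F> \<and> second_order U F K W}"

text \<open>
  \<open>b 0, \<dots>, b (n - 1)\<close> is a basis of the linear space \<open>X\<close> of functions on \<open>A\<close>. As HOL functions are
  total, functions on \<open>A\<close> are represented by arbitrary extensions, and \<open>X\<close> is closed under changing
  values outside \<open>A\<close>.
\<close>

definition fun_basis :: "'a set \<Rightarrow> ('a \<Rightarrow> real) set \<Rightarrow> nat \<Rightarrow> (nat \<Rightarrow> 'a \<Rightarrow> real) \<Rightarrow> bool" where
  "fun_basis A X n b \<longleftrightarrow>
     X = {f. \<exists>c. \<forall>x\<in>A. f x = (\<Sum>i<n. c i * b i x)} \<and>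
     (\<forall>c. (\<forall>x\<in>A. (\<Sum>i<n. c i * b i x) = 0) \<longrightarrow> (\<forall>i<n. c i = 0))"

text \<open>The differentials are linearly independent at the points of a dense subset of \<open>T\<^sup>*U\<close>.\<close>

definition functionally_independent :: "point set \<Rightarrow> nat \<Rightarrow> (nat \<Rightarrow> phase_fun) \<Rightarrow> bool" where
  "functionally_independent U n F \<longleftrightarrow>
     U \<times> UNIV \<subseteq> closure {z \<in> U \<times> UNIV.
       \<forall>c. (\<forall>v. (\<Sum>i<n. c i * frechet_derivative (F i) (at z) v) = 0) \<longrightarrow> (\<forall>i<n. c i = 0)}"

section \<open>Superintegrable systems and their structure tensor\<close>

text \<open>
  $V_{,ij} = T_{ij}{}^kV_{,k}+\frac12 g_{ij}\Delta V$ for all \<open>V\<close> in \<open>\<V>\<close>.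
\<close>

definition structure_tensor :: "point set \<Rightarrow> metric \<Rightarrow> scalar set \<Rightarrow> tensor3 \<Rightarrow> bool" where
  "structure_tensor U g \<V> T \<longleftrightarrow>
     (\<forall>i j k. smooth_fun U (T i j k)) \<and>
     (\<forall>V\<in>\<V>. \<forall>x\<in>U. \<forall>i j.
        hess g V i j x = (\<Sum>k\<in>UNIV. T i j k x * up1 g (grad V) k x)
          + (1/2) * gl g i j x * laplacian g V x)"

text \<open>
  The integrals in \<open>\<F>\<close> are those of one Hamiltonian, whose potential \<open>V0\<close> belongs to \<open>\<V>\<close>; all other
  potentials in \<open>\<V>\<close> are tied to \<open>\<F>\<close> by the Bertrand-Darboux condition.
\<close>

definition nondeg_superintegrable ::
  "point set \<Rightarrow> metric \<Rightarrow> scalar set \<Rightarrow> phase_fun set \<Rightarrow> bool" where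
  "nondeg_superintegrable U g \<V> \<F> \<longleftrightarrow>
     open U \<and> connected U \<and> riemannian_metric U g \<and>
     (\<exists>b. fun_basis U \<V> 4 b) \<and> (\<forall>V\<in>\<V>. smooth_fun U V) \<and>
     (\<exists>V0\<in>\<V>. hamiltonian g V0 \<in> \<F> \<and>
        (\<forall>F\<in>\<F>. second_order_integral U (hamiltonian g V0) F)) \<and>
     (\<exists>F. fun_basis (U \<times> UNIV) \<F> 3 F \<and> functionally_independent U 3 F) \<and>
     (\<forall>x\<in>U. irreducible_endos (killing_endos U g \<F> x)) \<and>
     (\<forall>F\<in>\<F>. \<forall>K W. second_order U F K W \<longrightarrow> (\<forall>V\<in>\<V>. bertrand_darboux U g K V)) \<and>
     (\<exists>T. structure_tensor U g \<V> T)"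

text \<open>
  $T_{ijk}=S_{ijk}+t_ig_{jk}+t_jg_{ik}-g_{ij}t_k$ with \<open>S\<close> totally symmetric and trace-free and
  $t_i=\nabla_it$; the relation $t_i=\frac12T_{ai}{}^a$ follows by taking a trace.
\<close>

definition structure_decomposition ::
  "point set \<Rightarrow> metric \<Rightarrow> tensor3 \<Rightarrow> tensor3 \<Rightarrow> scalar \<Rightarrow> bool" where
  "structure_decomposition U g T S t \<longleftrightarrow>
     (\<forall>i j k. smooth_fun U (S i j k)) \<and> smooth_fun U t \<and>
     (\<forall>x\<in>U. \<forall>i j k. S i j k x = S j i k x \<and> S i j k x = S i k j x) \<and>
     (\<forall>x\<in>U. \<forall>k. trace2 g x (\<lambda>a b. S a b k x) = 0) \<and>
     (\<forall>x\<in>U. \<forall>i j k. T i j k x =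
        S i j k x + grad t i x * gl g j k x + grad t j x * gl g i k x - gl g i j x * grad t k x)"

text \<open>$\Xi_{ij} = (\nabla^a+\frac23t^a)S_{ija}$\<close>

definition Xi :: "metric \<Rightarrow> tensor3 \<Rightarrow> scalar \<Rightarrow> tensor2" where
  "Xi g S t i j x =
     (\<Sum>a\<in>UNIV. \<Sum>b\<in>UNIV. gu g a b x * nabla3 g S b i j a x)
     + (2/3) * (\<Sum>a\<in>UNIV. up1 g (grad t) a x * S i j a x)"

end

theory Submission
  imports Defs
begin

text \<open>
  In a complex null frame \<open>m\<close>, \<open>cnj m\<close> with \<open>g(m, m) = 0\<close> and \<open>g(m, cnj m) = 1\<close>, the connection is a
  single imaginary one-form, and a tensor component is a function with a weight, the number of
  indices \<open>m\<close> minus the number of indices \<open>cnj m\<close>. Covariant derivatives become two weighted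
  derivations \<open>D\<close>, \<open>D'\<close> (\<open>DD True\<close> and \<open>DD False\<close>) with \<open>[D, D'] f = - w R f / 2\<close>, and everything is expressed by
  \<open>s = S(m, m, m)\<close>, \<open>\<tau> = t(m)\<close> and \<open>\<xi> = \<Xi>(m, m)\<close>.

  Potentials satisfy a closed linear first order system for \<open>(V, dV, \<Delta>V)\<close>. As the space of potentials has
  dimension 4, these data are arbitrary at each point. Hence the Bertrand-Darboux condition splits and,
  together with the Killing equation, yields a closed system for the 3 components of a Killing
  tensor, which are then arbitrary at each point, too. Its integrability conditions give \<open>D s\<close>, \<open>D' \<tau>\<close>
  and \<open>D \<tau>\<close>. The commutator on \<open>s\<close> gives \<open>D \<xi>\<close>. The commutator on \<open>\<tau>\<close> and the integrability condition of the
  system for \<open>V\<close> are two linear equations for \<open>D' \<xi>\<close> and \<open>D R\<close>; they give \<open>D' \<xi>\<close> and the algebraic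
  condition.
\<close>

section \<open>Smooth functions on an open subset of the plane\<close>

text \<open>That the data at a point are arbitrary rests on uniqueness for closed linear systems: it
  makes evaluation at a point injective on a finite-dimensional space, and equal real dimensions
  make it onto. The count is 1 + 2 + 1 for \<open>(V, dV, \<Delta>V)\<close> and 2 + 1 for a Killing
  tensor, split into its complex trace-free part and its real trace. In the second case functional
  independence enters: an integral with zero Killing tensor has zero differential.

  Each integrability condition then reads \<open>a * cnj z + b * z = 0\<close> for every complex
  \<open>z\<close>, so both coefficients vanish. For a real function of weight 0 the commutator is
  zero, and the content of commuting is that \<open>D' D f\<close> is real; this relates one
  coefficient to the conjugate of the other.

  Solved for \<open>D' \<xi>\<close>, the two final equations contain \<open>D R\<close> with the
  different coefficients -3/2 and 1, so they determine both; eliminating \<open>D' \<xi>\<close>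
  leaves five times the algebraic condition.

  One complex function per tensor suffices because in a null frame a trace is a sum of mixed
  components: trace-free symmetric tensors only have components with all indices \<open>m\<close> or
  all indices \<open>cnj m\<close>.\<close>

definition gpd :: "2 \<Rightarrow> (point \<Rightarrow> 'a::real_normed_vector) \<Rightarrow> point \<Rightarrow> 'a" where
  "gpd i f x = frechet_derivative f (at x) (axis i 1)"

text \<open>\<open>gpd\<close> extends \<open>pd\<close> to complex-valued functions, such as the
  components of a null frame.\<close>

lemma pd_eq_gpd: "pd i f = gpd i f"
  by (rule ext) (simp add: pd_def gpd_def)

lemma gpd_has_derivative: "(f has_derivative f') (at x) \<Longrightarrow> gpd i f x = f' (axis i 1)"
  unfolding gpd_def by (metis frechet_derivative_at)

lemma differentiable_has_derivative:
  "f differentiable (at x) \<Longrightarrow> (f has_derivative frechet_derivative f (at x)) (at x)"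
  by (simp add: frechet_derivative_works)

lemma frechet_derivative_gpd:
  assumes "f differentiable (at x)"
  shows "frechet_derivative f (at x) v = (\<Sum>i\<in>UNIV. v $ i *\<^sub>R gpd i f x)"
proof -
  have l: "linear (frechet_derivative f (at x))"
    using assms by (rule linear_frechet_derivative)
  have "v = (\<Sum>i\<in>UNIV. v $ i *\<^sub>R axis i 1)"
    by (simp add: vec_eq_iff sum_2 axis_def forall_2)
  then have "frechet_derivative f (at x) v = frechet_derivative f (at x) (\<Sum>i\<in>UNIV. v $ i *\<^sub>R axis i 1)"
    by simp
  then show ?thesis
    by (simp add: linear_sum[OF l] linear_cmul[OF l] gpd_def)
qed

text \<open>Fields are total functions that are meaningful only on \<open>U\<close>. Openness of
  \<open>U\<close> is what allows an identity valid only there to be differentiated.\<close>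

lemma gpd_cong_open:
  assumes "open U" "x \<in> U" "\<And>y. y \<in> U \<Longrightarrow> f y = h y" "f differentiable (at x)"
  shows "h differentiable (at x)" "gpd i h x = gpd i f x"
proof -
  have "(f has_derivative frechet_derivative f (at x)) (at x)"
    using assms(4) by (rule differentiable_has_derivative)
  then have d: "(h has_derivative frechet_derivative f (at x)) (at x)"
    by (rule has_derivative_transform_within_open[OF _ assms(1,2,3)])
  then show "h differentiable (at x)" by (auto simp: differentiable_def)
  show "gpd i h x = gpd i f x"
    using gpd_has_derivative[OF d] by (simp add: gpd_def)
qed

lemma gpd_const [simp]: "gpd i (\<lambda>x. c) x = 0"
  by (simp add: gpd_def)

lemma gpd_add:
  "f differentiable (at x) \<Longrightarrow> h differentiable (at x) \<Longrightarrow> gpd i (\<lambda>x. f x + h x) x = gpd i f x + gpd i h x"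
  by (subst gpd_has_derivative[OF has_derivative_add[OF differentiable_has_derivative differentiable_has_derivative]])
    (auto simp: gpd_def)

lemma gpd_mult:
  fixes f h :: "point \<Rightarrow> 'a::real_normed_algebra"
  shows "f differentiable (at x) \<Longrightarrow> h differentiable (at x) \<Longrightarrow> gpd i (\<lambda>x. f x * h x) x = f x * gpd i h x + gpd i f x * h x"
  by (subst gpd_has_derivative[OF has_derivative_mult[OF differentiable_has_derivative differentiable_has_derivative]])
    (auto simp: gpd_def)

lemma gpd_inverse:
  fixes f :: "point \<Rightarrow> 'a::real_normed_field"
  shows "f differentiable (at x) \<Longrightarrow> f x \<noteq> 0 \<Longrightarrow>
    gpd i (\<lambda>x. inverse (f x)) x = - (inverse (f x) * gpd i f x * inverse (f x))"
  by (subst gpd_has_derivative[OF Deriv.has_derivative_inverse[OF _ differentiable_has_derivative]])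
    (auto simp: gpd_def)

lemma gpd_bounded_linear:
  "bounded_linear T \<Longrightarrow> f differentiable (at x) \<Longrightarrow> gpd i (\<lambda>x. T (f x)) x = T (gpd i f x)"
  by (subst gpd_has_derivative[OF bounded_linear.has_derivative[OF _ differentiable_has_derivative]])
    (auto simp: gpd_def)

lemma bounded_linear_differentiable:
  "bounded_linear T \<Longrightarrow> f differentiable (at x) \<Longrightarrow> (\<lambda>x. T (f x)) differentiable (at x)"
  using bounded_linear.has_derivative by (fastforce simp: differentiable_def)

lemma sqrt_has_derivative_at:
  assumes "f differentiable (at x)" "f x > 0"
  shows "((\<lambda>x. sqrt (f x)) has_derivative (\<lambda>v. frechet_derivative f (at x) v * (inverse (sqrt (f x)) / 2))) (at x)"
proof -
  have "(sqrt has_derivative (\<lambda>v. v * (inverse (sqrt (f x)) / 2))) (at (f x))"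
    using DERIV_real_sqrt[OF assms(2)] unfolding has_field_derivative_def
    by (rule has_derivative_eq_rhs) auto
  from has_derivative_compose[OF differentiable_has_derivative[OF assms(1)] this] show ?thesis .
qed

lemma gpd_sqrt:
  "f differentiable (at x) \<Longrightarrow> f x > 0 \<Longrightarrow> gpd i (\<lambda>x. sqrt (f x)) x = gpd i f x * (inverse (sqrt (f x)) * (1/2))"
  by (subst gpd_has_derivative[OF sqrt_has_derivative_at]) (auto simp: gpd_def)

lemma sqrt_differentiable:
  "f differentiable (at x) \<Longrightarrow> f x > 0 \<Longrightarrow> (\<lambda>x. sqrt (f x)) differentiable (at x)"
  using sqrt_has_derivative_at differentiable_def by blast

text \<open>Order \<open>n\<close> means that the partial derivatives of order up to
  \<open>n\<close> are differentiable, so \<open>Ck 0\<close> is already differentiability. The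
  recursive form makes the closure properties inductions.\<close>

primrec Ck :: "nat \<Rightarrow> point set \<Rightarrow> (point \<Rightarrow> 'a::real_normed_vector) \<Rightarrow> bool" where
  "Ck 0 U f = (\<forall>x\<in>U. f differentiable (at x))"
| "Ck (Suc n) U f = ((\<forall>x\<in>U. f differentiable (at x)) \<and> (\<forall>i. Ck n U (gpd i f)))"

lemma Ck_differentiable: "Ck n U f \<Longrightarrow> x \<in> U \<Longrightarrow> f differentiable (at x)"
  by (cases n) auto

lemma Ck_Suc_imp: "Ck (Suc n) U f \<Longrightarrow> Ck n U f"
  by (induction n arbitrary: f) auto

lemma Ck_cong:
  assumes "open U" "\<And>x. x \<in> U \<Longrightarrow> f x = h x" "Ck n U f"
  shows "Ck n U h"
  using assms(2,3)
proof (induction n arbitrary: f h)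
  case 0
  then show ?case using gpd_cong_open(1)[OF assms(1)] by (metis Ck.simps(1))
next
  case (Suc n)
  have d: "\<forall>x\<in>U. f differentiable (at x)" and c: "\<And>i. Ck n U (gpd i f)" using Suc.prems by auto
  have "Ck n U (gpd i h)" for i
    by (rule Suc.IH[OF _ c[of i]]) (use gpd_cong_open(2)[OF assms(1) _ Suc.prems(1)] d in auto)
  then show ?case using gpd_cong_open(1)[OF assms(1)] Suc.prems d by (metis Ck.simps(2))
qed

lemma Ck_const: "Ck n U (\<lambda>x. c)"
proof (induction n arbitrary: c)
  case (Suc n)
  have "gpd i (\<lambda>x. c) = (\<lambda>x. 0)" for i by (rule ext) simp
  then show ?case using Suc by simp
qed simp

lemma Ck_add: "open U \<Longrightarrow> Ck n U f \<Longrightarrow> Ck n U h \<Longrightarrow> Ck n U (\<lambda>x. f x + h x)"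
proof (induction n arbitrary: f h)
  case (Suc n)
  have "Ck n U (gpd i (\<lambda>x. f x + h x))" for i
    by (rule Ck_cong[OF Suc.prems(1) _ Suc.IH[of "gpd i f" "gpd i h"]]) (use Suc.prems in \<open>auto simp: gpd_add\<close>)
  then show ?case using Suc.prems by auto
qed simp

lemma Ck_bounded_linear: "open U \<Longrightarrow> bounded_linear T \<Longrightarrow> Ck n U f \<Longrightarrow> Ck n U (\<lambda>x. T (f x))"
proof (induction n arbitrary: f)
  case (Suc n)
  have "Ck n U (gpd i (\<lambda>x. T (f x)))" for i
    by (rule Ck_cong[OF Suc.prems(1) _ Suc.IH[of "gpd i f"]]) (use Suc.prems in \<open>auto simp: gpd_bounded_linear\<close>)
  then show ?case using Suc.prems by (auto intro: bounded_linear_differentiable)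
qed (auto intro: bounded_linear_differentiable)

lemma Ck_mult:
  fixes f h :: "point \<Rightarrow> 'a::real_normed_algebra"
  shows "open U \<Longrightarrow> Ck n U f \<Longrightarrow> Ck n U h \<Longrightarrow> Ck n U (\<lambda>x. f x * h x)"
proof (induction n arbitrary: f h)
  case (Suc n)
  have "Ck n U (gpd i (\<lambda>x. f x * h x))" for i
    by (rule Ck_cong[OF Suc.prems(1) _ Ck_add[OF Suc.prems(1) Suc.IH[of f "gpd i h"] Suc.IH[of "gpd i f" h]]])
      (use Suc.prems Ck_Suc_imp in \<open>auto simp: gpd_mult\<close>)
  then show ?case using Suc.prems by auto
qed simp

lemma Ck_uminus: "open U \<Longrightarrow> Ck n U f \<Longrightarrow> Ck n U (\<lambda>x. - f x)"
  by (rule Ck_bounded_linear) (auto intro: bounded_linear_minus bounded_linear_ident)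

text \<open>The induction can keep \<open>f\<close> fixed: the derivative of the inverse is a
  product of \<open>gpd i f\<close> and the inverse itself, which is covered one order lower. The
  square root works in the same way.\<close>

lemma Ck_inverse:
  fixes f :: "point \<Rightarrow> 'a::real_normed_field"
  shows "open U \<Longrightarrow> Ck n U f \<Longrightarrow> (\<And>x. x \<in> U \<Longrightarrow> f x \<noteq> 0) \<Longrightarrow> Ck n U (\<lambda>x. inverse (f x))"
proof (induction n)
  case (Suc n)
  have i: "Ck n U (\<lambda>x. inverse (f x))" using Suc Ck_Suc_imp by blast
  have "Ck n U (gpd i (\<lambda>x. inverse (f x)))" for i
    by (rule Ck_cong[OF Suc.prems(1) _ Ck_uminus[OF Suc.prems(1) Ck_mult[OF Suc.prems(1) Ck_mult[OF Suc.prems(1) i, of "gpd i f"] i]]])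
      (use Suc.prems in \<open>auto simp: gpd_inverse\<close>)
  then show ?case using Suc.prems by auto
qed auto

lemma Ck_sqrt:
  shows "open U \<Longrightarrow> Ck n U f \<Longrightarrow> (\<And>x. x \<in> U \<Longrightarrow> f x > 0) \<Longrightarrow> Ck n U (\<lambda>x. sqrt (f x))"
proof (induction n)
  case (Suc n)
  have i: "Ck n U (\<lambda>x. sqrt (f x))" using Suc Ck_Suc_imp by blast
  have i': "Ck n U (\<lambda>x. inverse (sqrt (f x)))"
    by (rule Ck_inverse[OF Suc.prems(1) i]) (use Suc.prems in force)
  have "Ck n U (gpd i (\<lambda>x. sqrt (f x)))" for i
    by (rule Ck_cong[OF Suc.prems(1) _ Ck_mult[OF Suc.prems(1) _ Ck_mult[OF Suc.prems(1) i' Ck_const[of _ _ "1/2"]], of "gpd i f"]])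
      (use Suc.prems in \<open>auto simp: gpd_sqrt\<close>)
  then show ?case using Suc.prems by (auto intro: sqrt_differentiable)
qed (auto intro: sqrt_differentiable)

definition csm :: "point set \<Rightarrow> (point \<Rightarrow> 'a::real_normed_vector) \<Rightarrow> bool" where
  "csm U f \<longleftrightarrow> (\<forall>n. Ck n U f)"

lemma Ck_foldr: "Ck n U f \<longleftrightarrow> (\<forall>is. length is \<le> n \<longrightarrow> (\<forall>x\<in>U. foldr gpd is f differentiable (at x)))"
proof (induction n arbitrary: f)
  case (Suc n)
  show ?case
  proof
    assume "Ck (Suc n) U f"
    then have d: "\<forall>x\<in>U. f differentiable (at x)" and c: "\<And>i. Ck n U (gpd i f)" by auto
    show "\<forall>is. length is \<le> Suc n \<longrightarrow> (\<forall>x\<in>U. foldr gpd is f differentiable (at x))"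
    proof (intro allI impI)
      fix "is" :: "2 list" assume "length is \<le> Suc n"
      \<comment> \<open>\<open>foldr\<close> applies the last entry of the list first, hence the
        case split from the right.\<close>
      then show "\<forall>x\<in>U. foldr gpd is f differentiable (at x)"
        using d c Suc.IH by (cases "is" rule: rev_cases) auto
    qed
  next
    assume *: "\<forall>is. length is \<le> Suc n \<longrightarrow> (\<forall>x\<in>U. foldr gpd is f differentiable (at x))"
    have "Ck n U (gpd i f)" for i
      unfolding Suc.IH using *[rule_format, of "_ @ [i]"] by auto
    then show "Ck (Suc n) U f" using *[rule_format, of "[]"] by auto
  qed
qed simp

lemma smooth_fun_csm: "smooth_fun U f \<longleftrightarrow> csm U f"
proof -
  have "foldr pd = foldr gpd" by (simp add: pd_eq_gpd[abs_def])
  then show ?thesis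
    unfolding smooth_fun_def csm_def Ck_foldr by (metis order_refl)
qed

lemma csm_differentiable: "csm U f \<Longrightarrow> x \<in> U \<Longrightarrow> f differentiable (at x)"
  unfolding csm_def using Ck_differentiable by blast

lemma csm_continuous_on: "csm U f \<Longrightarrow> continuous_on U f"
  by (meson csm_differentiable continuous_at_imp_continuous_on differentiable_imp_continuous_within)

lemma csm_cong: "open U \<Longrightarrow> csm U f \<Longrightarrow> (\<And>x. x \<in> U \<Longrightarrow> f x = h x) \<Longrightarrow> csm U h"
  unfolding csm_def using Ck_cong by metis

lemma csm_gpd: "csm U f \<Longrightarrow> csm U (gpd i f)"
  unfolding csm_def by (meson Ck.simps(2))

lemma csm_const: "csm U (\<lambda>x. c)"
  unfolding csm_def by (simp add: Ck_const)

lemma csm_add: "open U \<Longrightarrow> csm U f \<Longrightarrow> csm U h \<Longrightarrow> csm U (\<lambda>x. f x + h x)"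
  unfolding csm_def by (simp add: Ck_add)

lemma csm_mult:
  fixes f h :: "point \<Rightarrow> 'a::real_normed_algebra"
  shows "open U \<Longrightarrow> csm U f \<Longrightarrow> csm U h \<Longrightarrow> csm U (\<lambda>x. f x * h x)"
  unfolding csm_def by (simp add: Ck_mult)

lemma csm_bounded_linear: "open U \<Longrightarrow> bounded_linear T \<Longrightarrow> csm U f \<Longrightarrow> csm U (\<lambda>x. T (f x))"
  unfolding csm_def by (simp add: Ck_bounded_linear)

lemma csm_uminus: "open U \<Longrightarrow> csm U f \<Longrightarrow> csm U (\<lambda>x. - f x)"
  unfolding csm_def by (simp add: Ck_uminus)

lemma csm_diff: "open U \<Longrightarrow> csm U f \<Longrightarrow> csm U h \<Longrightarrow> csm U (\<lambda>x. f x - h x)"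
  using csm_add[OF _ _ csm_uminus] by fastforce

lemma csm_inverse:
  fixes f :: "point \<Rightarrow> 'a::real_normed_field"
  shows "open U \<Longrightarrow> csm U f \<Longrightarrow> (\<And>x. x \<in> U \<Longrightarrow> f x \<noteq> 0) \<Longrightarrow> csm U (\<lambda>x. inverse (f x))"
  unfolding csm_def by (simp add: Ck_inverse)

lemma csm_sqrt: "open U \<Longrightarrow> csm U f \<Longrightarrow> (\<And>x. x \<in> U \<Longrightarrow> f x > 0) \<Longrightarrow> csm U (\<lambda>x. sqrt (f x))"
  unfolding csm_def by (simp add: Ck_sqrt)

lemma csm_of_real: "open U \<Longrightarrow> csm U f \<Longrightarrow> csm U (\<lambda>x. complex_of_real (f x))"
  by (rule csm_bounded_linear[OF _ bounded_linear_of_real])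

lemma csm_cnj: "open U \<Longrightarrow> csm U f \<Longrightarrow> csm U (\<lambda>x. cnj (f x))"
  by (rule csm_bounded_linear[OF _ bounded_linear_cnj])

lemma csm_sum: "open U \<Longrightarrow> (\<And>i. i \<in> A \<Longrightarrow> csm U (f i)) \<Longrightarrow> csm U (\<lambda>x. \<Sum>i\<in>A. f i x)"
  by (induction A rule: infinite_finite_induct) (auto intro: csm_const csm_add)

text \<open>The second difference on the left is symmetric in \<open>i\<close> and \<open>j\<close>; exchanging them therefore equates
  values of the two mixed derivatives near \<open>x\<close>.\<close>

lemma second_difference_mvt:
  fixes f :: "point \<Rightarrow> real"
  assumes "csm (ball x r) f" "0 < h" "h + h < r"
  shows "\<exists>s t. 0 < s \<and> s < h \<and> 0 < t \<and> t < h \<and>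
    f (x + h *\<^sub>R axis i 1 + h *\<^sub>R axis j 1) - f (x + h *\<^sub>R axis i 1) - f (x + h *\<^sub>R axis j 1) + f x
     = h * h * gpd j (gpd i f) (x + s *\<^sub>R axis i 1 + t *\<^sub>R axis j 1)"
proof -
  let ?a = "axis i 1 :: point" and ?b = "axis j 1 :: point"
  have inb: "x + s *\<^sub>R ?a + t *\<^sub>R ?b \<in> ball x r" if "0 \<le> s" "s \<le> h" "0 \<le> t" "t \<le> h" for s t
  proof -
    have "norm (s *\<^sub>R ?a + t *\<^sub>R ?b) \<le> norm (s *\<^sub>R ?a) + norm (t *\<^sub>R ?b)" by (rule norm_triangle_ineq)
    also have "\<dots> = s + t" using that by (simp add: norm_axis_1)
    also have "\<dots> < r" using that assms by linarith
    finally have "norm (s *\<^sub>R ?a + t *\<^sub>R ?b) < r" .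
    moreover have "dist x (x + s *\<^sub>R ?a + t *\<^sub>R ?b) = norm (s *\<^sub>R ?a + t *\<^sub>R ?b)"
      by (metis (no_types, lifting) add.assoc add_diff_cancel_left' dist_commute dist_norm)
    ultimately show ?thesis by (simp only: mem_ball)
  qed
  have der: "((\<lambda>s. F (y + s *\<^sub>R axis k 1)) has_field_derivative gpd k F (y + s *\<^sub>R axis k 1)) (at s)"
    if "F differentiable (at (y + s *\<^sub>R axis k 1))" for F :: scalar and y s k
  proof -
    have "((\<lambda>s. y + s *\<^sub>R axis k 1) has_derivative (\<lambda>v. v *\<^sub>R (axis k 1 :: point))) (at s)"
      by (auto intro!: derivative_eq_intros)
    from has_derivative_compose[OF this differentiable_has_derivative[OF that]]
    have "((\<lambda>s. F (y + s *\<^sub>R axis k 1)) has_derivative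
      (\<lambda>v. frechet_derivative F (at (y + s *\<^sub>R axis k 1)) (v *\<^sub>R (axis k 1 :: point)))) (at s)" .
    moreover have "(\<lambda>v. frechet_derivative F (at (y + s *\<^sub>R axis k 1)) (v *\<^sub>R (axis k 1 :: point)))
       = (\<lambda>v. gpd k F (y + s *\<^sub>R axis k 1) * v)"
      by (rule ext) (simp add: linear_cmul[OF linear_frechet_derivative[OF that]] gpd_def)
    ultimately show ?thesis by (simp add: has_field_derivative_def)
  qed
  \<comment> \<open>The second difference is the increment of \<open>\<phi>\<close>. The mean value
    theorem is used once along \<open>i\<close> for \<open>\<phi>\<close>, and then along
    \<open>j\<close> for \<open>gpd i f\<close>.\<close>
  define \<phi> where "\<phi> s = f (x + h *\<^sub>R ?b + s *\<^sub>R ?a) - f (x + s *\<^sub>R ?a)" for s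
  have d1: "(\<phi> has_field_derivative gpd i f (x + h *\<^sub>R ?b + s *\<^sub>R ?a) - gpd i f (x + s *\<^sub>R ?a)) (at s)"
    if "0 \<le> s" "s \<le> h" for s
    unfolding \<phi>_def using inb[of s h] inb[of s 0] that assms(1,2)
    by (intro DERIV_diff der csm_differentiable[of "ball x r"]) (auto simp: algebra_simps)
  obtain s where s: "0 < s" "s < h"
    "\<phi> h - \<phi> 0 = (h - 0) * (gpd i f (x + h *\<^sub>R ?b + s *\<^sub>R ?a) - gpd i f (x + s *\<^sub>R ?a))"
    using MVT2[OF assms(2) d1] by blast
  have d2: "((\<lambda>t. gpd i f (x + s *\<^sub>R ?a + t *\<^sub>R ?b)) has_field_derivative
      gpd j (gpd i f) (x + s *\<^sub>R ?a + t *\<^sub>R ?b)) (at t)"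
    if "0 \<le> t" "t \<le> h" for t
    using inb[of s t] that s by (intro der csm_differentiable[of "ball x r"] csm_gpd assms(1)) auto
  obtain t where t: "0 < t" "t < h"
    "gpd i f (x + s *\<^sub>R ?a + h *\<^sub>R ?b) - gpd i f (x + s *\<^sub>R ?a + 0 *\<^sub>R ?b)
     = (h - 0) * gpd j (gpd i f) (x + s *\<^sub>R ?a + t *\<^sub>R ?b)"
    using MVT2[OF assms(2) d2] by blast
  have "f (x + h *\<^sub>R ?a + h *\<^sub>R ?b) - f (x + h *\<^sub>R ?a) - f (x + h *\<^sub>R ?b) + f x = \<phi> h - \<phi> 0"
    by (simp add: \<phi>_def algebra_simps)
  also have "\<dots> = h * (gpd i f (x + s *\<^sub>R ?a + h *\<^sub>R ?b) - gpd i f (x + s *\<^sub>R ?a + 0 *\<^sub>R ?b))"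
    using s(3) by (simp add: algebra_simps)
  also have "\<dots> = h * h * gpd j (gpd i f) (x + s *\<^sub>R ?a + t *\<^sub>R ?b)" unfolding t(3) by simp
  finally show ?thesis using s t by blast
qed

lemma csm_subset: "csm U f \<Longrightarrow> V \<subseteq> U \<Longrightarrow> csm V f"
proof -
  have "Ck n U f \<Longrightarrow> V \<subseteq> U \<Longrightarrow> Ck n V f" for n by (induction n arbitrary: f) auto
  then show "csm U f \<Longrightarrow> V \<subseteq> U \<Longrightarrow> csm V f" by (simp add: csm_def)
qed

lemma gpd_commute_real:
  fixes f :: "point \<Rightarrow> real"
  assumes "open U" "csm U f" "x \<in> U"
  shows "gpd i (gpd j f) x = gpd j (gpd i f) x"
proof (rule ccontr)
  assume neq: "\<not> ?thesis"
  define e where "e = dist (gpd i (gpd j f) x) (gpd j (gpd i f) x) / 2"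
  have e: "e > 0" using neq by (simp add: e_def)
  have c: "isCont (gpd k (gpd l f)) x" for k l
    using csm_differentiable[OF csm_gpd[OF csm_gpd[OF assms(2)]] assms(3)]
    by (rule differentiable_imp_continuous_within)
  obtain d1 where d1: "d1 > 0" "\<And>y. dist y x < d1 \<Longrightarrow> dist (gpd i (gpd j f) y) (gpd i (gpd j f) x) < e"
    using c[of i j] e unfolding continuous_at_eps_delta by blast
  obtain d2 where d2: "d2 > 0" "\<And>y. dist y x < d2 \<Longrightarrow> dist (gpd j (gpd i f) y) (gpd j (gpd i f) x) < e"
    using c[of j i] e unfolding continuous_at_eps_delta by blast
  obtain d3 where d3: "d3 > 0" "ball x d3 \<subseteq> U" using assms openE by metis
  \<comment> \<open>A quarter of the smallest radius leaves room for two steps of length at most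
    \<open>h\<close> along the axes.\<close>
  define h where "h = min d1 (min d2 d3) / 4"
  have h: "0 < h" "h + h < d1" "h + h < d2" "h + h < d3" using d1(1) d2(1) d3(1) by (auto simp: h_def)
  have cb: "csm (ball x d3) f" using csm_subset[OF assms(2) d3(2)] .
  have near: "dist (x + s *\<^sub>R axis k 1 + t *\<^sub>R axis l 1) x < h + h" if "0 < s" "s < h" "0 < t" "t < h"
    for s t :: real and k l :: 2
  proof -
    have "norm (s *\<^sub>R (axis k 1 :: point) + t *\<^sub>R axis l 1) \<le> norm (s *\<^sub>R (axis k 1 :: point)) + norm (t *\<^sub>R (axis l 1 :: point))"
      by (rule norm_triangle_ineq)
    also have "\<dots> < h + h" using that by (simp add: norm_axis_1)
    finally show ?thesis by (simp add: dist_norm add.assoc)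
  qed
  obtain s t where st: "0 < s" "s < h" "0 < t" "t < h"
    "f (x + h *\<^sub>R axis i 1 + h *\<^sub>R axis j 1) - f (x + h *\<^sub>R axis i 1) - f (x + h *\<^sub>R axis j 1) + f x
     = h * h * gpd j (gpd i f) (x + s *\<^sub>R axis i 1 + t *\<^sub>R axis j 1)"
    using second_difference_mvt[OF cb h(1) h(4), of i j] by auto
  obtain s' t' where st': "0 < s'" "s' < h" "0 < t'" "t' < h"
    "f (x + h *\<^sub>R axis j 1 + h *\<^sub>R axis i 1) - f (x + h *\<^sub>R axis j 1) - f (x + h *\<^sub>R axis i 1) + f x
     = h * h * gpd i (gpd j f) (x + s' *\<^sub>R axis j 1 + t' *\<^sub>R axis i 1)"
    using second_difference_mvt[OF cb h(1) h(4), of j i] by auto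
  have "h * h * gpd i (gpd j f) (x + s' *\<^sub>R axis j 1 + t' *\<^sub>R axis i 1)
      = h * h * gpd j (gpd i f) (x + s *\<^sub>R axis i 1 + t *\<^sub>R axis j 1)"
    using st(5) st'(5) by (auto simp: algebra_simps)
  then have eq: "gpd i (gpd j f) (x + s' *\<^sub>R axis j 1 + t' *\<^sub>R axis i 1)
      = gpd j (gpd i f) (x + s *\<^sub>R axis i 1 + t *\<^sub>R axis j 1)" using h by simp
  have "dist (x + s' *\<^sub>R axis j 1 + t' *\<^sub>R axis i 1) x < d1" "dist (x + s *\<^sub>R axis i 1 + t *\<^sub>R axis j 1) x < d2"
    using near[OF st'(1-4), of j i] near[OF st(1-4), of i j] h by linarith+
  then have "dist (gpd i (gpd j f) (x + s' *\<^sub>R axis j 1 + t' *\<^sub>R axis i 1)) (gpd i (gpd j f) x) < e"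
    "dist (gpd i (gpd j f) (x + s' *\<^sub>R axis j 1 + t' *\<^sub>R axis i 1)) (gpd j (gpd i f) x) < e"
    using d1(2) d2(2) eq by metis+
  then have "dist (gpd i (gpd j f) x) (gpd j (gpd i f) x) < e + e"
    by (metis add_strict_mono dist_triangle3 le_less_trans)
  then show False by (simp add: e_def)
qed

lemma gpd_commute:
  fixes f :: "point \<Rightarrow> complex"
  assumes "open U" "csm U f" "x \<in> U"
  shows "gpd i (gpd j f) x = gpd j (gpd i f) x"
proof -
  have T: "T (gpd i (gpd j f) x) = T (gpd j (gpd i f) x)" if T: "bounded_linear T" for T :: "complex \<Rightarrow> real"
  proof -
    have 1: "gpd k (\<lambda>x. T (f x)) y = T (gpd k f y)" if "y \<in> U" for y k
      using gpd_bounded_linear[OF T csm_differentiable[OF assms(2) that]] .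
    have 2: "gpd l (gpd k (\<lambda>x. T (f x))) x = T (gpd l (gpd k f) x)" for l k
    proof -
      have "gpd l (gpd k (\<lambda>x. T (f x))) x = gpd l (\<lambda>x. T (gpd k f x)) x"
        by (rule gpd_cong_open(2)[OF assms(1,3)])
          (use 1 csm_differentiable[OF csm_bounded_linear[OF assms(1) T csm_gpd[OF assms(2)]] assms(3)] in auto)
      then show ?thesis
        using gpd_bounded_linear[OF T csm_differentiable[OF csm_gpd[OF assms(2)] assms(3)]] by simp
    qed
    show ?thesis
      using gpd_commute_real[OF assms(1) csm_bounded_linear[OF assms(1) T assms(2)] assms(3), of i j]
      by (simp add: 2)
  qed
  show ?thesis using T[OF bounded_linear_Re] T[OF bounded_linear_Im] by (simp add: complex_eq_iff)
qed

section \<open>Uniqueness for closed linear systems, and the metric\<close>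

lemma sum_mult_le_norm:
  fixes a b :: "nat \<Rightarrow> complex"
  assumes "\<And>j. j < n \<Longrightarrow> norm (a j) \<le> C"
  shows "norm (\<Sum>j<n. a j * b j) \<le> C * (\<Sum>j<n. norm (b j))"
proof -
  have "norm (\<Sum>j<n. a j * b j) \<le> (\<Sum>j<n. norm (a j * b j))" by (rule norm_sum)
  also have "\<dots> \<le> (\<Sum>j<n. C * norm (b j))"
    by (rule sum_mono) (use assms in \<open>auto simp: norm_mult mult_right_mono\<close>)
  finally show ?thesis by (simp add: sum_distrib_left)
qed

text \<open>A maximum argument in place of a Gronwall estimate: at the point of a small closed ball
  where the sum \<open>N\<close> of the norms is largest, the mean value inequality from the centre
  bounds \<open>N\<close> by half of itself.\<close>

lemma linear_system_zero_locally:
  fixes f :: "nat \<Rightarrow> point \<Rightarrow> complex" and A :: "2 \<Rightarrow> nat \<Rightarrow> nat \<Rightarrow> point \<Rightarrow> complex"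
  assumes U: "open U"
    and d: "\<And>i x. i < n \<Longrightarrow> x \<in> U \<Longrightarrow> f i differentiable (at x)"
    and A: "\<And>l i j. i < n \<Longrightarrow> j < n \<Longrightarrow> continuous_on U (A l i j)"
    and eq: "\<And>l i x. i < n \<Longrightarrow> x \<in> U \<Longrightarrow> gpd l (f i) x = (\<Sum>j<n. A l i j x * f j x)"
    and z: "z \<in> U" "\<And>i. i < n \<Longrightarrow> f i z = 0"
  shows "\<exists>r>0. \<forall>x\<in>ball z r. x \<in> U \<and> (\<forall>i<n. f i x = 0)"
proof -
  obtain r0 where r0: "r0 > 0" "cball z r0 \<subseteq> U" using U z(1) open_contains_cball by metis
  have bd: "\<exists>C. \<forall>x\<in>cball z r0. norm (A l i j x) \<le> C" if "i < n" "j < n" for l i j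
  proof -
    have "compact (A l i j ` cball z r0)"
      by (rule compact_continuous_image[OF continuous_on_subset[OF A[OF that] r0(2)] compact_cball])
    then have "bounded (A l i j ` cball z r0)" by (rule compact_imp_bounded)
    then show ?thesis by (auto simp: bounded_iff)
  qed
  define c where "c l i j = (SOME C. \<forall>x\<in>cball z r0. norm (A l i j x) \<le> C)" for l i j
  have c: "norm (A l i j x) \<le> c l i j" if "i < n" "j < n" "x \<in> cball z r0" for l i j x
    using someI_ex[OF bd[OF that(1,2), of l]] that(3) unfolding c_def by blast
  define C where "C = (\<Sum>l\<in>UNIV. \<Sum>i<n. \<Sum>j<n. \<bar>c l i j\<bar>)"
  have "\<bar>c l i j\<bar> \<le> C" if "i < n" "j < n" for l i j
  proof -
    have "\<bar>c l i j\<bar> \<le> (\<Sum>j<n. \<bar>c l i j\<bar>)" by (rule member_le_sum) (use that in auto)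
    also have "\<dots> \<le> (\<Sum>i<n. \<Sum>j<n. \<bar>c l i j\<bar>)"
      by (rule member_le_sum[of i _ "\<lambda>i. \<Sum>j<n. \<bar>c l i j\<bar>"]) (use that in \<open>auto simp: sum_nonneg\<close>)
    also have "\<dots> \<le> C" unfolding C_def
      by (rule member_le_sum[of l _ "\<lambda>l. \<Sum>i<n. \<Sum>j<n. \<bar>c l i j\<bar>"]) (auto simp: sum_nonneg)
    finally show ?thesis .
  qed
  then have C: "norm (A l i j x) \<le> C" if "i < n" "j < n" "x \<in> cball z r0" for l i j x
    using c that by (meson abs_ge_self order_trans)
  have C0: "C \<ge> 0" by (auto simp: C_def sum_nonneg)
  \<comment> \<open>The later estimate needs \<open>4 * n * C * r \<le> 1\<close>: a factor 2 comes
    from the two coordinate directions and another 2 yields the bound by one half. The added 1 keeps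
    the denominator positive when \<open>n\<close> or \<open>C\<close> is zero.\<close>
  define r where "r = min r0 (1 / (4 * real n * C + 1))"
  have pos: "4 * real n * C + 1 > 0" using C0 by (simp add: add_nonneg_pos)
  have r: "r > 0" "r \<le> r0" using r0 pos by (auto simp: r_def)
  have "r * (4 * real n * C + 1) \<le> 1" using pos by (simp add: r_def pos_le_divide_eq[symmetric])
  then have r1: "4 * (real n * C * r) \<le> 1" using r by (simp add: algebra_simps)
  define N where "N x = (\<Sum>i<n. norm (f i x))" for x
  have sub: "cball z r \<subseteq> U" using r0 r by auto
  have "continuous_on (cball z r) N" unfolding N_def
    by (intro continuous_intros continuous_at_imp_continuous_on)
      (use d sub differentiable_imp_continuous_within in blast)
  then obtain y where y: "y \<in> cball z r" "\<And>x. x \<in> cball z r \<Longrightarrow> N x \<le> N y"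
    using continuous_attains_sup[of "cball z r" N] r by auto
  have fy: "norm (f i y) \<le> 2 * C * N y * r" if i: "i < n" for i
  proof -
    have "norm (f i y - f i z) \<le> (2 * C * N y) * norm (y - z)"
    proof (rule differentiable_bound[of "cball z r"])
      show "convex (cball z r)" by simp
      show "(f i has_derivative frechet_derivative (f i) (at x)) (at x within cball z r)" if "x \<in> cball z r" for x
        using differentiable_has_derivative[OF d[OF i]] that sub has_derivative_at_withinI by blast
      show "onorm (frechet_derivative (f i) (at x)) \<le> 2 * C * N y" if x: "x \<in> cball z r" for x
      proof (rule onorm_bound)
        show "0 \<le> 2 * C * N y" using C0 by (simp add: N_def sum_nonneg)
        fix v :: point
        have g: "norm (gpd l (f i) x) \<le> C * N y" for l
        proof -
          have "norm (gpd l (f i) x) \<le> C * N x"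
            unfolding N_def eq[OF i subsetD[OF sub x]] using C i x r by (intro sum_mult_le_norm) auto
          also have "\<dots> \<le> C * N y" using y(2)[OF x] C0 by (simp add: mult_left_mono)
          finally show ?thesis .
        qed
        have "norm (frechet_derivative (f i) (at x) v) \<le> (\<Sum>l\<in>UNIV. norm (v $ l *\<^sub>R gpd l (f i) x))"
          unfolding frechet_derivative_gpd[OF d[OF i subsetD[OF sub x]]] by (rule norm_sum)
        also have "\<dots> \<le> (\<Sum>l\<in>(UNIV::2 set). norm v * (C * N y))"
          by (intro sum_mono) (auto intro!: mult_mono g component_le_norm_cart)
        finally show "norm (frechet_derivative (f i) (at x) v) \<le> 2 * C * N y * norm v"
          by (simp add: sum_2 algebra_simps)
      qed
    qed (use y r in auto)
    also have "\<dots> \<le> (2 * C * N y) * r"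
      using y(1) C0 by (intro mult_left_mono) (auto simp: N_def sum_nonneg dist_norm norm_minus_commute)
    finally show ?thesis using z(2)[OF i] by simp
  qed
  have "N y \<le> (\<Sum>i<n. 2 * C * N y * r)" unfolding N_def by (intro sum_mono) (use fy in \<open>auto simp: N_def\<close>)
  also have "\<dots> = (4 * (real n * C * r)) * (N y / 2)" by simp
  also have "\<dots> \<le> 1 * (N y / 2)" by (intro mult_right_mono r1) (auto simp: N_def sum_nonneg)
  finally have "N y \<le> 0" by simp
  then have N0: "N x \<le> 0" if "x \<in> cball z r" for x using y(2)[OF that] by simp
  have "norm (f i x) \<le> 0" if "x \<in> cball z r" "i < n" for x i
  proof -
    have "norm (f i x) \<le> N x" unfolding N_def by (rule member_le_sum) (use that in auto)
    also have "\<dots> \<le> 0" using N0 that by simp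
    finally show ?thesis .
  qed
  then show ?thesis using r sub by (intro exI[of _ r]) auto
qed

text \<open>The common zero set is open by the local statement and relatively closed by continuity,
  so connectedness makes it all of \<open>U\<close>.\<close>

lemma linear_system_unique:
  fixes f :: "nat \<Rightarrow> point \<Rightarrow> complex" and A :: "2 \<Rightarrow> nat \<Rightarrow> nat \<Rightarrow> point \<Rightarrow> complex"
  assumes U: "open U" "connected U"
    and d: "\<And>i x. i < n \<Longrightarrow> x \<in> U \<Longrightarrow> f i differentiable (at x)"
    and A: "\<And>l i j. i < n \<Longrightarrow> j < n \<Longrightarrow> continuous_on U (A l i j)"
    and eq: "\<And>l i x. i < n \<Longrightarrow> x \<in> U \<Longrightarrow> gpd l (f i) x = (\<Sum>j<n. A l i j x * f j x)"
    and z: "z \<in> U" "\<And>i. i < n \<Longrightarrow> f i z = 0"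
    and x: "x \<in> U" "i < n"
  shows "f i x = 0"
proof -
  define Z where "Z = {x\<in>U. \<forall>i<n. f i x = 0}"
  have "open Z" unfolding open_contains_ball Z_def
    using linear_system_zero_locally[OF U(1) d A eq] by (simp add: subset_eq)
  moreover have "open (U - Z)"
  proof -
    have "open (U \<inter> f i -` (- {0}))" if "i < n" for i
      using continuous_open_preimage[OF continuous_at_imp_continuous_on U(1), of "f i" "- {0}"]
        d[OF that] differentiable_imp_continuous_within by blast
    moreover have "U - Z = (\<Union>i\<in>{..<n}. U \<inter> f i -` (- {0}))" by (auto simp: Z_def)
    ultimately show ?thesis by (metis (no_types, lifting) lessThan_iff open_UN)
  qed
  moreover have "z \<in> Z" using z by (simp add: Z_def)
  ultimately have "U - Z = {}"
    using connectedD[OF U(2), of Z "U - Z"] z(1) by (auto simp: Z_def)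
  then show ?thesis using x by (auto simp: Z_def)
qed

section \<open>The metric, its inverse and the Christoffel symbols in coordinates\<close>

locale metric2 =
  fixes U :: "point set" and g :: metric
  assumes open_U: "open U" and metric: "riemannian_metric U g"
begin

lemmas [simp] = csm_gpd csm_const csm_add[OF open_U] csm_mult[OF open_U] csm_uminus[OF open_U]
  csm_diff[OF open_U] csm_of_real[OF open_U] csm_cnj[OF open_U] csm_sum[OF open_U]

lemma csm_divide_const [simp]:
  fixes f :: "point \<Rightarrow> 'a::real_normed_field"
  shows "csm U f \<Longrightarrow> csm U (\<lambda>x. f x / c)"
  by (simp add: field_class.field_divide_inverse)

lemma gpd_mult_csm [simp]:
  fixes f h :: "point \<Rightarrow> 'a::real_normed_algebra"
  shows "x \<in> U \<Longrightarrow> csm U f \<Longrightarrow> csm U h \<Longrightarrow> gpd i (\<lambda>x. f x * h x) x = f x * gpd i h x + gpd i f x * h x"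
  by (simp add: csm_differentiable gpd_mult)

lemma gpd_add_csm [simp]:
  "x \<in> U \<Longrightarrow> csm U f \<Longrightarrow> csm U h \<Longrightarrow> gpd i (\<lambda>x. f x + h x) x = gpd i f x + gpd i h x"
  by (simp add: csm_differentiable gpd_add)

lemma gpd_uminus_csm [simp]:
  "x \<in> U \<Longrightarrow> csm U f \<Longrightarrow> gpd i (\<lambda>x. - f x) x = - gpd i f x"
  using gpd_bounded_linear[OF bounded_linear_minus[OF bounded_linear_ident]] csm_differentiable by blast

lemma gpd_diff_csm [simp]:
  assumes "x \<in> U" "csm U f" "csm U h"
  shows "gpd i (\<lambda>x. f x - h x) x = gpd i f x - gpd i h x"
  using gpd_add_csm[OF assms(1,2) csm_uminus[OF open_U assms(3)], of i] assms by simp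

lemma gpd_of_real_csm [simp]:
  "x \<in> U \<Longrightarrow> csm U f \<Longrightarrow> gpd i (\<lambda>x. complex_of_real (f x)) x = of_real (gpd i f x)"
  using gpd_bounded_linear[OF bounded_linear_of_real] csm_differentiable by blast

lemma gpd_cnj_csm [simp]:
  "x \<in> U \<Longrightarrow> csm U f \<Longrightarrow> gpd i (\<lambda>x. cnj (f x)) x = cnj (gpd i f x)"
  using gpd_bounded_linear[OF bounded_linear_cnj] csm_differentiable by blast

lemma gpd_cong_csm:
  assumes "csm U f" "x \<in> U" "\<And>y. y \<in> U \<Longrightarrow> f y = h y"
  shows "gpd i f x = gpd i h x"
  using gpd_cong_open(2)[OF open_U assms(2,3) csm_differentiable[OF assms(1,2)]] by simp

lemma gl_csm [simp]: "csm U (gl g i j)"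
  using metric by (simp add: riemannian_metric_def smooth_fun_csm)

lemma gl_sym: "x \<in> U \<Longrightarrow> gl g i j x = gl g j i x"
  using metric by (auto simp: riemannian_metric_def gl_def transpose_def vec_eq_iff)

lemma gl_pos: "x \<in> U \<Longrightarrow> v \<noteq> 0 \<Longrightarrow> (\<Sum>i\<in>UNIV. \<Sum>j\<in>UNIV. gl g i j x * v $ i * v $ j) > 0"
  using metric
  by (auto simp: riemannian_metric_def gl_def inner_vec_def matrix_vector_mult_def sum_2 algebra_simps)

lemma gl_11_pos: "x \<in> U \<Longrightarrow> gl g 1 1 x > 0"
  using gl_pos[of x "axis 1 1"] by (simp add: sum_2 axis_def vec_eq_iff forall_2)

lemma gl_det_pos:
  assumes "x \<in> U"
  shows "gl g 1 1 x * gl g 2 2 x - gl g 1 2 x * gl g 1 2 x > 0"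
proof -
  define v :: point where "v = (\<chi> i. if i = 1 then - gl g 1 2 x else gl g 1 1 x)"
  have "v \<noteq> 0" using gl_11_pos[OF assms] by (auto simp: v_def vec_eq_iff forall_2)
  from gl_pos[OF assms this]
  have "gl g 1 1 x * (gl g 1 1 x * gl g 2 2 x - gl g 1 2 x * gl g 1 2 x) > 0"
    using gl_sym[OF assms, of 2 1] by (simp add: v_def sum_2 algebra_simps)
  then show ?thesis using gl_11_pos[OF assms] by (simp add: zero_less_mult_iff)
qed

lemma gu_inverse:
  assumes "x \<in> U"
  shows "(\<Sum>b\<in>UNIV. gl g a b x * gu g b c x) = (if a = c then 1 else 0)"
    and "(\<Sum>b\<in>UNIV. gu g a b x * gl g b c x) = (if a = c then 1 else 0)"
proof -
  have "det (g x) \<noteq> 0"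
    using gl_det_pos[OF assms] gl_sym[OF assms, of 2 1] by (simp add: det_2 gl_def)
  then have "invertible (g x)" by (simp add: invertible_det_nz)
  then have "g x ** matrix_inv (g x) = mat 1" "matrix_inv (g x) ** g x = mat 1"
    using someI_ex[of "\<lambda>A'. g x ** A' = mat 1 \<and> A' ** g x = mat 1"]
    by (auto simp: invertible_def matrix_inv_def)
  then show "(\<Sum>b\<in>UNIV. gl g a b x * gu g b c x) = (if a = c then 1 else 0)"
    "(\<Sum>b\<in>UNIV. gu g a b x * gl g b c x) = (if a = c then 1 else 0)"
    by (simp_all add: matrix_matrix_mult_def mat_def vec_eq_iff gl_def gu_def)
qed

text \<open>Cramer's rule. It replaces \<open>matrix_inv\<close> by an expression from which
  symmetry and smoothness of the inverse metric can be read off.\<close>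

lemma gu_eq:
  assumes "x \<in> U"
  defines "d \<equiv> gl g 1 1 x * gl g 2 2 x - gl g 1 2 x * gl g 1 2 x"
  shows "gu g 1 1 x = gl g 2 2 x * inverse d" "gu g 2 2 x = gl g 1 1 x * inverse d"
    "gu g 1 2 x = - gl g 1 2 x * inverse d" "gu g 2 1 x = - gl g 1 2 x * inverse d"
proof -
  have d: "d \<noteq> 0" using gl_det_pos[OF assms(1)] by (simp add: d_def)
  have s: "gl g 2 1 x = gl g 1 2 x" by (rule gl_sym[OF assms(1)])
  note e = gu_inverse(1)[OF assms(1)] 
  have e11: "gl g 1 1 x * gu g 1 1 x + gl g 1 2 x * gu g 2 1 x = 1" using e[of 1 1] by (simp add: sum_2)
  have e12: "gl g 1 1 x * gu g 1 2 x + gl g 1 2 x * gu g 2 2 x = 0" using e[of 1 2] by (simp add: sum_2)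
  have e21: "gl g 1 2 x * gu g 1 1 x + gl g 2 2 x * gu g 2 1 x = 0" using e[of 2 1] s by (simp add: sum_2)
  have e22: "gl g 1 2 x * gu g 1 2 x + gl g 2 2 x * gu g 2 2 x = 1" using e[of 2 2] s by (simp add: sum_2)
  have "gu g 1 1 x * d = gl g 2 2 x" using e11 e21 unfolding d_def by algebra
  then show "gu g 1 1 x = gl g 2 2 x * inverse d" using d by (simp add: field_simps)
  have "gu g 2 2 x * d = gl g 1 1 x" using e12 e22 unfolding d_def by algebra
  then show "gu g 2 2 x = gl g 1 1 x * inverse d" using d by (simp add: field_simps)
  have "gu g 1 2 x * d = - gl g 1 2 x" using e12 e22 unfolding d_def by algebra
  then show "gu g 1 2 x = - gl g 1 2 x * inverse d" using d by (simp add: field_simps)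
  have "gu g 2 1 x * d = - gl g 1 2 x" using e11 e21 unfolding d_def by algebra
  then show "gu g 2 1 x = - gl g 1 2 x * inverse d" using d by (simp add: field_simps)
qed

lemma gu_sym: "x \<in> U \<Longrightarrow> gu g i j x = gu g j i x"
  using gu_eq exhaust_2[of i] exhaust_2[of j] by auto

lemma inverse_det_csm: "csm U (\<lambda>x. inverse (gl g 1 1 x * gl g 2 2 x - gl g 1 2 x * gl g 1 2 x))"
  by (rule csm_inverse[OF open_U]) (use gl_det_pos in \<open>auto simp: less_imp_neq[symmetric]\<close>)

lemma gu_csm [simp]: "csm U (gu g i j)"
proof -
  have "csm U (gu g 1 1)" "csm U (gu g 2 2)" "csm U (gu g 1 2)" "csm U (gu g 2 1)"
    by (rule csm_cong[OF open_U _ gu_eq(1)[symmetric]] csm_cong[OF open_U _ gu_eq(2)[symmetric]]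
        csm_cong[OF open_U _ gu_eq(3)[symmetric]] csm_cong[OF open_U _ gu_eq(4)[symmetric]];
      simp add: inverse_det_csm)+
  then show ?thesis using exhaust_2[of i] exhaust_2[of j] by auto
qed

lemma christoffel_csm [simp]: "csm U (christoffel g k i j)"
  unfolding christoffel_def[abs_def] pd_eq_gpd by simp

lemma gl_christoffel:
  assumes "x \<in> U"
  shows "(\<Sum>a\<in>UNIV. gl g k a x * christoffel g a i j x)
    = (1/2) * (gpd i (gl g k j) x + gpd j (gl g k i) x - gpd k (gl g i j) x)"
proof -
  define X where "X l = (1/2) * (gpd i (gl g l j) x + gpd j (gl g l i) x - gpd l (gl g i j) x)" for l
  have "(\<Sum>a\<in>UNIV. gl g k a x * christoffel g a i j x)
      = (\<Sum>a\<in>UNIV. gl g k a x * (\<Sum>l\<in>UNIV. gu g a l x * X l))"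
    by (simp add: christoffel_def pd_eq_gpd X_def sum_2 algebra_simps)
  also have "\<dots> = (\<Sum>l\<in>UNIV. (\<Sum>a\<in>UNIV. gl g k a x * gu g a l x) * X l)"
    by (simp add: sum_2 algebra_simps)
  also have "\<dots> = X k" by (simp add: gu_inverse[OF assms] if_distrib if_distribR cong: if_cong)
  finally show ?thesis by (simp add: X_def)
qed

lemma christoffel_sym: "x \<in> U \<Longrightarrow> christoffel g k i j x = christoffel g k j i x"
proof -
  assume x: "x \<in> U"
  have "gpd l (gl g i j) x = gpd l (gl g j i) x" for l
    by (rule gpd_cong_csm) (use x gl_sym in auto)
  then show ?thesis by (simp add: christoffel_def pd_eq_gpd add.commute)
qed

text \<open>The connection is metric: the two terms are Christoffel symbols of the first kind, in
  whose sum all but one derivative cancel.\<close>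

lemma gpd_gl:
  assumes "x \<in> U"
  shows "gpd l (gl g i j) x = (\<Sum>a\<in>UNIV. christoffel g a l i x * gl g a j x) + (\<Sum>a\<in>UNIV. christoffel g a l j x * gl g i a x)"
proof -
  have s: "gpd a (gl g b c) x = gpd a (gl g c b) x" for a b c
    by (rule gpd_cong_csm) (use assms gl_sym in auto)
  have "(\<Sum>a\<in>UNIV. christoffel g a l i x * gl g a j x) = (\<Sum>a\<in>UNIV. gl g j a x * christoffel g a l i x)"
    by (intro sum.cong) (auto simp: gl_sym[OF assms] mult.commute)
  moreover have "(\<Sum>a\<in>UNIV. christoffel g a l j x * gl g i a x) = (\<Sum>a\<in>UNIV. gl g i a x * christoffel g a l j x)"
    by (simp add: mult.commute)
  ultimately show ?thesis
    unfolding gl_christoffel[OF assms] using s[of l i j] s[of i l j] s[of j l i] by simp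
qed

text \<open>Nullness says that \<open>m 1 / m 2\<close> is a root of the quadratic with coefficients
  \<open>g11\<close>, \<open>2 g12\<close>, \<open>g22\<close>. Its roots are not real because the
  determinant \<open>d\<close> is positive, which also makes the square root of \<open>d\<close>
  smooth. The factor \<open>q\<close> normalises the product of \<open>m\<close> with its
  conjugate.\<close>

lemma exists_null_frame:
  "\<exists>m :: 2 \<Rightarrow> point \<Rightarrow> complex. (\<forall>i. csm U (m i)) \<and> (\<forall>x\<in>U.
     (\<Sum>i\<in>UNIV. \<Sum>j\<in>UNIV. of_real (gl g i j x) * m i x * m j x) = 0 \<and>
     (\<Sum>i\<in>UNIV. \<Sum>j\<in>UNIV. of_real (gl g i j x) * m i x * cnj (m j x)) = 1)"
proof -
  define d where "d x = gl g 1 1 x * gl g 2 2 x - gl g 1 2 x * gl g 1 2 x" for x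
  define q where "q x = sqrt (2 * gl g 1 1 x * d x)" for x
  define m where "m i x = (if i = (1::2) then of_real (- gl g 1 2 x) + \<i> * of_real (sqrt (d x)) else of_real (gl g 1 1 x))
      * of_real (inverse (q x))" for i x
  have p: "d x > 0" "gl g 1 1 x > 0" if "x \<in> U" for x
    using gl_det_pos[OF that] gl_11_pos[OF that] by (auto simp: d_def)
  have q: "q x > 0" "q x * q x = 2 * gl g 1 1 x * d x" if "x \<in> U" for x
    using p[OF that] by (auto simp: q_def)
  have dc: "csm U d" unfolding d_def[abs_def] by simp
  have sc: "csm U (\<lambda>x. sqrt (d x))" by (rule csm_sqrt[OF open_U dc p(1)])
  have qc: "csm U q" unfolding q_def[abs_def] by (rule csm_sqrt[OF open_U]) (use p dc in auto)
  have ic: "csm U (\<lambda>x. inverse (q x))" by (rule csm_inverse[OF open_U qc]) (use q in force)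
  have "csm U (m i)" for i
    unfolding m_def[abs_def] using sc ic by (cases "i = 1") (simp_all del: of_real_inverse)
  moreover have "(\<Sum>i\<in>UNIV. \<Sum>j\<in>UNIV. of_real (gl g i j x) * m i x * m j x) = 0 \<and>
     (\<Sum>i\<in>UNIV. \<Sum>j\<in>UNIV. of_real (gl g i j x) * m i x * cnj (m j x)) = 1" if x: "x \<in> U" for x
  proof -
    define a b c r Q where "a = complex_of_real (gl g 1 1 x)" "b = complex_of_real (gl g 1 2 x)"
      "c = complex_of_real (gl g 2 2 x)" "r = complex_of_real (sqrt (d x))" "Q = complex_of_real (inverse (q x))"
    have r2: "r * r = a * c - b * b"
    proof -
      have "sqrt (d x) * sqrt (d x) = d x" using p[OF x] by simp
      then have "r * r = of_real (d x)" unfolding a_b_c_r_Q_def by (simp only: of_real_mult[symmetric])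
      then show ?thesis by (simp add: a_b_c_r_Q_def d_def)
    qed
    have "2 * gl g 1 1 x * d x * (inverse (q x) * inverse (q x)) = 1"
      using q[OF x] p[OF x] by (simp add: field_simps)
    then have "complex_of_real (2 * gl g 1 1 x * d x * (inverse (q x) * inverse (q x))) = 1" by simp
    then have Q: "2 * a * (a * c - b * b) * (Q * Q) = 1"
      by (simp add: a_b_c_r_Q_def d_def)
    have m: "m 1 x = (- b + \<i> * r) * Q" "m 2 x = a * Q"
      "cnj (m 1 x) = (- b - \<i> * r) * Q" "cnj (m 2 x) = a * Q"
      by (simp_all add: m_def a_b_c_r_Q_def)
    \<comment> \<open>Both identities hold for arbitrary \<open>r\<close>. With
      \<open>r * r = a * c - b * b\<close> the first becomes zero, and \<open>Q\<close> turns the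
      second into 1.\<close>
    have e1: "a * ((- b + \<i> * r) * Q) * ((- b + \<i> * r) * Q) + b * ((- b + \<i> * r) * Q) * (a * Q)
        + (b * (a * Q) * ((- b + \<i> * r) * Q) + c * (a * Q) * (a * Q)) = a * (a * c - b * b - r * r) * (Q * Q)"
      by (simp add: algebra_simps)
    have e2: "a * ((- b + \<i> * r) * Q) * ((- b - \<i> * r) * Q) + b * ((- b + \<i> * r) * Q) * (a * Q)
        + (b * (a * Q) * ((- b - \<i> * r) * Q) + c * (a * Q) * (a * Q)) = a * (a * c - b * b + r * r) * (Q * Q)"
      by (simp add: algebra_simps)
    have s: "gl g 2 1 x = gl g 1 2 x" by (rule gl_sym[OF x])
    show ?thesis
      unfolding sum_2 m(3,4) unfolding m(1,2) s a_b_c_r_Q_def(1-3)[symmetric] e1 e2 r2 using Q by (simp add: algebra_simps)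
  qed
  ultimately show ?thesis by blast
qed

end

section \<open>Null frames\<close>

text \<open>In dimension two the covector of a null vector annihilates that vector, hence is the
  vector rotated by a right angle and divided by the determinant \<open>\<delta>\<close> of the
  pair. With these formulas the symmetric product of the two null vectors is seen to invert the
  matrix of the form.\<close>

lemma lower_null_basis:
  fixes a b c p q P Q :: complex
  assumes e1: "a * p * p + b * p * q + (b * q * p + c * q * q) = 0"
    and e2: "a * P * P + b * P * Q + (b * Q * P + c * Q * Q) = 0"
    and e3: "a * p * P + b * p * Q + (b * q * P + c * q * Q) = 1"
  shows "(p * P + P * p) * a + (p * Q + P * q) * b = 1" "(p * P + P * p) * b + (p * Q + P * q) * c = 0"
    "(q * P + Q * p) * a + (q * Q + Q * q) * b = 0" "(q * P + Q * p) * b + (q * Q + Q * q) * c = 1"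
proof -
  define \<delta> where "\<delta> = p * Q - q * P"
  have u: "\<delta> * (a * p + b * q) = - q" "\<delta> * (b * p + c * q) = p"
    "\<delta> * (a * P + b * Q) = Q" "\<delta> * (b * P + c * Q) = - P"
    unfolding \<delta>_def using e1 e2 e3 by algebra+
  have d: "\<delta> \<noteq> 0" using u e3 by auto
  have "\<delta> * ((p * P + P * p) * a + (p * Q + P * q) * b) = \<delta>"
    "\<delta> * ((p * P + P * p) * b + (p * Q + P * q) * c) = 0"
    "\<delta> * ((q * P + Q * p) * a + (q * Q + Q * q) * b) = 0"
    "\<delta> * ((q * P + Q * p) * b + (q * Q + Q * q) * c) = \<delta>"
    using u unfolding \<delta>_def by algebra+
  then show "(p * P + P * p) * a + (p * Q + P * q) * b = 1" "(p * P + P * p) * b + (p * Q + P * q) * c = 0"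
    "(q * P + Q * p) * a + (q * Q + Q * q) * b = 0" "(q * P + Q * p) * b + (q * Q + Q * q) * c = 1"
    using d by simp_all
qed

locale null_frame = metric2 +
  fixes m :: "2 \<Rightarrow> point \<Rightarrow> complex"
  assumes m_csm [simp]: "csm U (m i)"
    and m_m: "x \<in> U \<Longrightarrow> (\<Sum>i\<in>UNIV. \<Sum>j\<in>UNIV. of_real (gl g i j x) * m i x * m j x) = 0"
    and m_cnj_m: "x \<in> U \<Longrightarrow> (\<Sum>i\<in>UNIV. \<Sum>j\<in>UNIV. of_real (gl g i j x) * m i x * cnj (m j x)) = 1"
begin

text \<open>The Boolean selects \<open>m\<close> or its conjugate; \<open>wt\<close> is the corresponding weight under rotations
  of the frame.\<close>

definition mv :: "bool \<Rightarrow> 2 \<Rightarrow> point \<Rightarrow> complex" where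
  "mv \<sigma> i x = (if \<sigma> then m i x else cnj (m i x))"

definition wt :: "bool \<Rightarrow> int" where
  "wt \<sigma> = (if \<sigma> then 1 else - 1)"

lemma wt_simps [simp]: "wt True = 1" "wt False = - 1"
  by (simp_all add: wt_def)

lemma mv_csm [simp]: "csm U (mv \<sigma> i)"
  unfolding mv_def[abs_def] by (cases \<sigma>) auto

lemma cnj_mv [simp]: "cnj (mv \<sigma> i x) = mv (\<not> \<sigma>) i x"
  by (simp add: mv_def)

lemma gl_mv:
  assumes "x \<in> U"
  shows "(\<Sum>i\<in>UNIV. \<Sum>j\<in>UNIV. of_real (gl g i j x) * mv \<sigma> i x * mv \<tau> j x) = (if \<sigma> = \<tau> then 0 else 1)"
proof -
  have "(\<Sum>i\<in>UNIV. \<Sum>j\<in>UNIV. of_real (gl g i j x) * cnj (m i x) * cnj (m j x))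
      = cnj (\<Sum>i\<in>UNIV. \<Sum>j\<in>UNIV. of_real (gl g i j x) * m i x * m j x)"
    "(\<Sum>i\<in>UNIV. \<Sum>j\<in>UNIV. of_real (gl g i j x) * cnj (m i x) * m j x)
      = cnj (\<Sum>i\<in>UNIV. \<Sum>j\<in>UNIV. of_real (gl g i j x) * m i x * cnj (m j x))" by simp_all
  then show ?thesis
    using m_m[OF assms] m_cnj_m[OF assms] by (cases \<sigma>; cases \<tau>) (simp_all add: mv_def)
qed

text \<open>Completeness of the frame. Inserted as a Kronecker delta, it recovers coordinate
  components from contractions with \<open>m\<close> and its conjugate.\<close>

lemma mv_complete:
  assumes "x \<in> U"
  shows "(\<Sum>b\<in>UNIV. (m a x * cnj (m b x) + cnj (m a x) * m b x) * of_real (gl g b c x)) = (if a = c then 1 else 0)"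
proof -
  note s = gl_sym[OF assms, of 2 1]
  have "cnj (\<Sum>i\<in>UNIV. \<Sum>j\<in>UNIV. of_real (gl g i j x) * m i x * m j x) = 0"
    using m_m[OF assms] by simp
  note f = lower_null_basis[OF m_m[OF assms, unfolded sum_2 s] this[unfolded sum_2 s complex_cnj_add complex_cnj_mult complex_cnj_complex_of_real]
      m_cnj_m[OF assms, unfolded sum_2 s]]
  show ?thesis
    using f exhaust_2[of a] exhaust_2[of c] by (auto simp: sum_2 s)
qed

lemma gu_mv:
  assumes "x \<in> U"
  shows "of_real (gu g a b x) = m a x * cnj (m b x) + cnj (m a x) * m b x"
proof -
  let ?P = "\<lambda>a c. m a x * cnj (m c x) + cnj (m a x) * m c x"
  have "complex_of_real (gu g a b x) = (\<Sum>d\<in>UNIV. (if a = d then 1 else 0) * of_real (gu g d b x))"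
    by (simp add: if_distrib if_distribR cong: if_cong)
  also have "\<dots> = (\<Sum>d\<in>UNIV. (\<Sum>c\<in>UNIV. ?P a c * of_real (gl g c d x)) * of_real (gu g d b x))"
    by (simp only: mv_complete[OF assms])
  also have "\<dots> = (\<Sum>c\<in>UNIV. ?P a c * of_real (\<Sum>d\<in>UNIV. gl g c d x * gu g d b x))"
    by (simp add: sum_2 algebra_simps)
  also have "\<dots> = ?P a b"
    unfolding gu_inverse(1)[OF assms] by (simp add: if_distrib if_distribR cong: if_cong)
  finally show ?thesis .
qed

lemma gu_contract:
  assumes "x \<in> U"
  shows "(\<Sum>a\<in>UNIV. \<Sum>b\<in>UNIV. of_real (gu g a b x) * P a * Q b)
    = (\<Sum>a\<in>UNIV. mv True a x * P a) * (\<Sum>b\<in>UNIV. mv False b x * Q b)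
    + (\<Sum>a\<in>UNIV. mv False a x * P a) * (\<Sum>b\<in>UNIV. mv True b x * Q b)"
  unfolding gu_mv[OF assms] by (simp add: sum_2 mv_def algebra_simps)

section \<open>The connection form of the null frame\<close>

definition cov_mv :: "bool \<Rightarrow> 2 \<Rightarrow> 2 \<Rightarrow> point \<Rightarrow> complex" where
  "cov_mv \<sigma> l i x = gpd l (mv \<sigma> i) x + (\<Sum>a\<in>UNIV. of_real (christoffel g i l a x) * mv \<sigma> a x)"

text \<open>The connection form: \<open>m\<close> spans a complex line bundle that is preserved by
  parallel transport, and \<open>cov_mv_eq\<close> shows that its covariant derivative is
  multiplication by \<open>om\<close>.\<close>

definition om :: "2 \<Rightarrow> point \<Rightarrow> complex" where
  "om l x = (\<Sum>i\<in>UNIV. \<Sum>j\<in>UNIV. of_real (gl g i j x) * cov_mv True l i x * mv False j x)"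

lemma om_csm [simp]: "csm U (om l)"
  unfolding om_def[abs_def] cov_mv_def by simp

lemma cnj_cov_mv: "x \<in> U \<Longrightarrow> cnj (cov_mv \<sigma> l i x) = cov_mv (\<not> \<sigma>) l i x"
proof -
  assume x: "x \<in> U"
  have "(\<lambda>y. cnj (mv \<sigma> i y)) = mv (\<not> \<sigma>) i" by (rule ext) simp
  then have "gpd l (mv (\<not> \<sigma>) i) x = cnj (gpd l (mv \<sigma> i) x)"
    using gpd_cnj_csm[OF x mv_csm[of \<sigma> i], of l] by simp
  then show ?thesis by (simp add: cov_mv_def)
qed

text \<open>The products of the frame vectors are constant; this is their derivative, with the
  derivative of the metric absorbed into Christoffel symbols.\<close>

lemma gl_cov_mv:
  assumes x: "x \<in> U"
  shows "(\<Sum>i\<in>UNIV. \<Sum>j\<in>UNIV. of_real (gl g i j x) * cov_mv \<sigma> l i x * mv \<tau> j x)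
    + (\<Sum>i\<in>UNIV. \<Sum>j\<in>UNIV. of_real (gl g i j x) * mv \<sigma> i x * cov_mv \<tau> l j x) = 0"
proof -
  let ?h = "\<lambda>x. \<Sum>i\<in>UNIV. \<Sum>j\<in>UNIV. of_real (gl g i j x) * mv \<sigma> i x * mv \<tau> j x"
  have "gpd l ?h x = gpd l (\<lambda>x. if \<sigma> = \<tau> then 0 else 1) x"
    by (rule gpd_cong_csm) (use x gl_mv in auto)
  then have "gpd l ?h x = 0" by simp
  then show ?thesis
    using x by (simp add: sum_2 gpd_gl cov_mv_def algebra_simps gl_sym[OF x, of 2 1])
qed

lemma cnj_om: "x \<in> U \<Longrightarrow> cnj (om l x) = - om l x"
proof -
  assume x: "x \<in> U"
  have "cnj (om l x) = (\<Sum>i\<in>UNIV. \<Sum>j\<in>UNIV. of_real (gl g i j x) * cov_mv False l i x * mv True j x)"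
    using cnj_cov_mv[OF x] by (simp add: om_def)
  also have "\<dots> = (\<Sum>i\<in>UNIV. \<Sum>j\<in>UNIV. of_real (gl g i j x) * mv True i x * cov_mv False l j x)"
    by (simp add: sum_2 gl_sym[OF x, of 2 1])
  finally show ?thesis using gl_cov_mv[OF x, where \<sigma> = True and \<tau> = False, of l] unfolding om_def
    by (simp add: add_eq_0_iff)
qed

text \<open>The component of the derivative of \<open>m\<close> along \<open>cnj m\<close> is its
  product with \<open>m\<close>, that is, half the derivative of the constant
  \<open>g(m, m)\<close>. Only the component along \<open>m\<close> is left, and it is
  \<open>om\<close> by definition.\<close>

lemma cov_mv_eq:
  assumes x: "x \<in> U"
  shows "cov_mv \<sigma> l i x = of_int (wt \<sigma>) * om l x * mv \<sigma> i x"
proof -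
  have T: "cov_mv True l i x = om l x * mv True i x" for i
  proof -
    let ?P = "\<lambda>b. m i x * cnj (m b x) + cnj (m i x) * m b x"
    have z: "(\<Sum>i\<in>UNIV. \<Sum>j\<in>UNIV. of_real (gl g i j x) * cov_mv True l i x * mv True j x) = 0"
    proof -
      have "(\<Sum>i\<in>UNIV. \<Sum>j\<in>UNIV. of_real (gl g i j x) * mv True i x * cov_mv True l j x)
        = (\<Sum>i\<in>UNIV. \<Sum>j\<in>UNIV. of_real (gl g i j x) * cov_mv True l i x * mv True j x)"
        by (simp add: sum_2 gl_sym[OF x, of 2 1])
      then show ?thesis using gl_cov_mv[OF x, where \<sigma> = True and \<tau> = True, of l]
        by (simp add: mult_2[symmetric] del: mult_2)
    qed
    have "cov_mv True l i x = (\<Sum>c\<in>UNIV. (if i = c then 1 else 0) * cov_mv True l c x)"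
      by (simp add: if_distrib if_distribR cong: if_cong)
    also have "\<dots> = (\<Sum>c\<in>UNIV. (\<Sum>b\<in>UNIV. ?P b * of_real (gl g b c x)) * cov_mv True l c x)"
      by (simp only: mv_complete[OF x])
    also have "\<dots> = m i x * om l x + cnj (m i x) * (\<Sum>i\<in>UNIV. \<Sum>j\<in>UNIV. of_real (gl g i j x) * cov_mv True l i x * mv True j x)"
      by (simp add: om_def sum_2 mv_def gl_sym[OF x, of 2 1] algebra_simps)
    finally show ?thesis using z by (simp add: mv_def)
  qed
  show ?thesis
  proof (cases \<sigma>)
    case False
    then show ?thesis using arg_cong[OF T, of cnj] cnj_cov_mv[OF x] cnj_om[OF x] by simp
  qed (use T in simp)
qed

lemma gpd_mv:
  "x \<in> U \<Longrightarrow> gpd l (mv \<sigma> i) x =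
    of_int (wt \<sigma>) * om l x * mv \<sigma> i x - (\<Sum>a\<in>UNIV. of_real (christoffel g i l a x) * mv \<sigma> a x)"
  using cov_mv_eq[of x \<sigma> l i] by (simp add: cov_mv_def eq_diff_eq)

section \<open>Weighted derivations, their commutator and the curvature\<close>

definition cd :: "int \<Rightarrow> 2 \<Rightarrow> (point \<Rightarrow> complex) \<Rightarrow> point \<Rightarrow> complex" where
  "cd w l f x = gpd l f x - of_int w * om l x * f x"

text \<open>The weight is not recorded in the type of a function, so it is an explicit argument. The
  result has weight \<open>w + wt \<rho>\<close>, which is the weight to be used in a further
  derivation.\<close>

definition DD :: "bool \<Rightarrow> int \<Rightarrow> (point \<Rightarrow> complex) \<Rightarrow> point \<Rightarrow> complex" where
  "DD \<rho> w f x = (\<Sum>l\<in>UNIV. mv \<rho> l x * cd w l f x)"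

lemma cd_csm [simp]: "csm U f \<Longrightarrow> csm U (cd w l f)"
  unfolding cd_def[abs_def] by simp

lemma DD_csm [simp]: "csm U f \<Longrightarrow> csm U (DD \<rho> w f)"
  unfolding DD_def[abs_def] by simp

lemma DD_cong: "csm U f \<Longrightarrow> x \<in> U \<Longrightarrow> (\<And>y. y \<in> U \<Longrightarrow> f y = h y) \<Longrightarrow> DD \<rho> w f x = DD \<rho> w h x"
  using gpd_cong_csm[of f x h] by (simp add: DD_def cd_def)

lemma DD_mult:
  "x \<in> U \<Longrightarrow> csm U f \<Longrightarrow> csm U h \<Longrightarrow> w = u + v \<Longrightarrow>
    DD \<rho> w (\<lambda>x. f x * h x) x = DD \<rho> u f x * h x + f x * DD \<rho> v h x"
  by (simp add: DD_def cd_def sum_2 algebra_simps)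

lemma DD_add: "x \<in> U \<Longrightarrow> csm U f \<Longrightarrow> csm U h \<Longrightarrow> DD \<rho> w (\<lambda>x. f x + h x) x = DD \<rho> w f x + DD \<rho> w h x"
  by (simp add: DD_def cd_def sum_2 algebra_simps)

lemma DD_diff: "x \<in> U \<Longrightarrow> csm U f \<Longrightarrow> csm U h \<Longrightarrow> DD \<rho> w (\<lambda>x. f x - h x) x = DD \<rho> w f x - DD \<rho> w h x"
  by (simp add: DD_def cd_def sum_2 algebra_simps)

lemma DD_cmult: "x \<in> U \<Longrightarrow> csm U f \<Longrightarrow> DD \<rho> w (\<lambda>x. c * f x) x = c * DD \<rho> w f x"
  by (simp add: DD_def cd_def sum_2 algebra_simps)

lemma DD_zero: "DD \<rho> w (\<lambda>x. 0) x = 0"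
  by (simp add: DD_def cd_def)

text \<open>Conjugation reverses the weight as well as the direction because \<open>om\<close> is
  imaginary.\<close>

lemma DD_cnj: "x \<in> U \<Longrightarrow> csm U f \<Longrightarrow> DD \<rho> w (\<lambda>x. cnj (f x)) x = cnj (DD (\<not> \<rho>) (- w) f x)"
  by (simp add: DD_def cd_def cnj_om)

text \<open>The way back from frame derivatives to partial derivatives, by completeness; it makes
  uniqueness for linear systems available for equations in \<open>DD\<close>.\<close>

lemma gpd_eq_DD:
  assumes x: "x \<in> U"
  shows "gpd l f x = of_int w * om l x * f x
    + (\<Sum>j\<in>UNIV. of_real (gl g l j x) * mv False j x) * DD True w f x
    + (\<Sum>j\<in>UNIV. of_real (gl g l j x) * mv True j x) * DD False w f x"
proof -
  have "cd w l f x = (\<Sum>a\<in>UNIV. (if a = l then 1 else 0) * cd w a f x)"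
    by (simp add: if_distrib if_distribR cong: if_cong)
  also have "\<dots> = (\<Sum>a\<in>UNIV. (\<Sum>b\<in>UNIV. (m a x * cnj (m b x) + cnj (m a x) * m b x) * of_real (gl g b l x)) * cd w a f x)"
    by (simp only: mv_complete[OF x])
  also have "\<dots> = (\<Sum>j\<in>UNIV. of_real (gl g l j x) * mv False j x) * DD True w f x
    + (\<Sum>j\<in>UNIV. of_real (gl g l j x) * mv True j x) * DD False w f x"
    by (simp add: DD_def sum_2 mv_def algebra_simps gl_sym[OF x, of _ l])
  finally show ?thesis by (simp add: cd_def algebra_simps)
qed

text \<open>Differentiating the inner frame vector produces a Christoffel term and a multiple of
  \<open>om\<close>. The latter cancels the contribution \<open>wt \<rho>\<close> to the outer
  weight. The former is symmetric in the two directions, so it disappears from the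
  commutator.\<close>

lemma DD_DD:
  assumes x: "x \<in> U" and f: "csm U f"
  shows "DD \<sigma> (w + wt \<rho>) (DD \<rho> w f) x = (\<Sum>k\<in>UNIV. \<Sum>l\<in>UNIV. mv \<sigma> k x * mv \<rho> l x *
    (gpd k (cd w l f) x - (\<Sum>a\<in>UNIV. of_real (christoffel g a k l x) * cd w a f x) - of_int w * om k x * cd w l f x))"
proof -
  have "DD \<rho> w f = (\<lambda>x. \<Sum>l\<in>UNIV. mv \<rho> l x * cd w l f x)" by (rule ext) (rule DD_def)
  then have G: "gpd k (DD \<rho> w f) x = (\<Sum>l\<in>UNIV. mv \<rho> l x * gpd k (cd w l f) x + gpd k (mv \<rho> l) x * cd w l f x)" for k
    using x f by (simp add: sum_2)
  show ?thesis
    unfolding DD_def[of \<sigma>] cd_def[of "w + wt \<rho>"] G gpd_mv[OF x] DD_def[of \<rho> w f x]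
    by (simp add: sum_2 algebra_simps)
qed

definition curv :: "2 \<Rightarrow> 2 \<Rightarrow> point \<Rightarrow> complex" where
  "curv a b x = gpd a (om b) x - gpd b (om a) x"

text \<open>The Ricci identity for the frame vectors: it expresses that their mixed partial
  derivatives, computed from \<open>gpd_mv\<close>, agree.\<close>

lemma curv_mv:
  assumes x: "x \<in> U"
  shows "curv a b x * (of_int (wt \<sigma>) * mv \<sigma> i x) = (\<Sum>c\<in>UNIV. of_real (riemann g i c a b x) * mv \<sigma> c x)"
proof -
  have e: "gpd a (gpd b (mv \<sigma> i)) x = gpd a (\<lambda>x. of_int (wt \<sigma>) * om b x * mv \<sigma> i x
      - (\<Sum>c\<in>UNIV. of_real (christoffel g i b c x) * mv \<sigma> c x)) x" for a b
    by (rule gpd_cong_csm) (use x gpd_mv in auto)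
  show ?thesis
    using gpd_commute[OF open_U mv_csm x, of a b \<sigma> i] x unfolding e
    by (simp add: gpd_mv[OF x] curv_def riemann_def pd_eq_gpd sum_2 algebra_simps)
qed

text \<open>The two halves of the trace are equal: exchanging \<open>m\<close> and
  \<open>cnj m\<close> changes the sign of the weight in \<open>curv_mv\<close>, and exchanging the
  indices changes the sign of \<open>curv\<close>.\<close>

lemma curv_scalar:
  assumes x: "x \<in> U"
  shows "(\<Sum>a\<in>UNIV. \<Sum>b\<in>UNIV. mv True a x * mv False b x * curv a b x) = of_real (scalar_curv g x) / 2"
proof -
  have "of_real (scalar_curv g x) = (\<Sum>a\<in>UNIV. \<Sum>b\<in>UNIV. \<Sum>c\<in>UNIV.
      (m b x * cnj (m c x) + cnj (m b x) * m c x) * of_real (riemann g a c a b x))"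
    by (simp add: scalar_curv_def gu_mv[OF x])
  also have "\<dots> = (\<Sum>a\<in>UNIV. \<Sum>b\<in>UNIV. mv True b x * (\<Sum>c\<in>UNIV. of_real (riemann g a c a b x) * mv False c x)
      + mv False b x * (\<Sum>c\<in>UNIV. of_real (riemann g a c a b x) * mv True c x))"
    by (simp add: mv_def sum_2 algebra_simps)
  also have "\<dots> = 2 * (\<Sum>a\<in>UNIV. \<Sum>b\<in>UNIV. mv True a x * mv False b x * curv a b x)"
    unfolding curv_mv[OF x, symmetric] by (simp add: sum_2 algebra_simps curv_def)
  finally show ?thesis by simp
qed

lemma DD_commutator:
  assumes x: "x \<in> U" and f: "csm U f"
  shows "DD True (w - 1) (DD False w f) x - DD False (w + 1) (DD True w f) x
    = - of_int w / 2 * of_real (scalar_curv g x) * f x"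
proof -
  have c: "gpd k (cd w l f) x - gpd l (cd w k f) x
      = - of_int w * (curv k l x * f x + om l x * gpd k f x - om k x * gpd l f x)" for k l
    using x f gpd_commute[OF open_U f x, of k l]
    by (simp add: cd_def[abs_def] curv_def algebra_simps)
  have 1: "w - 1 = w + wt False" and 2: "w + 1 = w + wt True" by simp_all
  have "DD True (w - 1) (DD False w f) x - DD False (w + 1) (DD True w f) x
      = (\<Sum>k\<in>UNIV. \<Sum>l\<in>UNIV. mv True k x * mv False l x *
         ((gpd k (cd w l f) x - gpd l (cd w k f) x) - of_int w * (om k x * cd w l f x - om l x * cd w k f x)))"
    unfolding 1 2 DD_DD[OF x f] by (simp add: sum_2 christoffel_sym[OF x, of _ 2 1] algebra_simps)
  also have "\<dots> = - of_int w * f x * (\<Sum>k\<in>UNIV. \<Sum>l\<in>UNIV. mv True k x * mv False l x * curv k l x)"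
    unfolding c by (simp add: cd_def sum_2 algebra_simps)
  finally show ?thesis by (simp add: curv_scalar[OF x])
qed

section \<open>Frame components of tensors and of their covariant derivatives\<close>

definition C1 :: "bool \<Rightarrow> tensor1 \<Rightarrow> point \<Rightarrow> complex" where
  "C1 \<sigma> A x = (\<Sum>i\<in>UNIV. mv \<sigma> i x * of_real (A i x))"

definition C2 :: "bool \<Rightarrow> bool \<Rightarrow> tensor2 \<Rightarrow> point \<Rightarrow> complex" where
  "C2 \<sigma> \<tau> A x = (\<Sum>i\<in>UNIV. \<Sum>j\<in>UNIV. mv \<sigma> i x * mv \<tau> j x * of_real (A i j x))"

definition C3 :: "bool \<Rightarrow> bool \<Rightarrow> bool \<Rightarrow> tensor3 \<Rightarrow> point \<Rightarrow> complex" where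
  "C3 \<sigma> \<tau> \<upsilon> A x = (\<Sum>i\<in>UNIV. \<Sum>j\<in>UNIV. \<Sum>k\<in>UNIV. mv \<sigma> i x * mv \<tau> j x * mv \<upsilon> k x * of_real (A i j k x))"

definition C4 :: "bool \<Rightarrow> bool \<Rightarrow> bool \<Rightarrow> bool \<Rightarrow> (2 \<Rightarrow> tensor3) \<Rightarrow> point \<Rightarrow> complex" where
  "C4 \<rho> \<sigma> \<tau> \<upsilon> A x = (\<Sum>l\<in>UNIV. \<Sum>i\<in>UNIV. \<Sum>j\<in>UNIV. \<Sum>k\<in>UNIV.
     mv \<rho> l x * mv \<sigma> i x * mv \<tau> j x * mv \<upsilon> k x * of_real (A l i j k x))"

lemma C_csm [simp]:
  "(\<And>i. csm U (A1 i)) \<Longrightarrow> csm U (C1 \<sigma> A1)"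
  "(\<And>i j. csm U (A2 i j)) \<Longrightarrow> csm U (C2 \<sigma> \<tau> A2)"
  "(\<And>i j k. csm U (A3 i j k)) \<Longrightarrow> csm U (C3 \<sigma> \<tau> \<upsilon> A3)"
  unfolding C1_def[abs_def] C2_def[abs_def] C3_def[abs_def] by simp_all

lemma cnj_C [simp]:
  "cnj (C1 \<sigma> A1 x) = C1 (\<not> \<sigma>) A1 x"
  "cnj (C2 \<sigma> \<tau> A2 x) = C2 (\<not> \<sigma>) (\<not> \<tau>) A2 x"
  "cnj (C3 \<sigma> \<tau> \<upsilon> A3 x) = C3 (\<not> \<sigma>) (\<not> \<tau>) (\<not> \<upsilon>) A3 x"
  unfolding C1_def C2_def C3_def by simp_all

lemma C1_grad: "x \<in> U \<Longrightarrow> csm U f \<Longrightarrow> C1 \<rho> (grad f) x = DD \<rho> 0 (\<lambda>x. of_real (f x)) x"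
  by (simp add: C1_def DD_def cd_def grad_def pd_eq_gpd)

text \<open>The Christoffel terms of the covariant derivative cancel those in \<open>gpd_mv\<close>.
  What remains of the derivative of the frame is the weight term of \<open>cd\<close>. The same
  holds for more indices.\<close>

lemma C2_nabla1:
  assumes "x \<in> U" "\<And>i. csm U (A i)"
  shows "C2 \<rho> \<sigma> (nabla1 g A) x = DD \<rho> (wt \<sigma>) (C1 \<sigma> A) x"
proof -
  have "cd (wt \<sigma>) l (C1 \<sigma> A) x = (\<Sum>i\<in>UNIV. mv \<sigma> i x * of_real (nabla1 g A l i x))" for l
    using assms by (simp add: cd_def C1_def[abs_def] nabla1_def pd_eq_gpd gpd_mv sum_2 algebra_simps)
  then show ?thesis by (simp add: DD_def C2_def sum_2 algebra_simps)
qed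

lemma C3_nabla2:
  assumes "x \<in> U" "\<And>i j. csm U (A i j)"
  shows "C3 \<rho> \<sigma> \<tau> (nabla2 g A) x = DD \<rho> (wt \<sigma> + wt \<tau>) (C2 \<sigma> \<tau> A) x"
proof -
  have "cd (wt \<sigma> + wt \<tau>) l (C2 \<sigma> \<tau> A) x = (\<Sum>i\<in>UNIV. \<Sum>j\<in>UNIV. mv \<sigma> i x * mv \<tau> j x * of_real (nabla2 g A l i j x))" for l
    using assms by (simp add: cd_def C2_def[abs_def] nabla2_def pd_eq_gpd gpd_mv sum_2 algebra_simps)
  then show ?thesis by (simp add: DD_def C3_def sum_2 algebra_simps)
qed

lemma C4_nabla3:
  assumes "x \<in> U" "\<And>i j k. csm U (A i j k)"
  shows "C4 \<rho> \<sigma> \<tau> \<upsilon> (nabla3 g A) x = DD \<rho> (wt \<sigma> + wt \<tau> + wt \<upsilon>) (C3 \<sigma> \<tau> \<upsilon> A) x"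
proof -
  have "cd (wt \<sigma> + wt \<tau> + wt \<upsilon>) l (C3 \<sigma> \<tau> \<upsilon> A) x =
    (\<Sum>i\<in>UNIV. \<Sum>j\<in>UNIV. \<Sum>k\<in>UNIV. mv \<sigma> i x * mv \<tau> j x * mv \<upsilon> k x * of_real (nabla3 g A l i j k x))" for l
    using assms by (simp add: cd_def C3_def[abs_def] nabla3_def pd_eq_gpd gpd_mv sum_2 algebra_simps)
  then show ?thesis by (simp add: DD_def C4_def sum_2 algebra_simps)
qed

text \<open>The basis of the comparison lemmas below, which remove one index at a time: tensor
  identities may be checked on frame components.\<close>

lemma mv_separates:
  fixes P :: "2 \<Rightarrow> complex"
  assumes "x \<in> U" and "\<And>\<sigma>. (\<Sum>i\<in>UNIV. mv \<sigma> i x * P i) = 0"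
  shows "P i = 0"
proof -
  have "P i = (\<Sum>a\<in>UNIV. (if a = i then 1 else 0) * P a)"
    by (simp add: if_distrib if_distribR cong: if_cong)
  also have "\<dots> = (\<Sum>a\<in>UNIV. (\<Sum>b\<in>UNIV. (m a x * cnj (m b x) + cnj (m a x) * m b x) * of_real (gl g b i x)) * P a)"
    by (simp only: mv_complete[OF assms(1)])
  also have "\<dots> = (\<Sum>b\<in>UNIV. cnj (m b x) * of_real (gl g b i x)) * (\<Sum>a\<in>UNIV. mv True a x * P a)
      + (\<Sum>b\<in>UNIV. m b x * of_real (gl g b i x)) * (\<Sum>a\<in>UNIV. mv False a x * P a)"
    by (simp add: mv_def sum_2 algebra_simps)
  finally show ?thesis by (simp add: assms(2))
qed

lemma C1_eqI: "x \<in> U \<Longrightarrow> (\<And>\<sigma>. C1 \<sigma> A x = C1 \<sigma> B x) \<Longrightarrow> A i x = B i x"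
  using mv_separates[of x "\<lambda>i. of_real (A i x) - of_real (B i x)"]
  by (simp add: C1_def right_diff_distrib sum_subtractf)

lemma C2_eqI:
  assumes "x \<in> U" "\<And>\<sigma> \<tau>. C2 \<sigma> \<tau> A x = C2 \<sigma> \<tau> B x"
  shows "A i j x = B i j x"
proof -
  have "(\<Sum>j\<in>UNIV. mv \<tau> j x * of_real (A i j x)) - (\<Sum>j\<in>UNIV. mv \<tau> j x * of_real (B i j x)) = 0" for i \<tau>
    by (rule mv_separates[OF assms(1)])
      (use assms(2)[of _ \<tau>] in \<open>simp add: C2_def sum_2 algebra_simps\<close>)
  then show ?thesis using C1_eqI[OF assms(1), of "A i" "B i"] by (simp add: C1_def)
qed

lemma C3_eqI:
  assumes "x \<in> U" "\<And>\<sigma> \<tau> \<upsilon>. C3 \<sigma> \<tau> \<upsilon> A x = C3 \<sigma> \<tau> \<upsilon> B x"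
  shows "A i j k x = B i j k x"
proof -
  have "C2 \<tau> \<upsilon> (A i) x - C2 \<tau> \<upsilon> (B i) x = 0" for i \<tau> \<upsilon>
    by (rule mv_separates[OF assms(1)])
      (use assms(2)[of _ \<tau> \<upsilon>] in \<open>simp add: C2_def C3_def sum_2 algebra_simps\<close>)
  then show ?thesis using C2_eqI[OF assms(1), of "A i" "B i"] by simp
qed

lemma C4_eqI:
  assumes "x \<in> U" "\<And>\<rho> \<sigma> \<tau> \<upsilon>. C4 \<rho> \<sigma> \<tau> \<upsilon> A x = C4 \<rho> \<sigma> \<tau> \<upsilon> B x"
  shows "A l i j k x = B l i j k x"
proof -
  have "C3 \<sigma> \<tau> \<upsilon> (A l) x - C3 \<sigma> \<tau> \<upsilon> (B l) x = 0" for l \<sigma> \<tau> \<upsilon>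
    by (rule mv_separates[OF assms(1)])
      (use assms(2)[of _ \<sigma> \<tau> \<upsilon>] in \<open>simp add: C3_def C4_def sum_2 algebra_simps\<close>)
  then show ?thesis using C3_eqI[OF assms(1), of "A l" "B l"] by simp
qed

end

section \<open>Potentials\<close>

text \<open>The unknowns are indexed by numbers below \<open>n\<close>. The type \<open>'n\<close>
  serves to transport the system to \<open>real ^ 'n\<close>, where an injective endomorphism is
  surjective.\<close>

lemma square_system_solvable:
  fixes M :: "nat \<Rightarrow> nat \<Rightarrow> real" and y :: "nat \<Rightarrow> real"
  assumes n: "n = CARD('n::finite)"
    and inj: "\<And>c. (\<And>k. k < n \<Longrightarrow> (\<Sum>i<n. c i * M k i) = 0) \<Longrightarrow> (\<And>i. i < n \<Longrightarrow> c i = 0)"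
  shows "\<exists>c. \<forall>k<n. (\<Sum>i<n. c i * M k i) = y k"
proof -
  obtain h where h: "bij_betw h (UNIV :: 'n set) {..<n}"
    using ex_bij_betw_finite_nat[OF finite, of "UNIV :: 'n set"] unfolding n atLeast0LessThan by blast
  define h' where "h' = inv_into UNIV h"
  have hh': "h (h' i) = i" if "i < n" for i
    using bij_betw_inv_into_right[OF h] that by (simp add: h'_def)
  have h'h: "h' (h j) = j" for j using bij_betw_inv_into_left[OF h] by (simp add: h'_def)
  have hn: "h j < n" for j using bij_betwE[OF h] by auto
  define \<Phi> :: "real ^ 'n \<Rightarrow> real ^ 'n" where "\<Phi> c = (\<chi> k. \<Sum>j\<in>UNIV. c $ j * M (h k) (h j))" for c
  have re: "(\<Sum>i<n. c i * M k i) = (\<Sum>j\<in>UNIV. c (h j) * M k (h j))" for c k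
    by (rule sum.reindex_bij_betw[OF h, symmetric])
  have lin: "linear \<Phi>"
    by (rule linearI) (simp_all add: \<Phi>_def vec_eq_iff sum.distrib algebra_simps sum_distrib_left)
  have "c = 0" if "\<Phi> c = 0" for c
  proof -
    have "c $ h' i = 0" if "i < n" for i
    proof (rule inj[OF _ that])
      fix k assume "k < n"
      have "(\<Sum>i<n. c $ h' i * M k i) = \<Phi> c $ h' k"
        by (simp add: re h'h \<Phi>_def hh'[OF \<open>k < n\<close>])
      then show "(\<Sum>i<n. c $ h' i * M k i) = 0" using \<open>\<Phi> c = 0\<close> by simp
    qed
    then show ?thesis using hn h'h by (metis vec_eq_iff zero_index)
  qed
  then have "inj \<Phi>" using linear_injective_0[OF lin] by blast
  then have "surj \<Phi>" using linear_injective_imp_surjective[OF lin] by blast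
  then obtain c where c: "\<Phi> c = (\<chi> k. y (h k))" by (metis surjD)
  have "(\<Sum>i<n. c $ h' i * M k i) = y k" if "k < n" for k
  proof -
    have "(\<Sum>i<n. c $ h' i * M k i) = \<Phi> c $ h' k"
      by (simp add: re h'h \<Phi>_def hh'[OF that])
    then show ?thesis by (simp add: c hh'[OF that])
  qed
  then show ?thesis by (intro exI[of _ "\<lambda>i. c $ h' i"]) auto
qed

lemma sum_lessThan_3: "(\<Sum>j<3. h j) = h 0 + h 1 + h (2::nat)"
  by (simp add: eval_nat_numeral)

lemma sum_lessThan_4: "(\<Sum>j<4. h j) = h 0 + h 1 + h 2 + h (3::nat)"
  by (simp add: eval_nat_numeral)

lemma less_3_cases: "i < 3 \<Longrightarrow> i = 0 \<or> i = 1 \<or> i = (2::nat)"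
  by auto

lemma less_4_cases: "i < 4 \<Longrightarrow> i = 0 \<or> i = 1 \<or> i = 2 \<or> i = (3::nat)"
  by auto

context null_frame
begin

text \<open>In coordinates the weights contribute multiples of \<open>om\<close> on the diagonal, so
  a system that is closed under both frame derivations is closed under partial derivatives,
  too.\<close>

lemma frame_system_unique:
  fixes f :: "nat \<Rightarrow> point \<Rightarrow> complex" and w :: "nat \<Rightarrow> int" and \<alpha> :: "bool \<Rightarrow> nat \<Rightarrow> nat \<Rightarrow> point \<Rightarrow> complex"
  assumes con: "connected U"
    and f: "\<And>i. i < n \<Longrightarrow> csm U (f i)"
    and \<alpha>: "\<And>\<rho> i j. i < n \<Longrightarrow> j < n \<Longrightarrow> csm U (\<alpha> \<rho> i j)"
    and eq: "\<And>\<rho> i x. i < n \<Longrightarrow> x \<in> U \<Longrightarrow> DD \<rho> (w i) (f i) x = (\<Sum>j<n. \<alpha> \<rho> i j x * f j x)"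
    and z: "z \<in> U" "\<And>i. i < n \<Longrightarrow> f i z = 0"
    and x: "x \<in> U" "i < n"
  shows "f i x = 0"
proof -
  define A where "A l i j x = (if i = j then of_int (w i) * om l x else 0)
    + (\<Sum>k\<in>UNIV. of_real (gl g l k x) * mv False k x) * \<alpha> True i j x
    + (\<Sum>k\<in>UNIV. of_real (gl g l k x) * mv True k x) * \<alpha> False i j x" for l i j x
  show ?thesis
  proof (rule linear_system_unique[OF open_U con, of n f A z])
    show "continuous_on U (A l i j)" if "i < n" "j < n" for l i j
      unfolding A_def[abs_def] using \<alpha> that by (intro csm_continuous_on) (cases "i = j"; simp)
    show "gpd l (f i) x = (\<Sum>j<n. A l i j x * f j x)" if "i < n" "x \<in> U" for l i x
    proof -
      have "(\<Sum>j<n. (if i = j then of_int (w i) * om l x else 0) * f j x)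
          = (\<Sum>j<n. if i = j then of_int (w i) * om l x * f j x else 0)"
        by (intro sum.cong) auto
      also have "\<dots> = of_int (w i) * om l x * f i x" using that(1) by (simp add: sum.delta)
      finally have d: "(\<Sum>j<n. (if i = j then of_int (w i) * om l x else 0) * f j x) = of_int (w i) * om l x * f i x" .
      show ?thesis
        unfolding gpd_eq_DD[OF that(2), of l "f i" "w i"] eq[OF that] A_def distrib_right sum.distrib d
        by (simp only: mult.assoc sum_distrib_left[symmetric])
    qed
      show "f i differentiable (at x)" if "i < n" "x \<in> U" for i x
      using csm_differentiable[OF f[OF that(1)] that(2)] .
  qed (use z x in auto)
qed

lemma C2_gl: "x \<in> U \<Longrightarrow> C2 \<sigma> \<tau> (gl g) x = (if \<sigma> = \<tau> then 0 else 1)"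
  using gl_mv[of x \<sigma> \<tau>] by (simp add: C2_def sum_2 algebra_simps)

lemma grad_csm [simp]: "csm U f \<Longrightarrow> csm U (grad f i)"
  by (simp add: grad_def pd_eq_gpd)

lemma hess_sym: "x \<in> U \<Longrightarrow> csm U f \<Longrightarrow> hess g f i j x = hess g f j i x"
  by (simp add: hess_def nabla1_def grad_def pd_eq_gpd gpd_commute_real[OF open_U, of f x i j]
      christoffel_sym[of x _ j i])

lemma C2_hess:
  assumes "x \<in> U" "csm U f"
  shows "C2 \<sigma> \<tau> (hess g f) x = DD \<sigma> (wt \<tau>) (C1 \<tau> (grad f)) x"
proof -
  have "C2 \<sigma> \<tau> (hess g f) x = C2 \<sigma> \<tau> (nabla1 g (grad f)) x"
    by (simp add: C2_def hess_sym[OF assms, of _ _] hess_def[symmetric])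
  then show ?thesis using C2_nabla1[OF assms(1)] assms(2) by simp
qed

lemma C2_hess_sym: "x \<in> U \<Longrightarrow> csm U f \<Longrightarrow> C2 \<sigma> \<tau> (hess g f) x = C2 \<tau> \<sigma> (hess g f) x"
  by (simp add: C2_def hess_sym[of x f 2 1] sum_2 algebra_simps)

lemma laplacian_frame:
  assumes "x \<in> U" "csm U f"
  shows "of_real (laplacian g f x) = 2 * C2 True False (hess g f) x"
proof -
  have "of_real (laplacian g f x) = (\<Sum>a\<in>UNIV. \<Sum>b\<in>UNIV. of_real (gu g a b x) * of_real (hess g f a b x))"
    by (simp add: laplacian_def)
  also have "\<dots> = C2 True False (hess g f) x + C2 False True (hess g f) x"
    unfolding gu_mv[OF assms(1)] by (simp add: C2_def mv_def sum_2 algebra_simps)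
  finally show ?thesis using C2_hess_sym[OF assms, of False True] by simp
qed

end

locale system = null_frame +
  fixes \<V> :: "scalar set" and \<F> :: "phase_fun set" and T S :: tensor3 and t :: scalar
  assumes nd: "nondeg_superintegrable U g \<V> \<F>"
    and st: "structure_tensor U g \<V> T"
    and sd: "structure_decomposition U g T S t"
begin

lemma connected_U: "connected U"
  using nd by (simp add: nondeg_superintegrable_def)

lemma S_csm [simp]: "csm U (S i j k)"
  using sd by (simp add: structure_decomposition_def smooth_fun_csm)

lemma t_csm [simp]: "csm U t"
  using sd by (simp add: structure_decomposition_def smooth_fun_csm)

lemma \<V>_csm: "V \<in> \<V> \<Longrightarrow> csm U V"
  using nd by (simp add: nondeg_superintegrable_def smooth_fun_csm)

lemma S_sym:
  assumes "x \<in> U"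
  shows "S 1 2 1 x = S 1 1 2 x" "S 2 1 1 x = S 1 1 2 x" "S 2 1 2 x = S 1 2 2 x" "S 2 2 1 x = S 1 2 2 x"
  using sd assms unfolding structure_decomposition_def by metis+

definition s :: "point \<Rightarrow> complex" where "s = C3 True True True S"

definition \<tau> :: "point \<Rightarrow> complex" where "\<tau> = C1 True (grad t)"

text \<open>The component \<open>\<Xi>(m, m)\<close>, as confirmed in \<open>C2_Xi\<close>. In the
  divergence of \<open>S\<close> only the derivative along \<open>cnj m\<close> contributes, because
  the mixed components of \<open>S\<close> vanish.\<close>

definition \<xi> :: "point \<Rightarrow> complex" where "\<xi> x = DD False 3 s x + 2/3 * cnj (\<tau> x) * s x"

definition R :: "point \<Rightarrow> complex" where "R x = of_real (scalar_curv g x)"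

lemma s_csm [simp]: "csm U s" and \<tau>_csm [simp]: "csm U \<tau>"
  unfolding s_def \<tau>_def by simp_all

lemma \<xi>_csm [simp]: "csm U \<xi>"
  unfolding \<xi>_def[abs_def] by simp

lemma R_csm [simp]: "csm U R"
  unfolding R_def[abs_def] scalar_curv_def[abs_def] riemann_def pd_eq_gpd by simp

lemma cnj_R [simp]: "cnj (R x) = R x"
  by (simp add: R_def)

lemma C1_t: "C1 True (grad t) x = \<tau> x" "C1 False (grad t) x = cnj (\<tau> x)"
  by (simp_all add: \<tau>_def)

lemma C3_S_swap:
  assumes "x \<in> U"
  shows "C3 a b c S x = C3 b a c S x" "C3 a b c S x = C3 a c b S x"
  by (simp_all add: C3_def sum_2 S_sym[OF assms] algebra_simps)

text \<open>The trace over two indices is the sum of their two mixed components, and these agree by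
  symmetry.\<close>

lemma C3_S_mixed:
  assumes x: "x \<in> U"
  shows "C3 True False c S x = 0"
proof -
  have z: "trace2 g x (\<lambda>a b. S a b k x) = 0" for k
    using sd x unfolding structure_decomposition_def by blast
  have "0 = (\<Sum>k\<in>UNIV. mv c k x * of_real (trace2 g x (\<lambda>a b. S a b k x)))" by (simp add: z)
  also have "\<dots> = C3 True False c S x + C3 False True c S x"
    unfolding trace2_def of_real_sum of_real_mult gu_mv[OF x]
    by (simp add: C3_def mv_def sum_2 algebra_simps)
  finally show ?thesis using C3_S_swap(1)[OF x, of False True c] by simp
qed

lemma C3_S:
  assumes x: "x \<in> U"
  shows "C3 a b c S x = (if a = b \<and> b = c then if a then s x else cnj (s x) else 0)"
  using C3_S_mixed[OF x] C3_S_swap[OF x]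
  by (cases a; cases b; cases c) (simp_all add: s_def, metis+)

lemma C3_T:
  assumes x: "x \<in> U"
  shows "C3 a b c T x = C3 a b c S x + C1 a (grad t) x * C2 b c (gl g) x
    + C1 b (grad t) x * C2 a c (gl g) x - C2 a b (gl g) x * C1 c (grad t) x"
proof -
  have "T i j k x = S i j k x + grad t i x * gl g j k x + grad t j x * gl g i k x - gl g i j x * grad t k x" for i j k
    using sd x unfolding structure_decomposition_def by blast
  note e = this
  show ?thesis
    unfolding C3_def e by (simp add: C3_def C2_def C1_def sum_2 algebra_simps)
qed

section \<open>The closed system satisfied by potentials\<close>

definition v :: "scalar \<Rightarrow> point \<Rightarrow> complex" where "v V = C1 True (grad V)"

text \<open>Half the Laplacian is the mixed component of the Hessian, as
  \<open>g(m, cnj m) = 1\<close>.\<close>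

definition L :: "scalar \<Rightarrow> point \<Rightarrow> complex" where "L V x = of_real (laplacian g V x) / 2"

lemma v_csm [simp]: "csm U V \<Longrightarrow> csm U (v V)"
  by (simp add: v_def)

lemma L_csm [simp]: "csm U V \<Longrightarrow> csm U (L V)"
  unfolding L_def[abs_def] laplacian_def[abs_def] hess_def nabla1_def pd_eq_gpd by simp

lemma cnj_L [simp]: "cnj (L V x) = L V x"
  by (simp add: L_def)

text \<open>The structure tensor is trace-free in its first two indices, so the mixed component of
  the Hessian consists of the Laplacian term alone.\<close>

lemma C2_hess_V:
  assumes x: "x \<in> U" and V: "V \<in> \<V>"
  shows "C2 True True (hess g V) x = s x * cnj (v V x) + 2 * \<tau> x * v V x"
    and "C2 False False (hess g V) x = cnj (s x) * v V x + 2 * cnj (\<tau> x) * cnj (v V x)"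
    and "C2 True False (hess g V) x = L V x" "C2 False True (hess g V) x = L V x"
proof -
  have h: "hess g V i j x = (\<Sum>k\<in>UNIV. T i j k x * up1 g (grad V) k x) + (1/2) * gl g i j x * laplacian g V x" for i j
    using st V x unfolding structure_tensor_def by blast
  have "C2 a b (hess g V) x = (\<Sum>i\<in>UNIV. \<Sum>j\<in>UNIV. mv a i x * mv b j x *
      ((\<Sum>k\<in>UNIV. \<Sum>c\<in>UNIV. of_real (gu g k c x) * of_real (T i j k x) * of_real (grad V c x))))
      + L V x * C2 a b (gl g) x" for a b
    unfolding C2_def h by (simp add: up1_def L_def sum_2 algebra_simps add_divide_distrib)
  also have "\<dots> a b = C3 a b True T x * C1 False (grad V) x + C3 a b False T x * C1 True (grad V) x
      + L V x * C2 a b (gl g) x" for a b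
    unfolding gu_contract[OF x] by (simp add: C3_def C1_def sum_2 algebra_simps)
  finally have "C2 a b (hess g V) x = C3 a b True T x * cnj (v V x) + C3 a b False T x * v V x
      + L V x * C2 a b (gl g) x" for a b by (simp add: v_def)
  then show "C2 True True (hess g V) x = s x * cnj (v V x) + 2 * \<tau> x * v V x"
    "C2 False False (hess g V) x = cnj (s x) * v V x + 2 * cnj (\<tau> x) * cnj (v V x)"
    "C2 True False (hess g V) x = L V x" "C2 False True (hess g V) x = L V x"
    by (simp_all add: C3_T[OF x] C3_S[OF x] C2_gl[OF x] C1_t)
qed

lemma DD_V:
  assumes x: "x \<in> U" and V: "V \<in> \<V>"
  shows "DD True 1 (v V) x = s x * cnj (v V x) + 2 * \<tau> x * v V x"
    and "DD False 1 (v V) x = L V x"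
    and "DD True (- 1) (\<lambda>x. cnj (v V x)) x = L V x"
    and "DD False (- 1) (\<lambda>x. cnj (v V x)) x = cnj (s x) * v V x + 2 * cnj (\<tau> x) * cnj (v V x)"
    and "DD True 0 (\<lambda>x. of_real (V x)) x = v V x"
    and "DD False 0 (\<lambda>x. of_real (V x)) x = cnj (v V x)"
proof -
  note c = \<V>_csm[OF V]
  show 1: "DD True 1 (v V) x = s x * cnj (v V x) + 2 * \<tau> x * v V x"
    using C2_hess[OF x c, of True True] C2_hess_V(1)[OF x V] by (simp add: v_def)
  show 2: "DD False 1 (v V) x = L V x"
    using C2_hess[OF x c, of False True] C2_hess_V(4)[OF x V] by (simp add: v_def)
  show "DD True (- 1) (\<lambda>x. cnj (v V x)) x = L V x"
    "DD False (- 1) (\<lambda>x. cnj (v V x)) x = cnj (s x) * v V x + 2 * cnj (\<tau> x) * cnj (v V x)"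
    using x c 1 2 by (simp_all add: DD_cnj)
  show "DD True 0 (\<lambda>x. of_real (V x)) x = v V x" "DD False 0 (\<lambda>x. of_real (V x)) x = cnj (v V x)"
    using C1_grad[OF x c, symmetric] by (simp_all add: v_def)
qed

text \<open>As \<open>L\<close> is the derivative of \<open>v\<close> along \<open>cnj m\<close>,
  its derivative along \<open>m\<close> can be computed by commuting and differentiating the known
  \<open>DD True 1 (v V)\<close>. This closes the system for \<open>V\<close>, \<open>v\<close>, its
  conjugate and \<open>L\<close>.\<close>

lemma DD_L:
  assumes x: "x \<in> U" and V: "V \<in> \<V>"
  shows "DD True 0 (L V) x = (DD False 3 s x + 2 * cnj (\<tau> x) * s x) * cnj (v V x)
      + (s x * cnj (s x) + 2 * DD False 1 \<tau> x - R x / 2) * v V x + 2 * \<tau> x * L V x"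
proof -
  note c [simp] = \<V>_csm[OF V]
  have 1: "DD True 0 (DD False 1 (v V)) x = DD True 0 (L V) x"
    by (rule DD_cong) (use x DD_V(2)[OF _ V] in auto)
  have "DD False 2 (DD True 1 (v V)) x = DD False 2 (\<lambda>x. s x * cnj (v V x) + 2 * (\<tau> x * v V x)) x"
    by (rule DD_cong) (use x DD_V(1)[OF _ V] in auto)
  also have "\<dots> = DD False 3 s x * cnj (v V x) + s x * (cnj (s x) * v V x + 2 * cnj (\<tau> x) * cnj (v V x))
      + 2 * (DD False 1 \<tau> x * v V x + \<tau> x * L V x)"
  proof -
    have "DD False 2 (\<lambda>x. s x * cnj (v V x)) x
        = DD False 3 s x * cnj (v V x) + s x * (cnj (s x) * v V x + 2 * cnj (\<tau> x) * cnj (v V x))"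
      using x DD_mult[of x s "\<lambda>x. cnj (v V x)" 2 3 "- 1" False] by (simp add: DD_V[OF x V])
    moreover have "DD False 2 (\<lambda>x. \<tau> x * v V x) x = DD False 1 \<tau> x * v V x + \<tau> x * L V x"
      using x DD_mult[of x \<tau> "v V" 2 1 1 False] by (simp add: DD_V[OF x V])
    ultimately show ?thesis using x by (simp add: DD_add DD_cmult)
  qed
  finally show ?thesis
    using DD_commutator[OF x, of "v V" 1] 1 by (simp add: R_def algebra_simps)
qed

end

section \<open>Killing tensors\<close>

text \<open>A binary cubic form has four coefficients; the values at the two unit vectors, their sum
  and their difference determine them.\<close>

lemma cubic_form_zero:
  fixes N :: "2 \<Rightarrow> 2 \<Rightarrow> 2 \<Rightarrow> real"
  assumes z: "\<And>Q :: 2 \<Rightarrow> real. (\<Sum>i\<in>UNIV. \<Sum>j\<in>UNIV. \<Sum>k\<in>UNIV. N i j k * Q i * Q j * Q k) = 0"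
    and sym: "\<And>i j k. N i j k = N i k j"
  shows "N i j k + N j k i + N k i j = 0"
proof -
  have 1: "N 1 1 1 = 0" using z[of "\<lambda>i. if i = 1 then 1 else 0"] by (simp add: sum_2)
  have 2: "N 2 2 2 = 0" using z[of "\<lambda>i. if i = 1 then 0 else 1"] by (simp add: sum_2)
  have s: "N 1 2 1 = N 1 1 2" "N 2 2 1 = N 2 1 2" by (rule sym)+
  have 3: "2 * N 1 1 2 + N 2 1 1 + (2 * N 2 1 2 + N 1 2 2) = 0"
    using z[of "\<lambda>i. 1"] by (simp add: sum_2 1 2 s)
  have 4: "- (2 * N 1 1 2 + N 2 1 1) + (2 * N 2 1 2 + N 1 2 2) = 0"
    using z[of "\<lambda>i. if i = 1 then 1 else - 1"] by (simp add: sum_2 1 2 s)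
  have "2 * N 1 1 2 + N 2 1 1 = 0" "2 * N 2 1 2 + N 1 2 2 = 0" using 3 4 by linarith+
  then show ?thesis
    using exhaust_2[of i] exhaust_2[of j] exhaust_2[of k] by (elim disjE) (simp_all add: 1 2 s)
qed

context metric2
begin

lemma quadratic_has_derivative:
  fixes K :: tensor2 and W :: scalar and F :: phase_fun
  assumes x: "x \<in> U" and K: "\<And>i j. csm U (K i j)" and W: "csm U W"
    and F: "\<forall>y\<in>U. \<forall>p. F (y, p) = (\<Sum>i\<in>UNIV. \<Sum>j\<in>UNIV. K i j y * p $ i * p $ j) + W y"
  shows "(F has_derivative (\<lambda>h. (\<Sum>i\<in>UNIV. \<Sum>j\<in>UNIV.
      frechet_derivative (K i j) (at x) (fst h) * p $ i * p $ j
      + K i j x * snd h $ i * p $ j + K i j x * p $ i * snd h $ j)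
      + frechet_derivative W (at x) (fst h))) (at (x, p))"
proof -
  have 1: "((\<lambda>z. f (fst z)) has_derivative (\<lambda>h. frechet_derivative f (at x) (fst h))) (at (x, p))"
    if "csm U f" for f :: scalar
    using has_derivative_compose[OF has_derivative_fst[OF has_derivative_ident], of f "frechet_derivative f (at x)" "(x, p)" UNIV]
      differentiable_has_derivative[OF csm_differentiable[OF that x]] by simp
  have 2: "((\<lambda>z. snd z $ i) has_derivative (\<lambda>h. snd h $ i)) (at (x, p))" for i
    by (intro bounded_linear_imp_has_derivative bounded_linear_compose[OF bounded_linear_vec_nth bounded_linear_snd, unfolded o_def])
  have 3: "((\<lambda>z. K i j (fst z) * snd z $ i * snd z $ j) has_derivative
      (\<lambda>h. frechet_derivative (K i j) (at x) (fst h) * p $ i * p $ j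
      + K i j x * snd h $ i * p $ j + K i j x * p $ i * snd h $ j)) (at (x, p))" for i j
    by (rule has_derivative_eq_rhs[OF has_derivative_mult[OF has_derivative_mult[OF 1[OF K] 2] 2]])
      (auto simp: algebra_simps)
  have "((\<lambda>z. (\<Sum>i\<in>UNIV. \<Sum>j\<in>UNIV. K i j (fst z) * snd z $ i * snd z $ j) + W (fst z)) has_derivative
     (\<lambda>h. (\<Sum>i\<in>UNIV. \<Sum>j\<in>UNIV.
      frechet_derivative (K i j) (at x) (fst h) * p $ i * p $ j
      + K i j x * snd h $ i * p $ j + K i j x * p $ i * snd h $ j)
      + frechet_derivative W (at x) (fst h))) (at (x, p))"
    by (intro has_derivative_add has_derivative_sum 3 1[OF W])
  then show ?thesis
    by (rule has_derivative_transform_within_open[of _ _ _ _ "U \<times> UNIV"])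
      (use x F open_U in \<open>auto intro: open_Times\<close>)
qed

lemma dx_dp_quadratic:
  fixes K :: tensor2 and W :: scalar and F :: phase_fun
  assumes x: "x \<in> U" and K: "\<And>i j. csm U (K i j)" and W: "csm U W"
    and F: "\<forall>y\<in>U. \<forall>p. F (y, p) = (\<Sum>i\<in>UNIV. \<Sum>j\<in>UNIV. K i j y * p $ i * p $ j) + W y"
    and sym: "\<And>i j. K i j x = K j i x"
  shows "dx l F (x, p) = (\<Sum>i\<in>UNIV. \<Sum>j\<in>UNIV. gpd l (K i j) x * p $ i * p $ j) + gpd l W x"
    and "dp l F (x, p) = 2 * (\<Sum>j\<in>UNIV. K l j x * p $ j)"
proof -
  note d = frechet_derivative_at[OF quadratic_has_derivative[where F = F, OF x K W F], of p]
  have z: "frechet_derivative f (at x) 0 = 0" if "csm U f" for f :: scalar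
    using linear_0[OF linear_frechet_derivative[OF csm_differentiable[OF that x]]] .
  show "dx l F (x, p) = (\<Sum>i\<in>UNIV. \<Sum>j\<in>UNIV. gpd l (K i j) x * p $ i * p $ j) + gpd l W x"
    unfolding dx_def d[symmetric] by (simp add: gpd_def)
  show "dp l F (x, p) = 2 * (\<Sum>j\<in>UNIV. K l j x * p $ j)"
    unfolding dp_def d[symmetric] using exhaust_2[of l] sym[of 2 1]
    by (auto simp: z[OF K] z[OF W] sum_2 axis_def algebra_simps)
qed

lemma poisson_hamiltonian:
  assumes x: "x \<in> U" and K: "\<And>i j. csm U (K i j)" and W: "csm U W"
    and F: "\<forall>y\<in>U. \<forall>p. F (y, p) = (\<Sum>i\<in>UNIV. \<Sum>j\<in>UNIV. K i j y * p $ i * p $ j) + W y"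
    and sym: "\<And>i j. K i j x = K j i x" and V: "csm U V"
  shows "poisson F (hamiltonian g V) (x, p) = (\<Sum>l\<in>UNIV.
    ((\<Sum>i\<in>UNIV. \<Sum>j\<in>UNIV. gpd l (K i j) x * p $ i * p $ j) + gpd l W x) * (2 * (\<Sum>j\<in>UNIV. gu g l j x * p $ j))
    - (2 * (\<Sum>j\<in>UNIV. K l j x * p $ j)) * ((\<Sum>i\<in>UNIV. \<Sum>j\<in>UNIV. gpd l (gu g i j) x * p $ i * p $ j) + gpd l V x))"
proof -
  have H: "\<forall>y\<in>U. \<forall>p. hamiltonian g V (y, p) = (\<Sum>i\<in>UNIV. \<Sum>j\<in>UNIV. gu g i j y * p $ i * p $ j) + V y"
    by (simp add: hamiltonian_def)
  show ?thesis
    unfolding poisson_def dx_dp_quadratic[where F = F, OF x K W F sym]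
      dx_dp_quadratic[where F = "hamiltonian g V", OF x gu_csm V H gu_sym[OF x]] ..
qed

lemma low2_csm: "(\<And>i j. csm U (K i j)) \<Longrightarrow> csm U (low2 g K i j)"
  unfolding low2_def[abs_def] by simp

lemma low2_sym: "(\<And>i j. K i j x = K j i x) \<Longrightarrow> low2 g K i j x = low2 g K j i x"
proof -
  assume s: "\<And>i j. K i j x = K j i x"
  show ?thesis using exhaust_2[of i] exhaust_2[of j] s[of 2 1] by (auto simp: low2_def sum_2 algebra_simps)
qed

lemma raise_low2:
  assumes x: "x \<in> U" and s: "\<And>i j. K i j x = K j i x"
  shows "(\<Sum>n\<in>UNIV. gu g m n x * low2 g K n i x) = mixed g K m i x"
proof -
  have "(\<Sum>n\<in>UNIV. gu g m n x * low2 g K n i x)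
      = (\<Sum>b\<in>UNIV. \<Sum>a\<in>UNIV. (\<Sum>n\<in>UNIV. gu g m n x * gl g n a x) * gl g i b x * K a b x)"
    by (simp add: low2_def sum_2 algebra_simps)
  also have "\<dots> = (\<Sum>b\<in>UNIV. gl g i b x * K m b x)"
    unfolding gu_inverse[OF x] by (simp add: if_distrib if_distribR cong: if_cong)
  also have "\<dots> = mixed g K m i x" by (simp add: mixed_def gl_sym[OF x, of _ i] mult.commute)
  finally show ?thesis .
qed

lemma low2_zero_imp:
  assumes x: "x \<in> U" and s: "\<And>i j. K i j x = K j i x" and z: "\<And>i j. low2 g K i j x = 0"
  shows "K i j x = 0"
proof -
  have m: "mixed g K i b x = 0" for b using raise_low2[of x K i b, OF x s] z by simp
  have "K i j x = (\<Sum>a\<in>UNIV. K i a x * (if a = j then 1 else 0))"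
    by (simp add: if_distrib if_distribR cong: if_cong)
  also have "\<dots> = (\<Sum>b\<in>UNIV. mixed g K i b x * gu g b j x)"
    unfolding gu_inverse(1)[OF x, symmetric] by (simp add: mixed_def sum_2 algebra_simps)
  finally show ?thesis by (simp add: m)
qed

end

context null_frame
begin

text \<open>Metricity for the inverse metric. In its expression by the frame, each product contains
  \<open>m\<close> and its conjugate once, so the contributions of \<open>om\<close> cancel.\<close>

lemma gpd_gu:
  assumes x: "x \<in> U"
  shows "gpd l (gu g a b) x = - (\<Sum>c\<in>UNIV. christoffel g a l c x * gu g c b x) - (\<Sum>c\<in>UNIV. christoffel g b l c x * gu g a c x)"
proof -
  have gm: "of_real (gu g a b y) = mv True a y * mv False b y + mv False a y * mv True b y" if "y \<in> U" for y a b
    using gu_mv[OF that] by (simp add: mv_def)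
  have "complex_of_real (gpd l (gu g a b) x) = gpd l (\<lambda>y. complex_of_real (gu g a b y)) x" using x by simp
  also have "\<dots> = gpd l (\<lambda>y. mv True a y * mv False b y + mv False a y * mv True b y) x"
    by (rule gpd_cong_csm) (use x gm in auto)
  also have "\<dots> = of_real (- (\<Sum>c\<in>UNIV. christoffel g a l c x * gu g c b x) - (\<Sum>c\<in>UNIV. christoffel g b l c x * gu g a c x))"
    using x by (simp add: gpd_mv gm[OF x] sum_2 algebra_simps)
  finally show ?thesis by (simp only: of_real_eq_iff)
qed

text \<open>The part of the Poisson bracket that is cubic in the momenta is the symmetrised covariant
  derivative of the Killing tensor. The momentum \<open>p\<close> is held fixed while its raised version \<open>P\<close>
  varies with the base point.\<close>

lemma cubic_part:
  fixes Q :: "2 \<Rightarrow> real"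
  assumes x: "x \<in> U" and K: "\<And>i j. csm U (K i j)" and sym: "\<forall>y\<in>U. \<forall>i j. K i j y = K j i y"
  defines "A \<equiv> low2 g K" and "p \<equiv> \<lambda>b. \<Sum>c\<in>UNIV. gl g b c x * Q c"
  shows "(\<Sum>i\<in>UNIV. Q i * (\<Sum>a\<in>UNIV. \<Sum>b\<in>UNIV. gpd i (K a b) x * p a * p b)
     - (\<Sum>a\<in>UNIV. K i a x * p a) * (\<Sum>b\<in>UNIV. \<Sum>c\<in>UNIV. gpd i (gu g b c) x * p b * p c))
    = (\<Sum>i\<in>UNIV. \<Sum>a\<in>UNIV. \<Sum>b\<in>UNIV. nabla2 g A i a b x * Q i * Q a * Q b)"
proof -
  define P where "P a y = (\<Sum>b\<in>UNIV. gu g a b y * p b)" for a y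
  define q where "q i c = (\<Sum>b\<in>UNIV. christoffel g b i c x * p b)" for i c
  have Ac [simp]: "csm U (A i j)" for i j unfolding A_def by (rule low2_csm[OF K])
  have sx: "K i j x = K j i x" for i j using sym x by blast
  have As: "A 2 1 x = A 1 2 x" unfolding A_def by (rule low2_sym) (rule sx)
  have Pc [simp]: "csm U (P a)" for a unfolding P_def[abs_def] by simp
  have Px: "P a x = Q a" for a
  proof -
    have "P a x = (\<Sum>c\<in>UNIV. (\<Sum>b\<in>UNIV. gu g a b x * gl g b c x) * Q c)"
      by (simp add: P_def p_def sum_2 algebra_simps)
    then show ?thesis unfolding gu_inverse[OF x] by (simp add: if_distrib if_distribR cong: if_cong)
  qed
  have gP: "gpd i (P a) x = - (\<Sum>c\<in>UNIV. christoffel g a i c x * Q c) - (\<Sum>c\<in>UNIV. gu g a c x * q i c)" for i a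
  proof -
    have "gpd i (P a) x = (\<Sum>b\<in>UNIV. gpd i (gu g a b) x * p b)" using x by (simp add: P_def[abs_def] sum_2)
    also have "\<dots> = - (\<Sum>c\<in>UNIV. christoffel g a i c x * P c x) - (\<Sum>c\<in>UNIV. gu g a c x * q i c)"
      unfolding gpd_gu[OF x] by (simp add: P_def q_def sum_2 algebra_simps)
    finally show ?thesis by (simp add: Px)
  qed
  have lowP: "(\<Sum>a\<in>UNIV. gl g a c y * P a y) = p c" if "y \<in> U" for c y
  proof -
    have "(\<Sum>a\<in>UNIV. gl g a c y * P a y) = (\<Sum>b\<in>UNIV. (\<Sum>a\<in>UNIV. gl g c a y * gu g a b y) * p b)"
      by (simp add: P_def sum_2 algebra_simps gl_sym[OF that, of c])
    then show ?thesis unfolding gu_inverse[OF that] by (simp add: if_distrib if_distribR cong: if_cong)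
  qed
  \<comment> \<open>The same scalar in terms of the lowered tensor and the raised momentum. Being
    valid on all of \<open>U\<close>, the identity can be differentiated, which brings in the
    derivatives of \<open>A\<close>.\<close>
  have KA: "(\<Sum>a\<in>UNIV. \<Sum>b\<in>UNIV. K a b y * p a * p b) = (\<Sum>a\<in>UNIV. \<Sum>b\<in>UNIV. A a b y * P a y * P b y)" if "y \<in> U" for y
    unfolding lowP[OF that, symmetric] by (simp add: A_def low2_def sum_2 algebra_simps)
  have e1: "(\<Sum>a\<in>UNIV. \<Sum>b\<in>UNIV. gpd i (K a b) x * p a * p b)
     = (\<Sum>a\<in>UNIV. \<Sum>b\<in>UNIV. gpd i (A a b) x * Q a * Q b + A a b x * gpd i (P a) x * Q b + A a b x * Q a * gpd i (P b) x)" for i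
  proof -
    have "(\<Sum>a\<in>UNIV. \<Sum>b\<in>UNIV. gpd i (K a b) x * p a * p b) = gpd i (\<lambda>y. \<Sum>a\<in>UNIV. \<Sum>b\<in>UNIV. K a b y * p a * p b) x"
      using x K by (simp add: sum_2)
    also have "\<dots> = gpd i (\<lambda>y. \<Sum>a\<in>UNIV. \<Sum>b\<in>UNIV. A a b y * P a y * P b y) x"
      by (rule gpd_cong_csm) (use x K KA in auto)
    also have "\<dots> = (\<Sum>a\<in>UNIV. \<Sum>b\<in>UNIV. gpd i (A a b) x * Q a * Q b + A a b x * gpd i (P a) x * Q b + A a b x * Q a * gpd i (P b) x)"
      using x by (simp add: sum_2 Px algebra_simps)
    finally show ?thesis .
  qed
  have qs: "q 2 1 = q 1 2" by (simp add: q_def christoffel_sym[OF x, of _ 2 1])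
  have us: "gu g 2 1 x = gu g 1 2 x" by (rule gu_sym[OF x])
  have e2: "(\<Sum>b\<in>UNIV. \<Sum>c\<in>UNIV. gpd i (gu g b c) x * p b * p c) = - 2 * (\<Sum>c\<in>UNIV. q i c * Q c)" for i
  proof -
    have "(\<Sum>b\<in>UNIV. \<Sum>c\<in>UNIV. gpd i (gu g b c) x * p b * p c) = (\<Sum>b\<in>UNIV. gpd i (P b) x * p b)"
      using x by (simp add: P_def[abs_def] sum_2 algebra_simps)
    also have "\<dots> = - (\<Sum>c\<in>UNIV. q i c * Q c) - (\<Sum>c\<in>UNIV. q i c * P c x)"
      unfolding gP by (simp add: q_def P_def sum_2 us algebra_simps)
    finally show ?thesis by (simp add: Px)
  qed
  have e3: "(\<Sum>a\<in>UNIV. K i a x * p a) = (\<Sum>c\<in>UNIV. \<Sum>a\<in>UNIV. gu g i c x * A c a x * Q a)" for i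
  proof -
    have "(\<Sum>c\<in>UNIV. \<Sum>a\<in>UNIV. gu g i c x * A c a x * Q a) = (\<Sum>a\<in>UNIV. mixed g K i a x * Q a)"
      unfolding raise_low2[of x K i, OF x sx, symmetric] by (simp add: A_def sum_2 algebra_simps)
    then show ?thesis by (simp add: mixed_def p_def sum_2 algebra_simps)
  qed
  show ?thesis
    unfolding e1 e2 e3 gP nabla2_def pd_eq_gpd
    by (simp add: sum_2 qs us As algebra_simps)
qed

lemma killing_equation:
  assumes x: "x \<in> U" and K: "\<And>i j. csm U (K i j)" and W: "csm U W"
    and F: "\<forall>y\<in>U. \<forall>p. F (y, p) = (\<Sum>i\<in>UNIV. \<Sum>j\<in>UNIV. K i j y * p $ i * p $ j) + W y"
    and sym: "\<forall>y\<in>U. \<forall>i j. K i j y = K j i y" and V: "csm U V"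
    and PB: "\<And>p. poisson F (hamiltonian g V) (x, p) = 0"
  shows "nabla2 g (low2 g K) i j k x + nabla2 g (low2 g K) j k i x + nabla2 g (low2 g K) k i j x = 0"
proof -
  let ?N = "nabla2 g (low2 g K)"
  have sx: "K i j x = K j i x" for i j using sym x by blast
  have "(\<Sum>i\<in>UNIV. \<Sum>a\<in>UNIV. \<Sum>b\<in>UNIV. ?N i a b x * Q i * Q a * Q b) = 0" for Q :: "2 \<Rightarrow> real"
  proof -
    define pf where "pf b = (\<Sum>c\<in>UNIV. gl g b c x * Q c)" for b
    define p :: point where "p = (\<chi> b. pf b)"
    have pb: "p $ b = pf b" for b by (simp add: p_def)
    define c3 where "c3 p = (\<Sum>l\<in>UNIV.
      (\<Sum>i\<in>UNIV. \<Sum>j\<in>UNIV. gpd l (K i j) x * p $ i * p $ j) * (2 * (\<Sum>j\<in>UNIV. gu g l j x * p $ j))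
      - (2 * (\<Sum>j\<in>UNIV. K l j x * p $ j)) * (\<Sum>i\<in>UNIV. \<Sum>j\<in>UNIV. gpd l (gu g i j) x * p $ i * p $ j))" for p :: point
    define c1 where "c1 p = (\<Sum>l\<in>UNIV. gpd l W x * (2 * (\<Sum>j\<in>UNIV. gu g l j x * p $ j))
      - (2 * (\<Sum>j\<in>UNIV. K l j x * p $ j)) * gpd l V x)" for p :: point
    have c: "c3 p + c1 p = 0" for p
      using PB[of p] unfolding poisson_hamiltonian[where F = F, OF x K W F sx V] c3_def c1_def
      by (simp add: sum_2 algebra_simps)
    \<comment> \<open>The bracket has parts of degree 3 and 1 in the momenta. Doubling
      \<open>p\<close> scales them by 8 and 2, so each vanishes separately.\<close>
    have "c3 (2 *\<^sub>R p) = 8 * c3 p" "c1 (2 *\<^sub>R p) = 2 * c1 p"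
      by (simp_all add: c3_def c1_def sum_2 algebra_simps)
    then have "c3 p = 0" using c[of p] c[of "2 *\<^sub>R p"] by linarith
    moreover have Px: "(\<Sum>j\<in>UNIV. gu g l j x * p $ j) = Q l" for l
    proof -
      have "(\<Sum>j\<in>UNIV. gu g l j x * p $ j) = (\<Sum>c\<in>UNIV. (\<Sum>b\<in>UNIV. gu g l b x * gl g b c x) * Q c)"
        by (simp add: pb pf_def sum_2 algebra_simps)
      then show ?thesis unfolding gu_inverse[OF x] by (simp add: if_distrib if_distribR cong: if_cong)
    qed
    moreover have "c3 p = 2 * (\<Sum>i\<in>UNIV. Q i * (\<Sum>a\<in>UNIV. \<Sum>b\<in>UNIV. gpd i (K a b) x * pf a * pf b)
     - (\<Sum>a\<in>UNIV. K i a x * pf a) * (\<Sum>b\<in>UNIV. \<Sum>c\<in>UNIV. gpd i (gu g b c) x * pf b * pf c))"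
      unfolding c3_def Px unfolding pb by (simp add: sum_2 algebra_simps)
    ultimately show ?thesis
      using cubic_part[OF x K sym, of Q, folded pf_def] by simp
  qed
  moreover have "?N i j k x = ?N i k j x" for i j k
  proof -
    have s: "low2 g K a b y = low2 g K b a y" if "y \<in> U" for a b y
      by (rule low2_sym) (use sym that in blast)
    have "gpd i (low2 g K j k) x = gpd i (low2 g K k j) x"
      by (rule gpd_cong_csm) (use x s low2_csm[OF K] in auto)
    then show ?thesis by (simp add: nabla2_def pd_eq_gpd s[OF x, of _ k] s[OF x, of _ j])
  qed
  ultimately show ?thesis by (rule cubic_form_zero[of "\<lambda>i j k. ?N i j k x"])
qed

text \<open>If the Killing tensor vanishes, the bracket with the Hamiltonian is twice the derivative
  of \<open>W\<close> along the raised momentum. Hence \<open>W\<close> has zero differential. This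
  is what contradicts functional independence in \<open>K_jet\<close>.\<close>

lemma integral_without_momenta:
  assumes x: "x \<in> U" and K: "\<And>i j. csm U (K i j)" and W: "csm U W"
    and F: "\<forall>y\<in>U. \<forall>p. F (y, p) = (\<Sum>i\<in>UNIV. \<Sum>j\<in>UNIV. K i j y * p $ i * p $ j) + W y"
    and K0: "\<And>i j y. y \<in> U \<Longrightarrow> K i j y = 0" and V: "csm U V"
    and PB: "\<And>p. poisson F (hamiltonian g V) (x, p) = 0"
  shows "frechet_derivative F (at (x, p)) h = 0"
proof -
  have gK: "gpd l (K i j) x = 0" for l i j
    using gpd_cong_csm[OF K x, of i j "\<lambda>_. 0" l] K0 by simp
  have s0: "K i j x = K j i x" for i j by (simp add: K0[OF x])
  have gW: "gpd l W x = 0" for l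
  proof -
    \<comment> \<open>The momentum whose raised version is the \<open>l\<close>-th coordinate
      vector, which isolates \<open>gpd l W x\<close>.\<close>
    define p :: point where "p = (\<chi> b. gl g b l x)"
    have "(\<Sum>j\<in>UNIV. gu g i j x * p $ j) = (if i = l then 1 else 0)" for i
      using gu_inverse(2)[OF x, of i l] by (simp add: p_def)
    then show ?thesis
      using PB[of p] exhaust_2[of l] unfolding poisson_hamiltonian[where F = F, OF x K W F s0 V]
      by (auto simp: K0[OF x] gK sum_2)
  qed
  have z: "frechet_derivative f (at x) v = 0" if "csm U f" "\<And>l. gpd l f x = 0" for f :: scalar and v
    using frechet_derivative_gpd[OF csm_differentiable[OF that(1) x], of v] that(2) by simp
  show ?thesis
    unfolding frechet_derivative_at[OF quadratic_has_derivative[where F = F, OF x K W F], symmetric]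
    by (simp add: K0[OF x] z[OF K gK] z[OF W gW])
qed

lemma DD_sum:
  "x \<in> U \<Longrightarrow> (\<And>i. i \<in> I \<Longrightarrow> csm U (f i)) \<Longrightarrow> finite I \<Longrightarrow>
    DD \<rho> w (\<lambda>x. \<Sum>i\<in>I. c i * f i x) x = (\<Sum>i\<in>I. c i * DD \<rho> w (f i) x)"
  by (induction I rule: infinite_finite_induct) (auto simp: DD_zero DD_add DD_cmult)

lemma C2_bd_form:
  assumes x: "x \<in> U" and s: "\<And>i j. K i j x = K j i x"
  shows "C2 a b (bd_form g K V) x =
    C2 True a (low2 g K) x * C2 b False (hess g V) x + C2 False a (low2 g K) x * C2 b True (hess g V) x
    + C3 b True a (nabla2 g (low2 g K)) x * C1 False (grad V) x
    + C3 b False a (nabla2 g (low2 g K)) x * C1 True (grad V) x"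
proof -
  let ?A = "low2 g K"
  have "bd_form g K V i j x = (\<Sum>n\<in>UNIV. \<Sum>k\<in>UNIV. gu g n k x * ?A n i x * hess g V j k x)
     + (\<Sum>n\<in>UNIV. \<Sum>k\<in>UNIV. gu g n k x * nabla2 g ?A j n i x * grad V k x)" for i j
    unfolding bd_form_def raise_low2[of x K, OF x s, symmetric]
    by (simp add: sum_2 gu_sym[OF x, of 2 1] algebra_simps)
  then have "C2 a b (bd_form g K V) x = (\<Sum>i\<in>UNIV. \<Sum>j\<in>UNIV. mv a i x * mv b j x *
     ((\<Sum>n\<in>UNIV. \<Sum>k\<in>UNIV. of_real (gu g n k x) * of_real (?A n i x) * of_real (hess g V j k x))
     + (\<Sum>n\<in>UNIV. \<Sum>k\<in>UNIV. of_real (gu g n k x) * of_real (nabla2 g ?A j n i x) * of_real (grad V k x))))"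
    by (simp add: C2_def)
  then show ?thesis
    unfolding gu_contract[OF x] by (simp add: C2_def C3_def C1_def sum_2 algebra_simps)
qed

end

section \<open>Jets of potentials and Killing tensors\<close>

context system
begin

text \<open>A potential whose value, differential and Laplacian vanish at \<open>x0\<close> is zero,
  by uniqueness for its closed system. These are four real numbers, so on a space of dimension 4
  they can be prescribed.\<close>

lemma V_jet:
  assumes x0: "x0 \<in> U"
  shows "\<exists>V\<in>\<V>. v V x0 = v0 \<and> L V x0 = 0"
proof -
  obtain b where b: "fun_basis U \<V> 4 b" using nd by (auto simp: nondeg_superintegrable_def)
  define Vc where "Vc c x = (\<Sum>i<4. c i * b i x)" for c :: "nat \<Rightarrow> real" and x
  have Vc: "Vc c \<in> \<V>" for c using b by (auto simp: fun_basis_def Vc_def)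
  have b\<V>: "b i \<in> \<V>" if "i < 4" for i
  proof -
    have "Vc (\<lambda>j. if j = i then 1 else 0) = b i"
      using that by (simp add: Vc_def fun_eq_iff if_distrib if_distribR cong: if_cong)
    then show ?thesis using Vc by metis
  qed
  note bc = \<V>_csm[OF b\<V>]
  have vc: "v (Vc c) x = (\<Sum>i<4. of_real (c i) * v (b i) x)" if x: "x \<in> U" for c x
  proof -
    have "v (Vc c) x = DD True 0 (\<lambda>x. \<Sum>i<4. of_real (c i) * of_real (b i x)) x"
      using DD_V(5)[OF x Vc, of c] by (simp add: Vc_def)
    also have "\<dots> = (\<Sum>i<4. of_real (c i) * DD True 0 (\<lambda>x. of_real (b i x)) x)"
      using x bc by (intro DD_sum) auto
    also have "\<dots> = (\<Sum>i<4. of_real (c i) * v (b i) x)"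
      using DD_V(5)[OF x b\<V>] by (intro sum.cong) auto
    finally show ?thesis .
  qed
  have Lc: "L (Vc c) x = (\<Sum>i<4. of_real (c i) * L (b i) x)" if x: "x \<in> U" for c x
  proof -
    have "L (Vc c) x = DD False 1 (v (Vc c)) x" using DD_V(2)[OF x Vc] by simp
    also have "\<dots> = DD False 1 (\<lambda>x. \<Sum>i<4. of_real (c i) * v (b i) x) x"
      by (rule DD_cong) (use x vc \<V>_csm[OF Vc] in auto)
    also have "\<dots> = (\<Sum>i<4. of_real (c i) * DD False 1 (v (b i)) x)"
      using x bc by (intro DD_sum) auto
    also have "\<dots> = (\<Sum>i<4. of_real (c i) * L (b i) x)"
      using DD_V(2)[OF x b\<V>] by (intro sum.cong) auto
    finally show ?thesis .
  qed
  have unique: "V x = 0" if V: "V \<in> \<V>" and z: "V x0 = 0" "v V x0 = 0" "L V x0 = 0" and x: "x \<in> U" for V x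
  proof -
    note c [simp] = \<V>_csm[OF V]
    define a where "a x = DD False 3 s x + 2 * cnj (\<tau> x) * s x" for x
    define d where "d x = s x * cnj (s x) + 2 * DD False 1 \<tau> x - R x / 2" for x
    have ad [simp]: "csm U a" "csm U d" unfolding a_def[abs_def] d_def[abs_def] by simp_all
    \<comment> \<open>The right-hand sides involve \<open>v\<close> and its conjugate, so the
      conjugate is a separate unknown in a complex linear system.\<close>
    define f where "f = (!) [\<lambda>x. of_real (V x), v V, \<lambda>x. cnj (v V x), L V]"
    define w where "w = (!) [0, 1, - 1, 0 :: int]"
    define \<alpha> where "\<alpha> \<rho> i j = (if \<rho> then
        [[\<lambda>_. 0, \<lambda>_. 1, \<lambda>_. 0, \<lambda>_. 0], [\<lambda>_. 0, \<lambda>x. 2 * \<tau> x, s, \<lambda>_. 0],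
         [\<lambda>_. 0, \<lambda>_. 0, \<lambda>_. 0, \<lambda>_. 1], [\<lambda>_. 0, d, a, \<lambda>x. 2 * \<tau> x]] ! i ! j
      else
        [[\<lambda>_. 0, \<lambda>_. 0, \<lambda>_. 1, \<lambda>_. 0], [\<lambda>_. 0, \<lambda>_. 0, \<lambda>_. 0, \<lambda>_. 1],
         [\<lambda>_. 0, \<lambda>x. cnj (s x), \<lambda>x. 2 * cnj (\<tau> x), \<lambda>_. 0],
         [\<lambda>_. 0, \<lambda>x. cnj (a x), \<lambda>x. cnj (d x), \<lambda>x. 2 * cnj (\<tau> x)]] ! i ! j)" for \<rho> and i j :: nat
    have DL: "DD True 0 (L V) y = a y * cnj (v V y) + d y * v V y + 2 * \<tau> y * L V y" if "y \<in> U" for y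
      using DD_L[OF that V] by (simp add: a_def d_def)
    have DL': "DD False 0 (L V) y = cnj (DD True 0 (L V) y)" if "y \<in> U" for y
    proof -
      have "DD False 0 (L V) y = DD False 0 (\<lambda>y. cnj (L V y)) y" by simp
      then show ?thesis using DD_cnj[OF that L_csm[OF c], of False 0] by (simp del: cnj_L)
    qed
    have "f 0 x = 0"
    proof (rule frame_system_unique[OF connected_U, of 4 f \<alpha> w x0 x 0])
      show "csm U (f i)" if "i < 4" for i
        using less_4_cases[OF that] by (auto simp: f_def)
      show "csm U (\<alpha> \<rho> i j)" if "i < 4" "j < 4" for \<rho> i j
        using less_4_cases[OF that(1)] less_4_cases[OF that(2)]
        by (cases \<rho>; elim disjE; simp add: \<alpha>_def)
      show "DD \<rho> (w i) (f i) y = (\<Sum>j<4. \<alpha> \<rho> i j y * f j y)" if "i < 4" "y \<in> U" for \<rho> i y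
        using less_4_cases[OF that(1)]
        by (cases \<rho>; elim disjE;
            simp add: \<alpha>_def f_def w_def sum_lessThan_4 DD_V[OF that(2) V] DL'[OF that(2)] DL[OF that(2)])
      show "f i x0 = 0" if "i < 4" for i
        using less_4_cases[OF that] z by (auto simp: f_def)
    qed (use x x0 in auto)
    then show ?thesis by (simp add: f_def)
  qed
  \<comment> \<open>Row \<open>k\<close> evaluates one of the four real data at \<open>x0\<close>.
    The function \<open>L\<close> is real, so its real part suffices.\<close>
  define M where "M k i = (if k = 0 then b i x0 else if k = 1 then Re (v (b i) x0)
    else if k = 2 then Im (v (b i) x0) else Re (L (b i) x0))" for k i :: nat
  have Mv: "(\<Sum>i<4. c i * M 0 i) = Vc c x0" "(\<Sum>i<4. c i * M 1 i) = Re (v (Vc c) x0)"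
    "(\<Sum>i<4. c i * M 2 i) = Im (v (Vc c) x0)" "(\<Sum>i<4. c i * M 3 i) = Re (L (Vc c) x0)" for c
    by (simp_all add: M_def Vc_def[symmetric] vc[OF x0] Lc[OF x0])
  have ReL: "L V x0 = of_real (Re (L V x0))" for V by (simp add: L_def)
  have "\<exists>c. \<forall>k<4. (\<Sum>i<4. c i * M k i) = [0, Re v0, Im v0, 0] ! k"
  proof (rule square_system_solvable[where 'n = 4])
    show "c i = 0" if z: "\<And>k. k < 4 \<Longrightarrow> (\<Sum>i<4. c i * M k i) = 0" and i: "i < 4" for c i
    proof -
      have "Vc c x0 = 0" "v (Vc c) x0 = 0" "Re (L (Vc c) x0) = 0"
        using z[of 0] z[of 1] z[of 2] z[of 3] by (simp_all add: Mv complex_eq_iff del: One_nat_def)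
      then have "Vc c x = 0" if "x \<in> U" for x
        using unique[OF Vc _ _ _ that] ReL[of "Vc c"] by simp
      then show ?thesis using b i by (auto simp: fun_basis_def Vc_def)
    qed
  qed simp
  then obtain c where c: "\<And>k. k < 4 \<Longrightarrow> (\<Sum>i<4. c i * M k i) = [0, Re v0, Im v0, 0] ! k" by blast
  have "v (Vc c) x0 = v0" using c[of 1] c[of 2] by (simp add: Mv complex_eq_iff del: One_nat_def)
  moreover have "L (Vc c) x0 = 0" using c[of 3] ReL[of "Vc c"] by (simp add: Mv)
  ultimately show ?thesis using Vc by blast
qed

section \<open>The closed system satisfied by Killing tensors\<close>

definition \<kappa> :: "tensor2 \<Rightarrow> point \<Rightarrow> complex" where "\<kappa> K = C2 True True (low2 g K)"

text \<open>For the symmetric tensors considered here, \<open>\<eta>\<close> is real and equals half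
  the trace, while \<open>\<kappa>\<close> represents the trace-free part.\<close>

definition \<eta> :: "tensor2 \<Rightarrow> point \<Rightarrow> complex" where "\<eta> K = C2 True False (low2 g K)"

lemma second_order_simps:
  assumes "second_order U F K W"
  shows "csm U (K i j)" "csm U W" "\<forall>y\<in>U. \<forall>i j. K i j y = K j i y"
    "\<forall>y\<in>U. \<forall>p. F (y, p) = (\<Sum>i\<in>UNIV. \<Sum>j\<in>UNIV. K i j y * p $ i * p $ j) + W y"
  using assms by (auto simp: second_order_def smooth_fun_csm)

lemma second_order_frame:
  assumes "second_order U F K W"
  shows "csm U (low2 g K i j)" "csm U (\<kappa> K)" "csm U (\<eta> K)"
    "y \<in> U \<Longrightarrow> C2 False True (low2 g K) y = \<eta> K y" "y \<in> U \<Longrightarrow> cnj (\<eta> K y) = \<eta> K y"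
proof -
  note so = second_order_simps[OF assms]
  show c [simp]: "csm U (low2 g K i j)" for i j by (rule low2_csm[OF so(1)])
  show "csm U (\<kappa> K)" "csm U (\<eta> K)" by (simp_all add: \<kappa>_def \<eta>_def)
  assume y: "y \<in> U"
  have "low2 g K 2 1 y = low2 g K 1 2 y" by (rule low2_sym) (use so(3) y in blast)
  then show 1: "C2 False True (low2 g K) y = \<eta> K y" by (simp add: \<eta>_def C2_def sum_2 algebra_simps)
  then show "cnj (\<eta> K y) = \<eta> K y" by (simp add: \<eta>_def)
qed

lemma poisson_zero:
  "\<exists>V0\<in>\<V>. \<forall>F\<in>\<F>. \<forall>x\<in>U. \<forall>p. poisson F (hamiltonian g V0) (x, p) = 0"
  using nd unfolding nondeg_superintegrable_def second_order_integral_def by blast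

lemma killing_frame:
  assumes F: "F \<in> \<F>" and so: "second_order U F K W" and x: "x \<in> U"
  shows "C3 a b c (nabla2 g (low2 g K)) x + C3 b c a (nabla2 g (low2 g K)) x
    + C3 c a b (nabla2 g (low2 g K)) x = 0"
proof -
  obtain V0 where V0: "V0 \<in> \<V>" "\<And>p. poisson F (hamiltonian g V0) (x, p) = 0"
    using poisson_zero F x by blast
  note k = killing_equation[where F = F, OF x second_order_simps(1,2,4,3)[OF so] \<V>_csm[OF V0(1)] V0(2)]
  have "C3 a b c (nabla2 g (low2 g K)) x + C3 b c a (nabla2 g (low2 g K)) x
    + C3 c a b (nabla2 g (low2 g K)) x = (\<Sum>i\<in>UNIV. \<Sum>j\<in>UNIV. \<Sum>k\<in>UNIV. mv a i x * mv b j x * mv c k x *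
      of_real (nabla2 g (low2 g K) i j k x + nabla2 g (low2 g K) j k i x + nabla2 g (low2 g K) k i j x))"
    by (simp add: C3_def sum_2 algebra_simps)
  then show ?thesis unfolding k by simp
qed

text \<open>The Bertrand-Darboux condition determines the remaining derivatives of a Killing tensor,
  because the differential of a potential in \<open>\<V>\<close> is arbitrary at a given point.\<close>

lemma DD_K:
  assumes F: "F \<in> \<F>" and so: "second_order U F K W" and x: "x \<in> U"
  shows "DD True 2 (\<kappa> K) x = 0"
    and "DD False 2 (\<kappa> K) x = 2/3 * (s x * cnj (\<kappa> K x) - 2 * cnj (\<tau> x) * \<kappa> K x)"
    and "DD True 0 (\<eta> K) x = - 1/3 * (s x * cnj (\<kappa> K x) - 2 * cnj (\<tau> x) * \<kappa> K x)"
proof -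
  note f = second_order_frame[OF so]
  note [simp] = f(1,2,3)
  let ?A = "low2 g K" and ?N = "nabla2 g (low2 g K)"
  have N: "C3 r a b ?N x = DD r (wt a + wt b) (C2 a b ?A) x" for r a b
    by (rule C3_nabla2[OF x]) simp
  have sw: "DD r 0 (C2 False True ?A) x = DD r 0 (\<eta> K) x" for r
    by (rule DD_cong) (use x f in auto)
  have cF: "C2 False False ?A = (\<lambda>y. cnj (\<kappa> K y))" by (rule ext) (simp add: \<kappa>_def)
  have \<eta>F: "DD False 0 (\<eta> K) x = cnj (DD True 0 (\<eta> K) x)"
  proof -
    have "DD False 0 (\<eta> K) x = DD False 0 (\<lambda>y. cnj (\<eta> K y)) x"
      by (rule DD_cong) (use x f in auto)
    then show ?thesis using x by (simp add: DD_cnj)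
  qed
  have N1: "C3 True True True ?N x = DD True 2 (\<kappa> K) x" "C3 False True True ?N x = DD False 2 (\<kappa> K) x"
    "C3 True True False ?N x = DD True 0 (\<eta> K) x" "C3 True False True ?N x = DD True 0 (\<eta> K) x"
    "C3 False True False ?N x = cnj (DD True 0 (\<eta> K) x)" "C3 False False True ?N x = cnj (DD True 0 (\<eta> K) x)"
    "C3 True False False ?N x = cnj (DD False 2 (\<kappa> K) x)"
    using x by (simp_all add: N \<kappa>_def[symmetric] \<eta>_def[symmetric] sw cF \<eta>F DD_cnj)
  show "DD True 2 (\<kappa> K) x = 0"
    using killing_frame[OF F so x, of True True True] by (simp add: N1)
  have k2: "DD False 2 (\<kappa> K) x + 2 * DD True 0 (\<eta> K) x = 0"
    using killing_frame[OF F so x, of False True True] by (simp add: N1 algebra_simps)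
  \<comment> \<open>For a potential with \<open>v V x = z\<close> and \<open>L V x = 0\<close>, the
    Bertrand-Darboux condition says that \<open>e * cnj z\<close> is real. The choices 1 and
    \<open>\<i>\<close> of \<open>z\<close> force \<open>e = 0\<close>; this and the Killing
    equation \<open>k2\<close> are two linear equations for the two unknown derivatives.\<close>
  define e where "e = 2 * cnj (\<tau> x) * \<kappa> K x + DD False 2 (\<kappa> K) x - DD True 0 (\<eta> K) x - s x * cnj (\<kappa> K x)"
  have e: "e * cnj z - cnj e * z = 0" for z
  proof -
    obtain V where V: "V \<in> \<V>" "v V x = z" "L V x = 0" using V_jet[OF x] by blast
    have bd: "bd_form g K V i j x = bd_form g K V j i x" for i j
      using nd F so V(1) x unfolding nondeg_superintegrable_def bertrand_darboux_def
      by (metis eq_iff_diff_eq_0)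
    have gV: "C1 True (grad V) x = z" "C1 False (grad V) x = cnj z"
      using V(2) by (auto simp: v_def)
    have sy: "K i j x = K j i x" for i j using second_order_simps(3)[OF so] x by blast
    have "C2 True False (bd_form g K V) x = C2 False True (bd_form g K V) x"
      using bd[of 1 2] by (simp add: C2_def sum_2 algebra_simps)
    then show ?thesis
      unfolding C2_bd_form[where K = K, OF x sy] C2_hess_V[OF x V(1)] N1 f(4)[OF x]
      by (simp add: e_def \<kappa>_def[symmetric] \<eta>_def[symmetric] fun_cong[OF cF] V gV algebra_simps)
  qed
  have "e - cnj e = 0" "e * \<i> + cnj e * \<i> = 0" using e[of 1] e[of \<i>] by (simp_all add: algebra_simps)
  then have "e = 0" by (simp add: complex_eq_iff)
  then have "3/2 * DD False 2 (\<kappa> K) x = s x * cnj (\<kappa> K x) - 2 * cnj (\<tau> x) * \<kappa> K x"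
    using k2 unfolding e_def by (simp add: field_simps) algebra
  then show r: "DD False 2 (\<kappa> K) x = 2/3 * (s x * cnj (\<kappa> K x) - 2 * cnj (\<tau> x) * \<kappa> K x)"
    by (simp add: field_simps)
  show "DD True 0 (\<eta> K) x = - 1/3 * (s x * cnj (\<kappa> K x) - 2 * cnj (\<tau> x) * \<kappa> K x)"
    using k2 unfolding r by (simp add: field_simps) algebra
qed

text \<open>By \<open>DD_K\<close> and conjugation, \<open>\<kappa>\<close>, its conjugate and
  \<open>\<eta>\<close> satisfy a closed linear system, so one common zero makes the whole tensor
  vanish.\<close>

lemma K_unique:
  assumes F: "F \<in> \<F>" and so: "second_order U F K W" and x0: "x0 \<in> U"
    and z: "\<kappa> K x0 = 0" "\<eta> K x0 = 0" and x: "x \<in> U"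
  shows "K i j x = 0"
proof -
  note fr = second_order_frame[OF so]
  note [simp] = fr(1,2,3)
  define f where "f = (!) [\<kappa> K, \<lambda>x. cnj (\<kappa> K x), \<eta> K]"
  define w where "w = (!) [2, - 2, 0 :: int]"
  define \<alpha> where "\<alpha> \<rho> i j = (if \<rho> then
      [[\<lambda>_. 0, \<lambda>_. 0, \<lambda>_. 0], [\<lambda>x. 2/3 * cnj (s x), \<lambda>x. - 4/3 * \<tau> x, \<lambda>_. 0],
       [\<lambda>x. 2/3 * cnj (\<tau> x), \<lambda>x. - 1/3 * s x, \<lambda>_. 0]] ! i ! j
    else
      [[\<lambda>x. - 4/3 * cnj (\<tau> x), \<lambda>x. 2/3 * s x, \<lambda>_. 0], [\<lambda>_. 0, \<lambda>_. 0, \<lambda>_. 0],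
       [\<lambda>x. - 1/3 * cnj (s x), \<lambda>x. 2/3 * \<tau> x, \<lambda>_. 0]] ! i ! j)" for \<rho> and i j :: nat
  have \<eta>F: "DD False 0 (\<eta> K) y = cnj (DD True 0 (\<eta> K) y)" if "y \<in> U" for y
  proof -
    have "DD False 0 (\<eta> K) y = DD False 0 (\<lambda>y. cnj (\<eta> K y)) y"
      by (rule DD_cong) (use that fr in auto)
    then show ?thesis using that by (simp add: DD_cnj)
  qed
  have u: "f i x = 0" if "i < 3" for i
  proof (rule frame_system_unique[OF connected_U, of 3 f \<alpha> w x0 x i])
    show "csm U (f i)" if "i < 3" for i
      using less_3_cases[OF that] by (auto simp: f_def)
    show "csm U (\<alpha> \<rho> i j)" if "i < 3" "j < 3" for \<rho> i j
      using less_3_cases[OF that(1)] less_3_cases[OF that(2)]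
      by (cases \<rho>; elim disjE; simp add: \<alpha>_def)
    show "DD \<rho> (w i) (f i) y = (\<Sum>j<3. \<alpha> \<rho> i j y * f j y)" if "i < 3" "y \<in> U" for \<rho> i y
      using less_3_cases[OF that(1)] that(2)
      by (cases \<rho>; elim disjE;
          simp add: \<alpha>_def f_def w_def sum_lessThan_3 DD_cnj \<eta>F DD_K[OF F so that(2)] field_simps)
    show "f i x0 = 0" if "i < 3" for i
      using less_3_cases[OF that] z by (auto simp: f_def)
  qed (use x x0 that in auto)
  have "\<kappa> K x = 0" "\<eta> K x = 0" using u[of 0] u[of 2] by (simp_all add: f_def)
  then have "C2 a b (low2 g K) x = C2 a b (\<lambda>_ _ _. 0) x" for a b
    using fr(4)[OF x] cnj_C(2)[of True True "low2 g K" x]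
    by (cases a; cases b) (simp_all add: \<kappa>_def \<eta>_def, simp_all add: C2_def)
  then have "low2 g K i j x = 0" for i j using C2_eqI[OF x, of "low2 g K" "\<lambda>_ _ _. 0"] by blast
  then show ?thesis using low2_zero_imp[OF x, of K] second_order_simps(3)[OF so] x by blast
qed

lemma C2_low2_sum:
  "C2 a b (low2 g (\<lambda>k l y. \<Sum>i<(3::nat). c i * K i k l y)) x = (\<Sum>i<3. of_real (c i) * C2 a b (low2 g (K i)) x)"
  unfolding C2_def low2_def sum_lessThan_3 by (simp add: sum_2 algebra_simps)

text \<open>The three basis integrals give three real data \<open>Re \<kappa>\<close>,
  \<open>Im \<kappa>\<close>, \<open>\<eta>\<close> at \<open>x0\<close>. If a combination has zero
  data, its Killing tensor vanishes by \<open>K_unique\<close>, so its differential vanishes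
  everywhere, and functional independence makes the coefficients zero. Hence the data can be
  prescribed; \<open>\<eta>\<close> is set to 0.\<close>

lemma K_jet:
  assumes x0: "x0 \<in> U"
  shows "\<exists>F\<in>\<F>. \<exists>K W. second_order U F K W \<and> \<kappa> K x0 = \<kappa>0"
proof -
  obtain F where F: "fun_basis (U \<times> UNIV) \<F> 3 F" "functionally_independent U 3 F"
    using nd by (auto simp: nondeg_superintegrable_def)
  define Fc where "Fc c z = (\<Sum>i<3. c i * F i z)" for c :: "nat \<Rightarrow> real" and z
  have Fc: "Fc c \<in> \<F>" for c using F(1) by (auto simp: fun_basis_def Fc_def)
  have F\<F>: "F i \<in> \<F>" if "i < 3" for i
  proof -
    have "Fc (\<lambda>j. if j = i then 1 else 0) = F i"
      using that by (simp add: Fc_def fun_eq_iff if_distrib if_distribR cong: if_cong)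
    then show ?thesis using Fc by metis
  qed
  have "\<exists>K W. second_order U (F i) K W" if "i < 3" for i
    using nd F\<F>[OF that] unfolding nondeg_superintegrable_def second_order_integral_def by blast
  then obtain K W where KW: "\<And>i. i < 3 \<Longrightarrow> second_order U (F i) (K i) (W i)" by metis
  define Kc where "Kc c k l y = (\<Sum>i<3. c i * K i k l y)" for c :: "nat \<Rightarrow> real" and k l y
  define Wc where "Wc c y = (\<Sum>i<3. c i * W i y)" for c :: "nat \<Rightarrow> real" and y
  note so = second_order_simps[OF KW]
  have soc: "second_order U (Fc c) (Kc c) (Wc c)" for c
  proof -
    have "csm U (Kc c k l)" for k l unfolding Kc_def[abs_def]
      by (intro csm_sum csm_mult open_U csm_const) (use so(1) in auto)
    moreover have "csm U (Wc c)" unfolding Wc_def[abs_def]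
      by (intro csm_sum csm_mult open_U csm_const) (use so(2) in auto)
    moreover have "\<forall>y\<in>U. \<forall>k l. Kc c k l y = Kc c l k y"
      using so(3) unfolding Kc_def by (intro ballI allI sum.cong) auto
    moreover have "\<forall>y\<in>U. \<forall>p. Fc c (y, p) = (\<Sum>k\<in>UNIV. \<Sum>l\<in>UNIV. Kc c k l y * p $ k * p $ l) + Wc c y"
      using so(4) unfolding Fc_def Kc_def Wc_def sum_lessThan_3 by (simp add: sum_2 algebra_simps)
    ultimately show ?thesis by (simp add: second_order_def smooth_fun_csm)
  qed
  have \<kappa>c: "\<kappa> (Kc c) x0 = (\<Sum>i<3. of_real (c i) * \<kappa> (K i) x0)" "\<eta> (Kc c) x0 = (\<Sum>i<3. of_real (c i) * \<eta> (K i) x0)" for c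
    unfolding \<kappa>_def \<eta>_def Kc_def[abs_def] C2_low2_sum by simp_all
  define M where "M k i = (if k = 0 then Re (\<kappa> (K i) x0) else if k = 1 then Im (\<kappa> (K i) x0)
    else Re (\<eta> (K i) x0))" for k i :: nat
  have Mc: "(\<Sum>i<3. c i * M 0 i) = Re (\<kappa> (Kc c) x0)" "(\<Sum>i<3. c i * M 1 i) = Im (\<kappa> (Kc c) x0)"
    "(\<Sum>i<3. c i * M 2 i) = Re (\<eta> (Kc c) x0)" for c
    by (simp_all add: M_def \<kappa>c)
  obtain V0 where V0: "V0 \<in> \<V>" "\<And>F x p. F \<in> \<F> \<Longrightarrow> x \<in> U \<Longrightarrow> poisson F (hamiltonian g V0) (x, p) = 0"
    using poisson_zero by blast
  have "\<exists>c. \<forall>k<3. (\<Sum>i<3. c i * M k i) = [Re \<kappa>0, Im \<kappa>0, 0] ! k"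
  proof (rule square_system_solvable[where 'n = 3])
    show "c i = 0" if z: "\<And>k. k < 3 \<Longrightarrow> (\<Sum>i<3. c i * M k i) = 0" and i: "i < 3" for c i
    proof -
      have "\<kappa> (Kc c) x0 = 0" "Re (\<eta> (Kc c) x0) = 0"
        using z[of 0] z[of 1] z[of 2] by (simp_all add: Mc complex_eq_iff del: One_nat_def)
      moreover have "Im (\<eta> (Kc c) x0) = 0"
        using second_order_frame(5)[OF soc x0, of c] by (simp add: complex_eq_iff)
      ultimately have K0: "Kc c k l x = 0" if "x \<in> U" for k l x
        using K_unique[OF Fc soc x0 _ _ that] by (simp add: complex_eq_iff)
      have fd: "frechet_derivative (Fc c) (at (x, p)) h = 0" if "x \<in> U" for x p h
        using integral_without_momenta[where F = "Fc c", OF that second_order_simps(1,2,4)[OF soc] K0 \<V>_csm[OF V0(1)] V0(2)[OF Fc that]]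
        by simp
      have d: "F i differentiable (at (x, p))" if "x \<in> U" "i < 3" for i x p
        using quadratic_has_derivative[where F = "F i", OF that(1) second_order_simps(1,2,4)[OF KW[OF that(2)]]]
        by (auto simp: differentiable_def)
      have sum0: "(\<Sum>i<3. c i * frechet_derivative (F i) (at z) h) = 0" if zU: "z \<in> U \<times> UNIV" for z h
      proof -
        obtain x p where zp: "z = (x, p)" "x \<in> U" using zU by (cases z) auto
        have "(Fc c has_derivative (\<lambda>h. \<Sum>i<3. c i * frechet_derivative (F i) (at (x, p)) h)) (at (x, p))"
          unfolding Fc_def[abs_def]
          by (intro has_derivative_sum has_derivative_mult_right)
            (use d zp in \<open>auto intro: differentiable_has_derivative\<close>)
        from fun_cong[OF frechet_derivative_at[OF this], of h] fd[OF zp(2), of p h] show ?thesis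
          by (simp add: zp(1))
      qed
      \<comment> \<open>One point with independent differentials is enough, and the dense set of
        such points is nonempty because \<open>x0\<close> lies in \<open>U\<close>.\<close>
      have "{z \<in> U \<times> UNIV. \<forall>c. (\<forall>v. (\<Sum>i<3. c i * frechet_derivative (F i) (at z) v) = 0) \<longrightarrow> (\<forall>i<3. c i = 0)} \<noteq> {}"
        (is "?Z \<noteq> {}")
      proof
        assume "?Z = {}"
        then have "U \<times> (UNIV :: point set) \<subseteq> closure {}"
          using F(2) unfolding functionally_independent_def by (simp only:)
        then show False using x0 by auto
      qed
      then show ?thesis using sum0 i by blast
    qed
  qed simp
  then obtain c where c: "\<And>k. k < 3 \<Longrightarrow> (\<Sum>i<3. c i * M k i) = [Re \<kappa>0, Im \<kappa>0, 0] ! k" by blast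
  have "\<kappa> (Kc c) x0 = \<kappa>0" using c[of 0] c[of 1] by (simp add: Mc complex_eq_iff del: One_nat_def)
  then show ?thesis using Fc soc by blast
qed

end

section \<open>Integrability conditions in the frame\<close>

text \<open>A real linear map of the complex plane splits uniquely into a complex linear and an
  antilinear part. This turns conditions on arbitrary jets into equations for their
  coefficients.\<close>

lemma conj_linear_zero:
  assumes "\<And>z. a * cnj z + b * z = 0"
  shows "a = 0" "b = 0"
proof -
  have 1: "a + b = 0" using assms[of 1] by simp
  have "\<i> * (b - a) = 0" using assms[of \<i>] by (simp add: algebra_simps)
  then have "b = a" by simp
  with 1 show "a = 0" "b = 0" by simp_all
qed

context system
begin

text \<open>Both come from the commutator on \<open>\<kappa>\<close>, which has weight 2 and is
  annihilated by the derivation along \<open>m\<close>. At a point with \<open>\<kappa> = z\<close>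
  arbitrary, \<open>a\<close> and \<open>b\<close> are the coefficients of \<open>cnj z\<close> and
  \<open>z\<close>; they vanish separately.\<close>

lemma DD_s_\<tau>:
  assumes x: "x \<in> U"
  shows "DD True 3 s x = 4/3 * \<tau> x * s x"
    and "DD False 1 \<tau> x = 1/3 * (s x * cnj (s x)) + 3/4 * R x"
proof -
  define a where "a = 2/3 * DD True 3 s x - 8/9 * (s x * \<tau> x)"
  define b where "b = 4/9 * (s x * cnj (s x)) - 4/3 * cnj (DD False 1 \<tau> x) + R x"
  have ab: "a * cnj z + b * z = 0" for z
  proof -
    obtain F K W where FK: "F \<in> \<F>" "second_order U F K W" "\<kappa> K x = z" using K_jet[OF x] by blast
    note [simp] = second_order_frame(2,3)[OF FK(2)]
    note dk = DD_K[OF FK(1,2)]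
    have 0: "DD False 3 (DD True 2 (\<kappa> K)) x = 0"
      using DD_cong[of "DD True 2 (\<kappa> K)" x "\<lambda>_. 0" False 3] dk(1) x by (simp add: DD_zero)
    have ck: "DD True (- 2) (\<lambda>x. cnj (\<kappa> K x)) x = 2/3 * (cnj (s x) * z - 2 * \<tau> x * cnj z)"
    proof -
      have "DD True (- 2) (\<lambda>x. cnj (\<kappa> K x)) x = cnj (DD False 2 (\<kappa> K) x)" using x by (simp add: DD_cnj)
      then show ?thesis unfolding dk(2)[OF x] FK(3) by simp
    qed
    have "DD True 1 (DD False 2 (\<kappa> K)) x
        = DD True 1 (\<lambda>x. 2/3 * (s x * cnj (\<kappa> K x)) - 4/3 * (cnj (\<tau> x) * \<kappa> K x)) x"
      by (rule DD_cong) (use x dk(2) in \<open>auto simp: algebra_simps\<close>)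
    also have "\<dots> = 2/3 * DD True 1 (\<lambda>x. s x * cnj (\<kappa> K x)) x - 4/3 * DD True 1 (\<lambda>x. cnj (\<tau> x) * \<kappa> K x) x"
      using x by (simp add: DD_diff DD_cmult del: times_divide_eq_left times_divide_eq_right)
    also have "DD True 1 (\<lambda>x. s x * cnj (\<kappa> K x)) x
        = DD True 3 s x * cnj z + s x * (2/3 * (cnj (s x) * z - 2 * \<tau> x * cnj z))"
      using x DD_mult[of x s "\<lambda>x. cnj (\<kappa> K x)" 1 3 "- 2" True] by (simp add: ck FK(3))
    also have "DD True 1 (\<lambda>x. cnj (\<tau> x) * \<kappa> K x) x = cnj (DD False 1 \<tau> x) * z"
      using x DD_mult[of x "\<lambda>x. cnj (\<tau> x)" "\<kappa> K" 1 "- 1" 2 True] dk(1)[OF x] by (simp add: DD_cnj FK(3))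
    finally show ?thesis
      using DD_commutator[OF x, of "\<kappa> K" 2] 0
      by (simp add: a_def b_def FK(3) R_def[symmetric] field_simps) algebra
  qed
  have a: "a = 0" and b: "b = 0" using conj_linear_zero[OF ab] by blast+
  show "DD True 3 s x = 4/3 * \<tau> x * s x" using a by (simp add: a_def field_simps)
  have "4/3 * cnj (DD False 1 \<tau> x) = 4/9 * (s x * cnj (s x)) + R x" using b by (simp add: b_def algebra_simps)
  then have "cnj (DD False 1 \<tau> x) = 1/3 * (s x * cnj (s x)) + 3/4 * R x" by (simp add: field_simps)
  from arg_cong[OF this, of cnj] show "DD False 1 \<tau> x = 1/3 * (s x * cnj (s x)) + 3/4 * R x"
    by (simp add: mult.commute)
qed

text \<open>The function \<open>\<eta>\<close> is real of weight 0, so its mixed second derivative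
  \<open>X\<close> is real. With \<open>z\<close> arbitrary this relates the coefficient of
  \<open>cnj z\<close> to the conjugate of that of \<open>z\<close>, which yields the last unknown
  derivative of \<open>\<tau>\<close>.\<close>

lemma DD_\<tau>:
  assumes x: "x \<in> U"
  shows "DD True 1 \<tau> x = 4/3 * (\<tau> x * \<tau> x) - 1/2 * \<xi> x + cnj (\<tau> x) * s x"
proof -
  define a where "a = DD False 3 s x - 4/3 * (cnj (\<tau> x) * s x)"
  define b where "b = 8/3 * (cnj (\<tau> x) * cnj (\<tau> x)) - 2 * cnj (DD True 1 \<tau> x)"
  have ab: "(a - cnj b) * cnj z + (b - cnj a) * z = 0" for z
  proof -
    obtain F K W where FK: "F \<in> \<F>" "second_order U F K W" "\<kappa> K x = z" using K_jet[OF x] by blast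
    note fr = second_order_frame[OF FK(2)]
    note [simp] = fr(2,3)
    note dk = DD_K[OF FK(1,2)]
    have \<eta>F: "DD False 0 (\<eta> K) y = cnj (DD True 0 (\<eta> K) y)" if "y \<in> U" for y
    proof -
      have "DD False 0 (\<eta> K) y = DD False 0 (\<lambda>y. cnj (\<eta> K y)) y"
        by (rule DD_cong) (use that fr in auto)
      then show ?thesis using that by (simp add: DD_cnj)
    qed
    define X where "X = DD False 1 (DD True 0 (\<eta> K)) x"
    have "DD True (- 1) (DD False 0 (\<eta> K)) x = DD True (- 1) (\<lambda>y. cnj (DD True 0 (\<eta> K) y)) x"
      by (rule DD_cong) (use x \<eta>F in auto)
    then have "DD True (- 1) (DD False 0 (\<eta> K)) x = cnj X" using x by (simp add: DD_cnj X_def)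
    then have real: "cnj X = X" using DD_commutator[OF x, of "\<eta> K" 0] by (simp add: X_def)
    have ck: "DD False (- 2) (\<lambda>x. cnj (\<kappa> K x)) x = 0"
      using x dk(1)[OF x] by (simp add: DD_cnj)
    have "X = DD False 1 (\<lambda>x. 2/3 * (cnj (\<tau> x) * \<kappa> K x) - 1/3 * (s x * cnj (\<kappa> K x))) x"
      unfolding X_def by (rule DD_cong) (use x dk(3) in \<open>auto simp: algebra_simps\<close>)
    also have "\<dots> = 2/3 * DD False 1 (\<lambda>x. cnj (\<tau> x) * \<kappa> K x) x - 1/3 * DD False 1 (\<lambda>x. s x * cnj (\<kappa> K x)) x"
      using x by (simp add: DD_diff DD_cmult del: times_divide_eq_left times_divide_eq_right)
    also have "DD False 1 (\<lambda>x. s x * cnj (\<kappa> K x)) x = DD False 3 s x * cnj z"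
      using x DD_mult[of x s "\<lambda>x. cnj (\<kappa> K x)" 1 3 "- 2" False] by (simp add: ck FK(3))
    also have "DD False 1 (\<lambda>x. cnj (\<tau> x) * \<kappa> K x) x = cnj (DD True 1 \<tau> x) * z
        + cnj (\<tau> x) * (2/3 * (s x * cnj z - 2 * cnj (\<tau> x) * z))"
      using x DD_mult[of x "\<lambda>x. cnj (\<tau> x)" "\<kappa> K" 1 "- 1" 2 False] dk(2)[OF x] by (simp add: DD_cnj FK(3))
    finally have X: "X = - 1/3 * (a * cnj z + b * z)" by (simp add: a_def b_def field_simps)
    have e: "a * cnj z + b * z = - 3 * X" unfolding X by (simp add: field_simps)
    have "cnj (a * cnj z + b * z) = a * cnj z + b * z" unfolding e by (simp add: real)
    then show ?thesis by (simp add: algebra_simps)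
  qed
  have "a = cnj b" using conj_linear_zero(1)[OF ab] by simp
  then have "DD False 3 s x - 4/3 * (cnj (\<tau> x) * s x) = 8/3 * (\<tau> x * \<tau> x) - 2 * DD True 1 \<tau> x"
    by (simp add: a_def b_def)
  then show ?thesis by (simp add: \<xi>_def field_simps) algebra
qed

lemma DD_False_s: "DD False 3 s x = \<xi> x - 2/3 * (cnj (\<tau> x) * s x)"
  by (simp add: \<xi>_def)

lemma DD_True_\<xi>:
  assumes x: "x \<in> U"
  shows "DD True 2 \<xi> x = 2/3 * (s x * cnj (s x)) * s x + 4/3 * (\<tau> x * \<xi> x)"
proof -
  have "DD True 2 (DD False 3 s) x = DD True 2 (\<lambda>x. \<xi> x - 2/3 * (cnj (\<tau> x) * s x)) x"
    by (rule DD_cong) (use x DD_False_s in auto)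
  also have "\<dots> = DD True 2 \<xi> x - 2/3 * DD True 2 (\<lambda>x. cnj (\<tau> x) * s x) x"
    using x by (simp add: DD_diff DD_cmult del: times_divide_eq_left times_divide_eq_right)
  also have "DD True 2 (\<lambda>x. cnj (\<tau> x) * s x) x
      = cnj (DD False 1 \<tau> x) * s x + cnj (\<tau> x) * DD True 3 s x"
    using x DD_mult[of x "\<lambda>x. cnj (\<tau> x)" s 2 "- 1" 3 True] by (simp add: DD_cnj)
  finally have 1: "DD True 2 (DD False 3 s) x
    = DD True 2 \<xi> x - 2/3 * (cnj (DD False 1 \<tau> x) * s x + cnj (\<tau> x) * DD True 3 s x)" .
  have "DD False 4 (DD True 3 s) x = DD False 4 (\<lambda>x. 4/3 * (\<tau> x * s x)) x"
    by (rule DD_cong) (use x DD_s_\<tau> in auto)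
  also have "\<dots> = 4/3 * (DD False 1 \<tau> x * s x + \<tau> x * DD False 3 s x)"
    using x DD_mult[of x \<tau> s 4 1 3 False] by (simp add: DD_cmult del: times_divide_eq_left times_divide_eq_right)
  finally show ?thesis
    using DD_commutator[OF x s_csm, of 3] 1
    unfolding DD_s_\<tau>[OF x] DD_False_s R_def[symmetric] by (simp add: field_simps) algebra
qed

lemma scalar_curv_csm [simp]: "csm U (scalar_curv g)"
  unfolding scalar_curv_def[abs_def] riemann_def pd_eq_gpd by simp

lemma R_grad:
  assumes x: "x \<in> U"
  shows "DD True 0 R x = C1 True (grad (scalar_curv g)) x" "DD False 0 R x = cnj (DD True 0 R x)"
proof -
  have "R = (\<lambda>x. of_real (scalar_curv g x))" by (rule ext) (simp add: R_def)
  then show 1: "DD True 0 R x = C1 True (grad (scalar_curv g)) x"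
    using C1_grad[OF x scalar_curv_csm, of True] by simp
  have "DD False 0 R x = DD False 0 (\<lambda>x. cnj (R x)) x" by simp
  then show "DD False 0 R x = cnj (DD True 0 R x)"
    using DD_cnj[OF x R_csm, of False 0] by (simp del: cnj_R)
qed

lemma DD_s_cnj_s:
  assumes x: "x \<in> U"
  shows "DD True 0 (\<lambda>x. s x * cnj (s x)) x
    = 4/3 * \<tau> x * s x * cnj (s x) + s x * (cnj (\<xi> x) - 2/3 * (\<tau> x * cnj (s x)))"
  using x DD_mult[of x s "\<lambda>x. cnj (s x)" 0 3 "- 3" True]
  by (simp add: DD_cnj DD_s_\<tau>[OF x] DD_False_s)

text \<open>Integrability of the gradient \<open>t\<^sub>i\<close>.\<close>

lemma DD_False_\<xi>_curvature:
  assumes x: "x \<in> U"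
  shows "DD False 2 \<xi> x = 10/3 * (\<tau> x * (s x * cnj (s x))) + 3 * (R x * \<tau> x)
    + 4/3 * (cnj (\<tau> x) * cnj (\<tau> x) * s x) - 5/3 * (cnj (\<xi> x) * s x) + 2 * (cnj (\<tau> x) * \<xi> x)
    - 3/2 * DD True 0 R x"
proof -
  have "DD True 0 (DD False 1 \<tau>) x = DD True 0 (\<lambda>x. 1/3 * (s x * cnj (s x)) + 3/4 * R x) x"
    by (rule DD_cong) (use x DD_s_\<tau> in auto)
  also have "\<dots> = 1/3 * DD True 0 (\<lambda>x. s x * cnj (s x)) x + 3/4 * DD True 0 R x"
    using x by (simp add: DD_add DD_cmult del: times_divide_eq_left times_divide_eq_right)
  finally have 1: "DD True 0 (DD False 1 \<tau>) x = 1/3 * DD True 0 (\<lambda>x. s x * cnj (s x)) x + 3/4 * DD True 0 R x" .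
  have "DD False 2 (DD True 1 \<tau>) x
      = DD False 2 (\<lambda>x. 4/3 * (\<tau> x * \<tau> x) - 1/2 * \<xi> x + cnj (\<tau> x) * s x) x"
    by (rule DD_cong) (use x DD_\<tau> in auto)
  also have "\<dots> = 4/3 * DD False 2 (\<lambda>x. \<tau> x * \<tau> x) x - 1/2 * DD False 2 \<xi> x
      + DD False 2 (\<lambda>x. cnj (\<tau> x) * s x) x"
    using x by (simp add: DD_add DD_diff DD_cmult del: times_divide_eq_left times_divide_eq_right)
  also have "DD False 2 (\<lambda>x. \<tau> x * \<tau> x) x = 2 * (\<tau> x * DD False 1 \<tau> x)"
    using x DD_mult[of x \<tau> \<tau> 2 1 1 False] by simp
  also have "DD False 2 (\<lambda>x. cnj (\<tau> x) * s x) x = cnj (DD True 1 \<tau> x) * s x + cnj (\<tau> x) * DD False 3 s x"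
    using x DD_mult[of x "\<lambda>x. cnj (\<tau> x)" s 2 "- 1" 3 False] by (simp add: DD_cnj)
  finally have 2: "DD False 2 (DD True 1 \<tau>) x = 4/3 * (2 * (\<tau> x * DD False 1 \<tau> x)) - 1/2 * DD False 2 \<xi> x
    + (cnj (DD True 1 \<tau> x) * s x + cnj (\<tau> x) * DD False 3 s x)" .
  have "DD True 0 (DD False 1 \<tau>) x - DD False 2 (DD True 1 \<tau>) x = - 1/2 * R x * \<tau> x"
    using DD_commutator[OF x \<tau>_csm, of 1] by (simp add: R_def)
  then show ?thesis
    unfolding 1 2 DD_s_cnj_s[OF x] DD_s_\<tau>[OF x] DD_\<tau>[OF x] DD_False_s by (simp add: field_simps) algebra
qed

text \<open>Integrability of the closed system satisfied by the potentials.\<close>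

lemma DD_False_\<xi>_potential:
  assumes x: "x \<in> U"
  shows "DD False 2 \<xi> x + 8/9 * (cnj (\<tau> x) * cnj (\<tau> x) * s x) - 2/3 * (cnj (\<xi> x) * s x)
      + 4/3 * (\<tau> x * (s x * cnj (s x))) + 4/3 * (cnj (\<tau> x) * \<xi> x)
      + 10/3 * (\<tau> x * (s x * cnj (s x))) + 2 * (R x * \<tau> x)
    = cnj (\<xi> x) * s x + 4/3 * (\<tau> x * (s x * cnj (s x)))
      + 10/9 * (\<tau> x * (s x * cnj (s x))) + 5/3 * (s x * cnj (\<xi> x)) + DD True 0 R x"
proof -
  \<comment> \<open>The coefficients in \<open>DD_L\<close> once the known derivatives of
    \<open>s\<close> and \<open>\<tau>\<close> are inserted. Note that \<open>B\<close> is
    real.\<close>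
  define A where "A x = \<xi> x + 4/3 * (cnj (\<tau> x) * s x)" for x
  define B where "B x = 5/3 * (s x * cnj (s x)) + R x" for x
  have Ac [simp]: "csm U A" and Bc [simp]: "csm U B" unfolding A_def[abs_def] B_def[abs_def] by simp_all
  have cB: "cnj (B y) = B y" for y by (simp add: B_def mult.commute)
  define a where "a = DD False 2 A x + 2 * cnj (\<tau> x) * A x + 2 * \<tau> x * B x"
  define b where "b = A x * cnj (s x) + DD False 0 B x + 2 * \<tau> x * cnj (A x)"
  have ab: "(a - cnj b) * cnj z + (b - cnj a) * z = 0" for z
  proof -
    obtain V where V: "V \<in> \<V>" "v V x = z" "L V x = 0" using V_jet[OF x] by blast
    note [simp] = \<V>_csm[OF V(1)]
    note dv = DD_V[OF x V(1)]
    have DL: "DD True 0 (L V) y = A y * cnj (v V y) + B y * v V y + 2 * (\<tau> y * L V y)" if "y \<in> U" for y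
      unfolding DD_L[OF that V(1)] DD_s_\<tau>[OF that] DD_False_s A_def B_def by (simp add: field_simps)
    have LF: "DD False 0 (L V) y = cnj (DD True 0 (L V) y)" if "y \<in> U" for y
    proof -
      have "DD False 0 (L V) y = DD False 0 (\<lambda>y. cnj (L V y)) y" by simp
      then show ?thesis using DD_cnj[OF that L_csm[OF \<V>_csm[OF V(1)]], of False 0] by (simp del: cnj_L)
    qed
    \<comment> \<open>As for \<open>\<eta>\<close> above: \<open>L\<close> is real of weight 0, so
      the vanishing commutator means that this mixed derivative is real.\<close>
    define X where "X = DD False 1 (DD True 0 (L V)) x"
    have "DD True (- 1) (DD False 0 (L V)) x = DD True (- 1) (\<lambda>y. cnj (DD True 0 (L V) y)) x"
      by (rule DD_cong) (use x LF in auto)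
    then have "DD True (- 1) (DD False 0 (L V)) x = cnj X" using x by (simp add: DD_cnj X_def)
    then have real: "cnj X = X" using DD_commutator[OF x, of "L V" 0] by (simp add: X_def)
    have "X = DD False 1 (\<lambda>y. A y * cnj (v V y) + B y * v V y + 2 * (\<tau> y * L V y)) x"
      unfolding X_def by (rule DD_cong) (use x DL in auto)
    also have "\<dots> = DD False 1 (\<lambda>y. A y * cnj (v V y)) x + DD False 1 (\<lambda>y. B y * v V y) x
        + 2 * DD False 1 (\<lambda>y. \<tau> y * L V y) x"
      using x by (simp add: DD_add DD_cmult)
    also have "DD False 1 (\<lambda>y. A y * cnj (v V y)) x
        = DD False 2 A x * cnj z + A x * (cnj (s x) * z + 2 * cnj (\<tau> x) * cnj z)"
      using x DD_mult[of x A "\<lambda>y. cnj (v V y)" 1 2 "- 1" False] by (simp add: dv V)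
    also have "DD False 1 (\<lambda>y. B y * v V y) x = DD False 0 B x * z"
      using x DD_mult[of x B "v V" 1 0 1 False] by (simp add: dv V)
    also have "DD False 1 (\<lambda>y. \<tau> y * L V y) x = \<tau> x * (cnj (A x) * z + B x * cnj z)"
      using x DD_mult[of x \<tau> "L V" 1 1 0 False] by (simp add: LF[OF x] DL[OF x] V cB)
    finally have X: "X = a * cnj z + b * z" by (simp add: a_def b_def algebra_simps)
    have "cnj X = cnj a * z + cnj b * cnj z" unfolding X by simp
    with real X have "a * cnj z + b * z = cnj a * z + cnj b * cnj z" by simp
    then show ?thesis by (simp add: algebra_simps)
  qed
  have eq: "a = cnj b" using conj_linear_zero(1)[OF ab] by simp
  have DA: "DD False 2 A x = DD False 2 \<xi> x + 4/3 * (cnj (DD True 1 \<tau> x) * s x + cnj (\<tau> x) * DD False 3 s x)"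
    unfolding A_def[abs_def]
    using x DD_mult[of x "\<lambda>x. cnj (\<tau> x)" s 2 "- 1" 3 False] by (simp add: DD_cnj DD_add DD_cmult del: times_divide_eq_left times_divide_eq_right)
  have DB: "cnj (DD False 0 B x) = 5/3 * DD True 0 (\<lambda>x. s x * cnj (s x)) x + DD True 0 R x"
  proof -
    have "DD True 0 B x = DD True 0 (\<lambda>y. cnj (B y)) x" by (simp add: cB)
    also have "\<dots> = cnj (DD False 0 B x)" using DD_cnj[OF x Bc, of True 0] by simp
    finally have "cnj (DD False 0 B x) = DD True 0 B x" by simp
    also have "\<dots> = 5/3 * DD True 0 (\<lambda>x. s x * cnj (s x)) x + DD True 0 R x"
      unfolding B_def[abs_def]
      using x by (simp add: DD_add DD_cmult del: times_divide_eq_left times_divide_eq_right)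
    finally show ?thesis .
  qed
  have "cnj b = cnj (A x) * s x + (5/3 * DD True 0 (\<lambda>x. s x * cnj (s x)) x + DD True 0 R x) + 2 * cnj (\<tau> x) * A x"
    by (simp add: b_def DB)
  then have "DD False 2 A x + 2 * \<tau> x * B x
    = cnj (A x) * s x + (5/3 * DD True 0 (\<lambda>x. s x * cnj (s x)) x + DD True 0 R x)"
    using eq by (simp add: a_def)
  then show ?thesis
    unfolding DA DD_s_cnj_s[OF x] DD_\<tau>[OF x] DD_False_s A_def B_def by (simp add: field_simps) algebra
qed

lemma algebraic_condition:
  assumes x: "x \<in> U"
  shows "2/3 * (\<xi> x * cnj (\<tau> x)) + 4/9 * (s x * cnj (\<tau> x) * cnj (\<tau> x)) + 10/9 * (s x * cnj (s x)) * \<tau> x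
    - s x * cnj (\<xi> x) = 1/2 * DD True 0 R x - R x * \<tau> x"
proof -
  \<comment> \<open>With the curvature equation inserted, the potential equation becomes five times
    the claim. The number 135 is this 5 times 27, a multiple of the denominators 3 and 9.\<close>
  have "135 * (2/3 * (\<xi> x * cnj (\<tau> x)) + 4/9 * (s x * cnj (\<tau> x) * cnj (\<tau> x)) + 10/9 * (s x * cnj (s x)) * \<tau> x
    - s x * cnj (\<xi> x)) = 135 * (1/2 * DD True 0 R x - R x * \<tau> x)"
    using DD_False_\<xi>_potential[OF x] unfolding DD_False_\<xi>_curvature[OF x] by (simp add: field_simps)
  from mult_left_cancel[THEN iffD1, OF _ this] show ?thesis by simp
qed

text \<open>Solving the algebraic condition for the derivative of \<open>R\<close> and inserting it
  in the curvature equation removes everything except one term.\<close>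

lemma DD_False_\<xi>:
  assumes x: "x \<in> U"
  shows "DD False 2 \<xi> x = 4/3 * (cnj (\<xi> x) * s x)"
proof -
  have r: "DD True 0 R x = 2 * (2/3 * (\<xi> x * cnj (\<tau> x)) + 4/9 * (s x * cnj (\<tau> x) * cnj (\<tau> x))
      + 10/9 * (s x * cnj (s x)) * \<tau> x - s x * cnj (\<xi> x)) + 2 * (R x * \<tau> x)"
    unfolding algebraic_condition[OF x] by simp
  show ?thesis
    unfolding DD_False_\<xi>_curvature[OF x] r by (simp add: field_simps)
qed

end

section \<open>Back to tensors\<close>

context null_frame
begin

text \<open>Raising an index exchanges the two kinds of components: the coefficient of
  \<open>m\<close> in the raised vector is the contraction with \<open>cnj m\<close>.\<close>

lemma up1_mv:
  assumes "x \<in> U"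
  shows "of_real (up1 g w a x) = mv True a x * C1 False w x + mv False a x * C1 True w x"
  unfolding up1_def of_real_sum of_real_mult gu_mv[OF assms]
  by (simp add: C1_def mv_def sum_2 algebra_simps)

lemma up2_mv:
  assumes "x \<in> U"
  shows "of_real (up2 g A a b x) =
    mv True a x * mv True b x * C2 False False A x + mv True a x * mv False b x * C2 False True A x
    + mv False a x * mv True b x * C2 True False A x + mv False a x * mv False b x * C2 True True A x"
  unfolding up2_def of_real_sum of_real_mult gu_mv[OF assms]
  by (simp add: C2_def mv_def sum_2 algebra_simps)

lemma up3_mv:
  assumes x: "x \<in> U"
  shows "complex_of_real (up3 g A a b c x) =
    mv True a x * mv True b x * mv True c x * C3 False False False A x
    + mv True a x * mv True b x * mv False c x * C3 False False True A x
    + mv True a x * mv False b x * mv True c x * C3 False True False A x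
    + mv True a x * mv False b x * mv False c x * C3 False True True A x
    + mv False a x * mv True b x * mv True c x * C3 True False False A x
    + mv False a x * mv True b x * mv False c x * C3 True False True A x
    + mv False a x * mv False b x * mv True c x * C3 True True False A x
    + mv False a x * mv False b x * mv False c x * C3 True True True A x"
proof -
  have u: "(\<Sum>f\<in>UNIV. of_real (gu g c f x) * w f)
      = mv True c x * (\<Sum>f\<in>UNIV. mv False f x * w f) + mv False c x * (\<Sum>f\<in>UNIV. mv True f x * w f)"
    for c and w :: "2 \<Rightarrow> complex"
    unfolding gu_mv[OF x] by (simp add: mv_def sum_2 algebra_simps)
  have "complex_of_real (up3 g A a b c x) = (\<Sum>d\<in>UNIV. of_real (gu g a d x) * (\<Sum>e\<in>UNIV. of_real (gu g b e x) *
      (\<Sum>f\<in>UNIV. of_real (gu g c f x) * of_real (A d e f x))))"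
    by (simp add: up3_def sum_2 algebra_simps)
  then show ?thesis
    unfolding u by (simp add: C3_def sum_2 algebra_simps)
qed

lemma trace2_mv:
  assumes "x \<in> U"
  shows "of_real (trace2 g x X) = (\<Sum>a\<in>UNIV. \<Sum>b\<in>UNIV. (mv True a x * mv False b x + mv False a x * mv True b x) * of_real (X a b))"
  unfolding trace2_def of_real_sum of_real_mult gu_mv[OF assms] by (simp add: mv_def)

end

context system
begin

section \<open>Frame components of the tensors in the prolongation\<close>

lemma C4_S:
  assumes x: "x \<in> U"
  shows "C4 r a b c (nabla3 g S) x = (if a = b \<and> b = c then
    if a then DD r 3 s x else cnj (DD (\<not> r) 3 s x) else 0)"
proof (cases "a = b \<and> b = c")
  case True
  have F: "C3 False False False S = (\<lambda>y. cnj (s y))" by (rule ext) (simp add: s_def)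
  have "C4 r a a a (nabla3 g S) x = (if a then DD r 3 s x else cnj (DD (\<not> r) 3 s x))"
    unfolding C4_nabla3[OF x S_csm] using x F by (cases a) (simp_all add: s_def[symmetric] DD_cnj)
  then show ?thesis using True by simp
next
  case False
  have "C4 r a b c (nabla3 g S) x = DD r (wt a + wt b + wt c) (\<lambda>_. 0) x"
    unfolding C4_nabla3[OF x S_csm] by (rule DD_cong) (use x False C3_S in auto)
  then show ?thesis unfolding if_not_P[OF False] by (simp add: DD_zero)
qed

lemma Xi_csm [simp]: "csm U (Xi g S t i j)"
  unfolding Xi_def[abs_def] nabla3_def up1_def pd_eq_gpd by simp

text \<open>This identifies the scalar \<open>\<xi>\<close> with the tensor \<open>Xi\<close>, which
  is trace-free because \<open>S\<close> and its covariant derivative are.\<close>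

lemma C2_Xi:
  assumes x: "x \<in> U"
  shows "C2 a b (Xi g S t) x = (if a = b then if a then \<xi> x else cnj (\<xi> x) else 0)"
proof -
  have "of_real (Xi g S t i j x) = (\<Sum>a\<in>UNIV. \<Sum>b\<in>UNIV. (mv True a x * mv False b x + mv False a x * mv True b x)
        * of_real (nabla3 g S b i j a x))
      + 2/3 * (\<Sum>a\<in>UNIV. (mv True a x * cnj (\<tau> x) + mv False a x * \<tau> x) * of_real (S i j a x))" for i j
    unfolding Xi_def of_real_sum of_real_mult of_real_add gu_mv[OF x] up1_mv[OF x] C1_t by (simp add: mv_def)
  then have "C2 a b (Xi g S t) x = C4 False a b True (nabla3 g S) x + C4 True a b False (nabla3 g S) x
      + 2/3 * (cnj (\<tau> x) * C3 a b True S x + \<tau> x * C3 a b False S x)"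
    by (simp add: C2_def C3_def C4_def sum_2 algebra_simps)
  then show ?thesis
    unfolding C4_S[OF x] C3_S[OF x] by (cases a; cases b) (simp_all add: \<xi>_def)
qed

lemma normsq3_S:
  assumes x: "x \<in> U"
  shows "of_real (normsq3 g S x) = 2 * (s x * cnj (s x))"
proof -
  have "of_real (normsq3 g S x) = (\<Sum>a\<in>UNIV. \<Sum>b\<in>UNIV. \<Sum>c\<in>UNIV.
      (mv True a x * mv True b x * mv True c x * cnj (s x)
      + mv False a x * mv False b x * mv False c x * s x) * of_real (S a b c x))"
    unfolding normsq3_def of_real_sum of_real_mult up3_mv[OF x] C3_S[OF x] by simp
  also have "\<dots> = cnj (s x) * C3 True True True S x + s x * C3 False False False S x"
    by (simp add: C3_def sum_2 algebra_simps)
  finally show ?thesis by (simp add: C3_S[OF x])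
qed

lemma C2_hess_t:
  assumes x: "x \<in> U"
  shows "C2 True True (hess g t) x = DD True 1 \<tau> x" "C2 False True (hess g t) x = DD False 1 \<tau> x"
    "C2 True False (hess g t) x = DD False 1 \<tau> x" "C2 False False (hess g t) x = cnj (DD True 1 \<tau> x)"
proof -
  show 1: "C2 True True (hess g t) x = DD True 1 \<tau> x" and 2: "C2 False True (hess g t) x = DD False 1 \<tau> x"
    using C2_hess[OF x t_csm] by (simp_all add: \<tau>_def)
  show "C2 True False (hess g t) x = DD False 1 \<tau> x"
    using C2_hess_sym[OF x t_csm, of True False] 2 by simp
  show "C2 False False (hess g t) x = cnj (DD True 1 \<tau> x)" by (simp flip: 1)
qed

section \<open>The equations of the prolongation, checked on frame components\<close>

lemma laplacian_t:
  assumes x: "x \<in> U"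
  shows "laplacian g t x = (3/2) * scalar_curv g x + (1/3) * normsq3 g S x"
proof -
  have "complex_of_real (laplacian g t x) = of_real ((3/2) * scalar_curv g x + (1/3) * normsq3 g S x)"
    unfolding laplacian_frame[OF x t_csm] C2_hess_t[OF x] DD_s_\<tau>[OF x] of_real_add of_real_mult normsq3_S[OF x]
    by (simp add: R_def)
  then show ?thesis by (simp only: of_real_eq_iff)
qed

lemma tracefree_hess_t:
  assumes x: "x \<in> U"
  shows "tracefree_hess g t i j x =
          (\<Sum>a\<in>UNIV. S i j a x * up1 g (grad t) a x)
          + (4/3) * (grad t i x * grad t j x
              - (1/2) * gl g i j x * (\<Sum>a\<in>UNIV. up1 g (grad t) a x * grad t a x))
          - (1/2) * Xi g S t i j x" (is "_ = ?B i j x")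
proof -
  define n where "n = (\<Sum>a\<in>UNIV. up1 g (grad t) a x * grad t a x)"
  have n: "of_real n = 2 * (\<tau> x * cnj (\<tau> x))"
    unfolding n_def of_real_sum of_real_mult up1_mv[OF x] C1_t
  proof -
    have "(\<Sum>a\<in>UNIV. (mv True a x * cnj (\<tau> x) + mv False a x * \<tau> x) * complex_of_real (grad t a x))
        = cnj (\<tau> x) * C1 True (grad t) x + \<tau> x * C1 False (grad t) x"
      by (simp add: C1_def sum_2 algebra_simps)
    then show "(\<Sum>a\<in>UNIV. (mv True a x * cnj (\<tau> x) + mv False a x * \<tau> x) * complex_of_real (grad t a x)) = 2 * (\<tau> x * cnj (\<tau> x))"
      by (simp add: C1_t)
  qed
  show ?thesis
  proof (rule C2_eqI[OF x, of "tracefree_hess g t" ?B])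
    fix a b
    have "C2 a b (tracefree_hess g t) x = C2 a b (hess g t) x - 1/2 * C2 a b (gl g) x * of_real (laplacian g t x)"
      by (simp add: C2_def tracefree_hess_def sum_2 algebra_simps)
    also have "\<dots> = C2 a b (hess g t) x - C2 a b (gl g) x * DD False 1 \<tau> x"
      unfolding laplacian_frame[OF x t_csm] C2_hess_t[OF x] by simp
    also have "\<dots> = C3 a b True S x * cnj (\<tau> x) + C3 a b False S x * \<tau> x
        + 4/3 * (C1 a (grad t) x * C1 b (grad t) x - C2 a b (gl g) x * (\<tau> x * cnj (\<tau> x)))
        - 1/2 * C2 a b (Xi g S t) x"
      unfolding C2_gl[OF x] C3_S[OF x] C2_Xi[OF x]
      by (cases a; cases b) (simp_all add: C2_hess_t[OF x] C1_t DD_\<tau>[OF x] algebra_simps)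
    also have "\<dots> = C2 a b ?B x"
    proof -
      have "complex_of_real (?B i j x) = (\<Sum>a\<in>UNIV. of_real (S i j a x) * (mv True a x * cnj (\<tau> x) + mv False a x * \<tau> x))
          + 4/3 * (of_real (grad t i x) * of_real (grad t j x) - 1/2 * of_real (gl g i j x) * (2 * (\<tau> x * cnj (\<tau> x))))
          - 1/2 * of_real (Xi g S t i j x)" for i j
        unfolding n_def[symmetric] by (simp add: n up1_mv[OF x] C1_t)
      note e = this
      show ?thesis
        unfolding C2_def C3_def C1_def e by (simp add: sum_2 algebra_simps add_divide_distrib)
    qed
    finally show "C2 a b (tracefree_hess g t) x = C2 a b ?B x" .
  qed
qed

text \<open>On \<open>S(m, m, m)\<close>, the derivative along \<open>m\<close> is
  \<open>DD_s_\<tau>\<close> and the derivative along \<open>cnj m\<close> is the definition of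
  \<open>\<xi>\<close>. The other components are conjugates of these or vanish on both
  sides.\<close>

lemma nabla3_S:
  assumes x: "x \<in> U"
  shows "nabla3 g S l i j k x =
          (1/6) * sym3o g x (\<lambda>i j k. - (2/3) * S i j k x * grad t l x
              + 2 * grad t i x * S j k l x + Xi g S t i j x * gl g k l x) i j k"
proof -
  \<comment> \<open>The constant stays an atom while the frame components of the right-hand side are
    computed.\<close>
  define h :: real where "h = 2/3"
  \<comment> \<open>The symmetrisers act on the components at one point, whereas \<open>C4\<close>
    and \<open>C2\<close> take tensor fields. The right-hand side is therefore rebuilt from fields
    with the derivative index first.\<close>
  define X :: "2 \<Rightarrow> tensor3" where "X l i j k y = - h * S i j k y * grad t l y
              + 2 * grad t i y * S j k l y + Xi g S t i j y * gl g k l y" for l i j k y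
  define Y :: "2 \<Rightarrow> tensor3" where "Y l i j k y = sym3 (\<lambda>i j k. X l i j k y) i j k" for l i j k y
  define W :: tensor2 where "W l k y = trace2 g y (\<lambda>a b. Y l a b k y)" for l k y
  define B :: "2 \<Rightarrow> tensor3" where "B l i j k y = (1/6) * (Y l i j k y
    - (1/4) * (gl g i j y * W l k y + gl g i k y * W l j y + gl g j k y * W l i y))" for l i j k y
  have B: "B l i j k x = (1/6) * sym3o g x (\<lambda>i j k. - (2/3) * S i j k x * grad t l x
              + 2 * grad t i x * S j k l x + Xi g S t i j x * gl g k l x) i j k" for l i j k
    by (simp add: B_def W_def Y_def X_def h_def sym3o_def tracefree3_def)
  have CX: "C4 r a b c X x = - of_real h * C3 a b c S x * C1 r (grad t) x + 2 * C1 a (grad t) x * C3 b c r S x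
      + C2 a b (Xi g S t) x * C2 c r (gl g) x" for r a b c
    by (simp add: C4_def C3_def C2_def C1_def X_def sum_2 algebra_simps)
  have CY: "C4 r a b c Y x = C4 r a b c X x + C4 r a c b X x + C4 r b a c X x + C4 r c a b X x
      + C4 r b c a X x + C4 r c b a X x" for r a b c
    by (simp add: C4_def Y_def sym3_def sum_2 algebra_simps)
  have CW: "C2 r c W x = C4 r True False c Y x + C4 r False True c Y x" for r c
    unfolding C2_def W_def trace2_mv[OF x] by (simp add: C4_def sum_2 algebra_simps)
  have CB: "C4 r a b c B x = 1/6 * (C4 r a b c Y x - 1/4 * (C2 a b (gl g) x * C2 r c W x
      + C2 a c (gl g) x * C2 r b W x + C2 b c (gl g) x * C2 r a W x))" for r a b c
    by (simp add: C4_def C2_def B_def sum_2 algebra_simps)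
  have "C4 r a b c (nabla3 g S) x = C4 r a b c B x" for r a b c
    unfolding CB CW CY CX C4_S[OF x] C3_S[OF x] C2_Xi[OF x] C2_gl[OF x]
    by (cases r; cases a; cases b; cases c) (simp_all add: C1_t DD_s_\<tau>[OF x] DD_False_s h_def field_simps)
  then have "nabla3 g S l i j k x = B l i j k x" by (rule C4_eqI[OF x])
  then show ?thesis unfolding B .
qed

lemma S_up2_Xi:
  assumes x: "x \<in> U"
  shows "C1 a (\<lambda>i x. \<Sum>a\<in>UNIV. \<Sum>b\<in>UNIV. S i a b x * up2 g (Xi g S t) a b x) x
    = (if a then s x * cnj (\<xi> x) else cnj (s x) * \<xi> x)"
proof -
  have "C1 a (\<lambda>i x. \<Sum>a\<in>UNIV. \<Sum>b\<in>UNIV. S i a b x * up2 g (Xi g S t) a b x) x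
    = C3 a True True S x * cnj (\<xi> x) + C3 a False False S x * \<xi> x"
    unfolding C1_def of_real_sum of_real_mult up2_mv[OF x] C2_Xi[OF x]
    by (simp add: C3_def sum_2 algebra_simps)
  then show ?thesis by (simp add: C3_S[OF x])
qed

lemma Xi_up1_t:
  assumes x: "x \<in> U"
  shows "C1 a (\<lambda>i x. \<Sum>a\<in>UNIV. Xi g S t i a x * up1 g (grad t) a x) x
    = (if a then \<xi> x * cnj (\<tau> x) else cnj (\<xi> x) * \<tau> x)"
proof -
  have "C1 a (\<lambda>i x. \<Sum>a\<in>UNIV. Xi g S t i a x * up1 g (grad t) a x) x
    = C2 a True (Xi g S t) x * cnj (\<tau> x) + C2 a False (Xi g S t) x * \<tau> x"
    unfolding C1_def[of a] of_real_sum of_real_mult up1_mv[OF x] C1_t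
    by (simp add: C2_def sum_2 algebra_simps)
  then show ?thesis by (simp add: C2_Xi[OF x])
qed

text \<open>On \<open>\<Xi>(m, m)\<close> the two directions of differentiation are
  \<open>DD_True_\<xi>\<close> and \<open>DD_False_\<xi>\<close>; conjugation gives
  \<open>\<Xi>(cnj m, cnj m)\<close>. For mixed \<open>i\<close>, \<open>j\<close> both sides
  vanish.\<close>

lemma nabla2_Xi:
  assumes x: "x \<in> U"
  shows "nabla2 g (Xi g S t) k i j x =
          (1/3) * S i j k x * normsq3 g S x
          + (2/9) * sym3 (\<lambda>i j k. Xi g S t j k x * grad t i x
              - (1/2) * gl g i j x * (\<Sum>a\<in>UNIV. Xi g S t k a x * up1 g (grad t) a x)) i j k
          + (2/3) * sym2o g x (\<lambda>i j. gl g j k x *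
              (\<Sum>a\<in>UNIV. \<Sum>b\<in>UNIV. S i a b x * up2 g (Xi g S t) a b x)) i j"
proof -
  define q :: tensor1 where "q = (\<lambda>i x. \<Sum>a\<in>UNIV. \<Sum>b\<in>UNIV. S i a b x * up2 g (Xi g S t) a b x)"
  define z :: tensor1 where "z = (\<lambda>i x. \<Sum>a\<in>UNIV. Xi g S t i a x * up1 g (grad t) a x)"
  define Z :: tensor3 where "Z i j k y = Xi g S t j k y * grad t i y - (1/2) * gl g i j y * z k y" for i j k y
  define w :: tensor1 where "w k y = trace2 g y (\<lambda>a b. gl g b k y * q a y)" for k y
  define B :: tensor3 where "B k i j y = (1/3) * S i j k y * normsq3 g S y
     + (2/9) * sym3 (\<lambda>i j k. Z i j k y) i j k
     + (2/3) * (gl g j k y * q i y + gl g i k y * q j y - gl g i j y * w k y)" for k i j y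
  have B: "B k i j x = (1/3) * S i j k x * normsq3 g S x
          + (2/9) * sym3 (\<lambda>i j k. Xi g S t j k x * grad t i x
              - (1/2) * gl g i j x * (\<Sum>a\<in>UNIV. Xi g S t k a x * up1 g (grad t) a x)) i j k
          + (2/3) * sym2o g x (\<lambda>i j. gl g j k x *
              (\<Sum>a\<in>UNIV. \<Sum>b\<in>UNIV. S i a b x * up2 g (Xi g S t) a b x)) i j" for k i j
    unfolding B_def w_def Z_def sym2o_def q_def z_def ..
  have q: "C1 a q x = (if a then s x * cnj (\<xi> x) else cnj (s x) * \<xi> x)" for a
    unfolding q_def by (rule S_up2_Xi[OF x])
  have z: "C1 a z x = (if a then \<xi> x * cnj (\<tau> x) else cnj (\<xi> x) * \<tau> x)" for a
    unfolding z_def by (rule Xi_up1_t[OF x])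
  have CZ: "C3 a b c Z x = C2 b c (Xi g S t) x * C1 a (grad t) x - 1/2 * C2 a b (gl g) x * C1 c z x" for a b c
    by (simp add: C3_def C2_def C1_def Z_def sum_2 algebra_simps add_divide_distrib)
  have Cw: "C1 r w x = C2 False r (gl g) x * C1 True q x + C2 True r (gl g) x * C1 False q x" for r
    unfolding C1_def[of r w] w_def trace2_mv[OF x] by (simp add: C2_def C1_def sum_2 algebra_simps)
  have CB: "C3 r a b B x = 1/3 * C3 a b r S x * of_real (normsq3 g S x)
      + 2/9 * (C3 a b r Z x + C3 a r b Z x + C3 b a r Z x + C3 b r a Z x + C3 r a b Z x + C3 r b a Z x)
      + 2/3 * (C2 b r (gl g) x * C1 a q x + C2 a r (gl g) x * C1 b q x - C2 a b (gl g) x * C1 r w x)" for r a b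
    by (simp add: C3_def C2_def C1_def B_def sym3_def sum_2 algebra_simps)
  have CN: "C3 r a b (nabla2 g (Xi g S t)) x = (if a = b then if a then DD r 2 \<xi> x else cnj (DD (\<not> r) 2 \<xi> x) else 0)" for r a b
  proof (cases "a = b")
    case True
    have "C3 r a a (nabla2 g (Xi g S t)) x = DD r (wt a + wt a) (\<lambda>y. if a then \<xi> y else cnj (\<xi> y)) x"
      unfolding C3_nabla2[OF x Xi_csm] by (rule DD_cong) (use x C2_Xi in auto)
    then show ?thesis using True x by (cases a) (simp_all add: DD_cnj)
  next
    case False
    have "C3 r a b (nabla2 g (Xi g S t)) x = DD r (wt a + wt b) (\<lambda>_. 0) x"
      unfolding C3_nabla2[OF x Xi_csm] by (rule DD_cong) (use x False C2_Xi in auto)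
    then show ?thesis using False by (simp add: DD_zero)
  qed
  have "C3 r a b (nabla2 g (Xi g S t)) x = C3 r a b B x" for r a b
    unfolding CN CB CZ Cw q z C3_S[OF x] C2_Xi[OF x] C2_gl[OF x] normsq3_S[OF x]
    by (cases r; cases a; cases b) (simp_all add: C1_t DD_True_\<xi>[OF x] DD_False_\<xi>[OF x] field_simps)
  then have "nabla2 g (Xi g S t) k i j x = B k i j x" by (rule C3_eqI[OF x])
  then show ?thesis unfolding B .
qed

lemma algebraic_condition_tensor:
  assumes x: "x \<in> U"
  shows "(2/3) * (\<Sum>a\<in>UNIV. Xi g S t i a x * up1 g (grad t) a x)
          + (4/9) * (\<Sum>a\<in>UNIV. \<Sum>b\<in>UNIV. S i a b x * up1 g (grad t) a x * up1 g (grad t) b x)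
          + (5/9) * normsq3 g S x * grad t i x
          - (\<Sum>a\<in>UNIV. \<Sum>b\<in>UNIV. S i a b x * up2 g (Xi g S t) a b x)
          = (1/2) * grad (scalar_curv g) i x - scalar_curv g x * grad t i x"
proof -
  define q :: tensor1 where "q = (\<lambda>i x. \<Sum>a\<in>UNIV. \<Sum>b\<in>UNIV. S i a b x * up2 g (Xi g S t) a b x)"
  define z :: tensor1 where "z = (\<lambda>i x. \<Sum>a\<in>UNIV. Xi g S t i a x * up1 g (grad t) a x)"
  define y :: tensor1 where "y = (\<lambda>i x. \<Sum>a\<in>UNIV. \<Sum>b\<in>UNIV. S i a b x * up1 g (grad t) a x * up1 g (grad t) b x)"
  define A :: tensor1 where "A = (\<lambda>i x. (2/3) * z i x + (4/9) * y i x + (5/9) * normsq3 g S x * grad t i x - q i x)"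
  define B :: tensor1 where "B = (\<lambda>i x. (1/2) * grad (scalar_curv g) i x - scalar_curv g x * grad t i x)"
  have q: "C1 a q x = (if a then s x * cnj (\<xi> x) else cnj (s x) * \<xi> x)" for a
    unfolding q_def by (rule S_up2_Xi[OF x])
  have z: "C1 a z x = (if a then \<xi> x * cnj (\<tau> x) else cnj (\<xi> x) * \<tau> x)" for a
    unfolding z_def by (rule Xi_up1_t[OF x])
  have "C1 a y x = C3 a True True S x * (cnj (\<tau> x) * cnj (\<tau> x)) + C3 a True False S x * (cnj (\<tau> x) * \<tau> x)
      + C3 a False True S x * (\<tau> x * cnj (\<tau> x)) + C3 a False False S x * (\<tau> x * \<tau> x)" for a
    unfolding y_def C1_def[of a] of_real_sum of_real_mult up1_mv[OF x] C1_t
    by (simp add: C3_def sum_2 algebra_simps)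
  then have y: "C1 a y x = (if a then s x * (cnj (\<tau> x) * cnj (\<tau> x)) else cnj (s x) * (\<tau> x * \<tau> x))" for a
    by (simp add: C3_S[OF x])
  have CA: "C1 a A x = 2/3 * C1 a z x + 4/9 * C1 a y x + 5/9 * of_real (normsq3 g S x) * C1 a (grad t) x - C1 a q x" for a
    by (simp add: A_def C1_def sum_2 algebra_simps)
  have CB: "C1 a B x = 1/2 * C1 a (grad (scalar_curv g)) x - R x * C1 a (grad t) x" for a
    by (simp add: B_def R_def C1_def sum_2 algebra_simps)
  have T: "C1 True A x = C1 True B x"
    using algebraic_condition[OF x] unfolding CA CB z y q normsq3_S[OF x] R_grad(1)[OF x, symmetric] C1_t
    by (simp add: algebra_simps)
  \<comment> \<open>Both sides are real tensors, so the component along \<open>cnj m\<close> is the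
    conjugate of the one along \<open>m\<close>.\<close>
  have "C1 a A x = C1 a B x" for a
    using T arg_cong[OF T, of cnj] unfolding cnj_C by (cases a) auto
  then have "A i x = B i x" by (rule C1_eqI[OF x])
  then show ?thesis unfolding A_def B_def q_def z_def y_def .
qed

end

theorem proposition4p4:
  fixes U :: "point set" and g :: metric and \<V> :: "scalar set" and \<F> :: "phase_fun set"
    and T S :: tensor3 and t :: scalar
  assumes "nondeg_superintegrable U g \<V> \<F>"
    and "structure_tensor U g \<V> T"
    and "structure_decomposition U g T S t"
  shows "\<forall>x\<in>U.
      laplacian g t x = (3/2) * scalar_curv g x + (1/3) * normsq3 g S x
    \<and> (\<forall>i j. tracefree_hess g t i j x =
          (\<Sum>a\<in>UNIV. S i j a x * up1 g (grad t) a x)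
          + (4/3) * (grad t i x * grad t j x
              - (1/2) * gl g i j x * (\<Sum>a\<in>UNIV. up1 g (grad t) a x * grad t a x))
          - (1/2) * Xi g S t i j x)
    \<and> (\<forall>l i j k. nabla3 g S l i j k x =
          (1/6) * sym3o g x (\<lambda>i j k. - (2/3) * S i j k x * grad t l x
              + 2 * grad t i x * S j k l x + Xi g S t i j x * gl g k l x) i j k)
    \<and> (\<forall>k i j. nabla2 g (Xi g S t) k i j x =
          (1/3) * S i j k x * normsq3 g S x
          + (2/9) * sym3 (\<lambda>i j k. Xi g S t j k x * grad t i x
              - (1/2) * gl g i j x * (\<Sum>a\<in>UNIV. Xi g S t k a x * up1 g (grad t) a x)) i j k
          + (2/3) * sym2o g x (\<lambda>i j. gl g j k x *
              (\<Sum>a\<in>UNIV. \<Sum>b\<in>UNIV. S i a b x * up2 g (Xi g S t) a b x)) i j)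
    \<and> (\<forall>i. (2/3) * (\<Sum>a\<in>UNIV. Xi g S t i a x * up1 g (grad t) a x)
          + (4/9) * (\<Sum>a\<in>UNIV. \<Sum>b\<in>UNIV. S i a b x * up1 g (grad t) a x * up1 g (grad t) b x)
          + (5/9) * normsq3 g S x * grad t i x
          - (\<Sum>a\<in>UNIV. \<Sum>b\<in>UNIV. S i a b x * up2 g (Xi g S t) a b x)
          = (1/2) * grad (scalar_curv g) i x - scalar_curv g x * grad t i x)"
proof -
  have "open U" "riemannian_metric U g"
    using assms(1) by (simp_all add: nondeg_superintegrable_def)
  then interpret metric2 U g by unfold_locales
  obtain m :: "2 \<Rightarrow> point \<Rightarrow> complex" where m: "\<And>i. csm U (m i)"
    "\<And>x. x \<in> U \<Longrightarrow> (\<Sum>i\<in>UNIV. \<Sum>j\<in>UNIV. of_real (gl g i j x) * m i x * m j x) = 0"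
    "\<And>x. x \<in> U \<Longrightarrow> (\<Sum>i\<in>UNIV. \<Sum>j\<in>UNIV. of_real (gl g i j x) * m i x * cnj (m j x)) = 1"
    using exists_null_frame by blast
  interpret system U g m \<V> \<F> T S t
    by unfold_locales (use m assms in auto)
  show ?thesis
    by (intro ballI conjI allI laplacian_t tracefree_hess_t nabla3_S nabla2_Xi algebraic_condition_tensor)
qed

end
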